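(* Let $(\overline{M}^{n+2},\overline{g})$ be a Lorentzian manifold and $(M,\zeta)$ a closed normalization of a connected non compact null hypersurface $M$. If the rigged vector field $\xi$ is complete and the screen distribution $\mathscr{S}(\zeta)$ has compact leaves, then $(M,\widetilde{g})$ is complete, where $\widetilde g$ is the rigged Riemannian metric.
   Context: A null hypersurface $M$ in a Lorentzian manifold $(\overline{M},\overline{g})$ is a smooth codimension-one submanifold such that the restriction of $\overline{g}$ to each $T_pM$ is degenerate. A rigging for $M$ is a vector field $\zeta$ on an open set containing $M$ with $\zeta_p\notin T_pM$ for each $p\in M$; the pair $(M,\zeta)$ is called a normalization, and it is closed if the $1$-form $\alpha=\overline{g}(\zeta,\cdot)$ is closed. With $i:M\hookrightarrow\overline{M}$ the inclusion and $\omega=i^{\star}\alpha$, the rigged metric is the Riemannian metric $\widetilde{g}=i^{\star}(\overline{g}+\alpha\otimes\alpha)$ on $M$; the rigged vector field $\xi$ is the vector field $\widetilde{g}$-equivalent to $\omega$ (the unique lightlike vector field tangent to $M$ with $\overline{g}(\zeta,\xi)=1$); the screen distribution is $\mathscr{S}(\zeta)=TM\cap\zeta^{\perp}=\ker\omega$, which is integrable when $\zeta$ is closed. *)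

theory Defs
  imports "HOL-Analysis.Analysis"
begin

section \<open>Smooth maps between Euclidean spaces\<close>

text \<open>\<open>Ck_on k S f\<close>: the map \<open>f\<close> is of class \<open>C\<^sup>k\<close> on \<open>S\<close>. Only meant for open \<open>S\<close>.\<close>

primrec Ck_on ::
  "nat \<Rightarrow> 'a::euclidean_space set \<Rightarrow> ('a \<Rightarrow> 'b::euclidean_space) \<Rightarrow> bool" where
  "Ck_on 0 S f \<longleftrightarrow> continuous_on S f"
| "Ck_on (Suc k) S f \<longleftrightarrow>
     (\<forall>x\<in>S. f differentiable (at x)) \<and> (\<forall>v. Ck_on k S (\<lambda>x. frechet_derivative f (at x) v))"

definition smooth_on :: "'a::euclidean_space set \<Rightarrow> ('a \<Rightarrow> 'b::euclidean_space) \<Rightarrow> bool" where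
  "smooth_on S f \<longleftrightarrow> (\<forall>k. Ck_on k S f)"


section \<open>Smooth manifolds\<close>

text \<open>
  The ambient manifold is a whole type \<open>'a\<close> (Hausdorff and second countable by its type classes)
  with an atlas \<open>A\<close>. A chart is a pair \<open>(U, \<phi>)\<close>; the values of \<open>\<phi>\<close> outside \<open>U\<close> are irrelevant.
\<close>

type_synonym ('a, 'e) chart = "'a set \<times> ('a \<Rightarrow> 'e)"

definition chart_inv :: "('a, 'e) chart \<Rightarrow> 'e \<Rightarrow> 'a" where
  "chart_inv c = inv_into (fst c) (snd c)"

definition is_chart :: "('a::topological_space, 'e::euclidean_space) chart \<Rightarrow> bool" where
  "is_chart c \<longleftrightarrow> open (fst c) \<and> open (snd c ` fst c) \<and>
     homeomorphism (fst c) (snd c ` fst c) (snd c) (chart_inv c)"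

definition transition :: "('a, 'e) chart \<Rightarrow> ('a, 'e) chart \<Rightarrow> 'e \<Rightarrow> 'e" where
  "transition c d = snd d \<circ> chart_inv c"

definition compatible ::
  "('a::topological_space, 'e::euclidean_space) chart \<Rightarrow> ('a, 'e) chart \<Rightarrow> bool" where
  "compatible c d \<longleftrightarrow>
     smooth_on (snd c ` (fst c \<inter> fst d)) (transition c d) \<and>
     smooth_on (snd d ` (fst c \<inter> fst d)) (transition d c)"

definition smooth_atlas :: "('a::topological_space, 'e::euclidean_space) chart set \<Rightarrow> bool" where
  "smooth_atlas A \<longleftrightarrow> (\<forall>c\<in>A. is_chart c) \<and> (\<forall>c\<in>A. \<forall>d\<in>A. compatible c d) \<and> (\<Union>c\<in>A. fst c) = UNIV"

definition max_atlas ::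
  "('a::topological_space, 'e::euclidean_space) chart set \<Rightarrow> ('a, 'e) chart set" where
  "max_atlas A = {c. is_chart c \<and> (\<forall>d\<in>A. compatible c d)}"


section \<open>Tangent vectors and tensor fields\<close>

text \<open>
  A tangent vector at \<open>p\<close> is the family of its components in the charts of \<open>A\<close> around \<open>p\<close>, any two
  of them being related by the Jacobian of the change of charts; the family is \<open>0\<close> at all other
  charts. In particular \<open>\<lambda>_. 0\<close> is the zero vector at every point.
\<close>

type_synonym ('a, 'e) tvec = "('a, 'e) chart \<Rightarrow> 'e"

definition jacobian ::
  "('a, 'e::euclidean_space) chart \<Rightarrow> ('a, 'e) chart \<Rightarrow> 'a \<Rightarrow> 'e \<Rightarrow> 'e" where
  "jacobian c d p = frechet_derivative (transition c d) (at (snd c p))"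

definition tangent_space ::
  "('a, 'e::euclidean_space) chart set \<Rightarrow> 'a \<Rightarrow> ('a, 'e) tvec set" where
  "tangent_space A p = {v.
     (\<forall>c. c \<notin> A \<or> p \<notin> fst c \<longrightarrow> v c = 0) \<and>
     (\<forall>c\<in>A. \<forall>d\<in>A. p \<in> fst c \<inter> fst d \<longrightarrow> v d = jacobian c d p (v c))}"

text \<open>The tangent vector at \<open>p\<close> whose component in the chart \<open>c \<in> A\<close> is \<open>u\<close>.\<close>

definition coord_vec ::
  "('a, 'e::euclidean_space) chart set \<Rightarrow> ('a, 'e) chart \<Rightarrow> 'a \<Rightarrow> 'e \<Rightarrow> ('a, 'e) tvec" where
  "coord_vec A c p u = (\<lambda>d. if d \<in> A \<and> p \<in> fst d then jacobian c d p u else 0)"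

definition smooth_vector_field ::
  "('a::topological_space, 'e::euclidean_space) chart set \<Rightarrow> 'a set \<Rightarrow> ('a \<Rightarrow> ('a, 'e) tvec) \<Rightarrow> bool"
  where
  "smooth_vector_field A W X \<longleftrightarrow>
     (\<forall>p\<in>W. X p \<in> tangent_space A p) \<and>
     (\<forall>c\<in>A. smooth_on (snd c ` (fst c \<inter> W)) (\<lambda>x. X (chart_inv c x) c))"

text \<open>
  \<open>B\<close> is a scalar product of signature \<open>(-,+,\<dots>,+)\<close>: it takes the standard Minkowski form in some
  linear coordinates. (This makes \<open>B\<close> bilinear and symmetric.)
\<close>

definition lorentz_form :: "('e::euclidean_space \<Rightarrow> 'e \<Rightarrow> real) \<Rightarrow> bool" where
  "lorentz_form B \<longleftrightarrow> (\<exists>(L :: 'e \<Rightarrow> 'e) b0. linear L \<and> bij L \<and> b0 \<in> Basis \<and>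
     (\<forall>x y. B (L x) (L y) = (\<Sum>b\<in>Basis - {b0}. (x \<bullet> b) * (y \<bullet> b)) - (x \<bullet> b0) * (y \<bullet> b0)))"

definition lorentzian_metric ::
  "('a::topological_space, 'e::euclidean_space) chart set \<Rightarrow>
   ('a \<Rightarrow> ('a, 'e) tvec \<Rightarrow> ('a, 'e) tvec \<Rightarrow> real) \<Rightarrow> bool" where
  "lorentzian_metric A g \<longleftrightarrow> (\<forall>c\<in>A.
     (\<forall>p\<in>fst c. lorentz_form (\<lambda>u v. g p (coord_vec A c p u) (coord_vec A c p v))) \<and>
     (\<forall>u v. smooth_on (snd c ` fst c)
        (\<lambda>x. g (chart_inv c x) (coord_vec A c (chart_inv c x) u) (coord_vec A c (chart_inv c x) v))))"

text \<open>
  \<open>d\<alpha> = 0\<close> on the open set \<open>W\<close>: in the coordinates of each chart,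
  \<open>d\<alpha>(u, v) = \<partial>\<^sub>u (\<alpha>(v)) - \<partial>\<^sub>v (\<alpha>(u))\<close> for constant \<open>u\<close>, \<open>v\<close>.
\<close>

definition closed_form_on ::
  "('a::topological_space, 'e::euclidean_space) chart set \<Rightarrow> 'a set \<Rightarrow>
   ('a \<Rightarrow> ('a, 'e) tvec \<Rightarrow> real) \<Rightarrow> bool" where
  "closed_form_on A W \<alpha> \<longleftrightarrow> (\<forall>c\<in>A. \<forall>x\<in>snd c ` (fst c \<inter> W). \<forall>u v.
     frechet_derivative (\<lambda>y. \<alpha> (chart_inv c y) (coord_vec A c (chart_inv c y) v)) (at x) u -
     frechet_derivative (\<lambda>y. \<alpha> (chart_inv c y) (coord_vec A c (chart_inv c y) u)) (at x) v = 0)"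


section \<open>Submanifolds\<close>

text \<open>
  A submanifold is given by its own topology \<open>T\<close>, whose underlying set \<open>topspace T\<close> consists of
  points of the ambient manifold: \<open>T\<close>-locally it carries the ambient topology and is a slice of
  an ambient chart. These are the images of injective immersions with their intrinsic
  topology (an immersion is locally an embedding), and \<open>M\<close> is embedded iff \<open>T = top_of_set M\<close>.
  Such a \<open>T\<close> is Hausdorff; second countability is automatic when \<open>T\<close> is connected, which is the only
  case used below.
\<close>

definition submanifold ::
  "('a::topological_space, 'e::euclidean_space) chart set \<Rightarrow> nat \<Rightarrow> 'a topology \<Rightarrow> bool" where
  "submanifold A k T \<longleftrightarrow> (\<forall>p\<in>topspace T. \<exists>U c V.
     openin T U \<and> p \<in> U \<and> subtopology T U = top_of_set U \<and>
     c \<in> max_atlas A \<and> U \<subseteq> fst c \<and> subspace V \<and> dim V = k \<and>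
     snd c ` U = snd c ` fst c \<inter> V)"

text \<open>Smooth curves in a submanifold, defined on an open set \<open>J\<close> of parameters.\<close>

definition smooth_curve ::
  "('a::topological_space, 'e::euclidean_space) chart set \<Rightarrow> 'a topology \<Rightarrow> real set \<Rightarrow>
   (real \<Rightarrow> 'a) \<Rightarrow> bool" where
  "smooth_curve A T J \<gamma> \<longleftrightarrow> continuous_map (top_of_set J) T \<gamma> \<and>
     (\<forall>c\<in>A. smooth_on (J \<inter> \<gamma> -` fst c) (snd c \<circ> \<gamma>))"

definition velocity ::
  "('a, 'e::euclidean_space) chart set \<Rightarrow> (real \<Rightarrow> 'a) \<Rightarrow> real \<Rightarrow> ('a, 'e) tvec" where
  "velocity A \<gamma> t =
     (\<lambda>c. if c \<in> A \<and> \<gamma> t \<in> fst c then vector_derivative (snd c \<circ> \<gamma>) (at t) else 0)"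

definition sub_tangent_space ::
  "('a::topological_space, 'e::euclidean_space) chart set \<Rightarrow> 'a topology \<Rightarrow> 'a \<Rightarrow> ('a, 'e) tvec set"
  where
  "sub_tangent_space A T p =
     {velocity A \<gamma> 0 | \<gamma> e. e > 0 \<and> smooth_curve A T {-e<..<e} \<gamma> \<and> \<gamma> 0 = p}"

definition complete_vector_field ::
  "('a::topological_space, 'e::euclidean_space) chart set \<Rightarrow> 'a topology \<Rightarrow>
   ('a \<Rightarrow> ('a, 'e) tvec) \<Rightarrow> bool" where
  "complete_vector_field A T X \<longleftrightarrow> (\<forall>p\<in>topspace T. \<exists>\<gamma>.
     smooth_curve A T UNIV \<gamma> \<and> \<gamma> 0 = p \<and> (\<forall>t. velocity A \<gamma> t = X (\<gamma> t)))"

text \<open>Leaves of a distribution \<open>D\<close> on \<open>T\<close>: maximal connected integral manifolds.\<close>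

definition integral_manifold ::
  "('a::topological_space, 'e::euclidean_space) chart set \<Rightarrow> 'a topology \<Rightarrow>
   ('a \<Rightarrow> ('a, 'e) tvec set) \<Rightarrow> 'a topology \<Rightarrow> bool" where
  "integral_manifold A T D N \<longleftrightarrow>
     (\<exists>k. submanifold A k N) \<and> topspace N \<noteq> {} \<and> connected_space N \<and>
     topspace N \<subseteq> topspace T \<and> continuous_map N T id \<and>
     (\<forall>p\<in>topspace N. sub_tangent_space A N p = D p)"

definition leaf ::
  "('a::topological_space, 'e::euclidean_space) chart set \<Rightarrow> 'a topology \<Rightarrow>
   ('a \<Rightarrow> ('a, 'e) tvec set) \<Rightarrow> 'a topology \<Rightarrow> bool" where
  "leaf A T D L \<longleftrightarrow> integral_manifold A T D L \<and>
     (\<forall>N. integral_manifold A T D N \<and> topspace L \<subseteq> topspace N \<longrightarrow> topspace N = topspace L)"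


section \<open>Riemannian distance and completeness\<close>

text \<open>
  In this section \<open>h\<close> is a Riemannian metric on the submanifold \<open>T\<close>; only its values on vectors
  tangent to \<open>T\<close> matter.
\<close>

definition smooth_segment ::
  "('a::topological_space, 'e::euclidean_space) chart set \<Rightarrow> 'a topology \<Rightarrow> real \<Rightarrow> real \<Rightarrow>
   (real \<Rightarrow> 'a) \<Rightarrow> bool" where
  "smooth_segment A T s t \<gamma> \<longleftrightarrow> (\<exists>J \<eta>. open J \<and> {s..t} \<subseteq> J \<and> smooth_curve A T J \<eta> \<and>
     (\<forall>r\<in>{s..t}. \<gamma> r = \<eta> r))"

definition piecewise_smooth_path ::
  "('a::topological_space, 'e::euclidean_space) chart set \<Rightarrow> 'a topology \<Rightarrow> (real \<Rightarrow> 'a) \<Rightarrow> bool"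
  where
  "piecewise_smooth_path A T \<gamma> \<longleftrightarrow> (\<exists>K. finite K \<and> {0, 1} \<subseteq> K \<and> K \<subseteq> {0..1} \<and>
     (\<forall>s\<in>K. \<forall>t\<in>K. s < t \<and> {s<..<t} \<inter> K = {} \<longrightarrow> smooth_segment A T s t \<gamma>))"

definition curve_length ::
  "('a, 'e::euclidean_space) chart set \<Rightarrow>
   ('a \<Rightarrow> ('a, 'e) tvec \<Rightarrow> ('a, 'e) tvec \<Rightarrow> real) \<Rightarrow> (real \<Rightarrow> 'a) \<Rightarrow> real" where
  "curve_length A h \<gamma> =
     integral {0..1} (\<lambda>t. sqrt (h (\<gamma> t) (velocity A \<gamma> t) (velocity A \<gamma> t)))"

text \<open>
  The value \<open>0\<close> when no path exists is a junk value: it never occurs between points of a connected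
  submanifold.
\<close>

definition riemannian_distance ::
  "('a::topological_space, 'e::euclidean_space) chart set \<Rightarrow> 'a topology \<Rightarrow>
   ('a \<Rightarrow> ('a, 'e) tvec \<Rightarrow> ('a, 'e) tvec \<Rightarrow> real) \<Rightarrow> 'a \<Rightarrow> 'a \<Rightarrow> real" where
  "riemannian_distance A T h p q =
     (let \<Gamma> = {\<gamma>. piecewise_smooth_path A T \<gamma> \<and> \<gamma> 0 = p \<and> \<gamma> 1 = q}
      in if \<Gamma> = {} then 0 else Inf (curve_length A h ` \<Gamma>))"

definition riemannian_complete ::
  "('a::topological_space, 'e::euclidean_space) chart set \<Rightarrow> 'a topology \<Rightarrow>
   ('a \<Rightarrow> ('a, 'e) tvec \<Rightarrow> ('a, 'e) tvec \<Rightarrow> real) \<Rightarrow> bool" where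
  "riemannian_complete A T h \<longleftrightarrow>
     Metric_space (topspace T) (riemannian_distance A T h) \<and>
     Metric_space.mcomplete (topspace T) (riemannian_distance A T h)"


section \<open>Null hypersurfaces and riggings\<close>

definition null_hypersurface ::
  "('a::topological_space, 'e::euclidean_space) chart set \<Rightarrow>
   ('a \<Rightarrow> ('a, 'e) tvec \<Rightarrow> ('a, 'e) tvec \<Rightarrow> real) \<Rightarrow> 'a topology \<Rightarrow> bool" where
  "null_hypersurface A g T \<longleftrightarrow> submanifold A (DIM('e) - 1) T \<and>
     (\<forall>p\<in>topspace T. \<exists>v\<in>sub_tangent_space A T p. v \<noteq> (\<lambda>_. 0) \<and>
        (\<forall>w\<in>sub_tangent_space A T p. g p v w = 0))"

definition rigging ::
  "('a::topological_space, 'e::euclidean_space) chart set \<Rightarrow> 'a topology \<Rightarrow> 'a set \<Rightarrow>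
   ('a \<Rightarrow> ('a, 'e) tvec) \<Rightarrow> bool" where
  "rigging A T W \<zeta> \<longleftrightarrow> open W \<and> topspace T \<subseteq> W \<and> smooth_vector_field A W \<zeta> \<and>
     (\<forall>p\<in>topspace T. \<zeta> p \<notin> sub_tangent_space A T p)"

definition rigging_form ::
  "('a \<Rightarrow> ('a, 'e) tvec \<Rightarrow> ('a, 'e) tvec \<Rightarrow> real) \<Rightarrow> ('a \<Rightarrow> ('a, 'e) tvec) \<Rightarrow>
   'a \<Rightarrow> ('a, 'e) tvec \<Rightarrow> real" where
  "rigging_form g \<zeta> p v = g p (\<zeta> p) v"

definition closed_normalization ::
  "('a::topological_space, 'e::euclidean_space) chart set \<Rightarrow>
   ('a \<Rightarrow> ('a, 'e) tvec \<Rightarrow> ('a, 'e) tvec \<Rightarrow> real) \<Rightarrow> 'a topology \<Rightarrow> 'a set \<Rightarrow>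
   ('a \<Rightarrow> ('a, 'e) tvec) \<Rightarrow> bool" where
  "closed_normalization A g T W \<zeta> \<longleftrightarrow> null_hypersurface A g T \<and> rigging A T W \<zeta> \<and>
     closed_form_on A W (rigging_form g \<zeta>)"

text \<open>The pullback along the inclusion consists in using this only on tangent vectors to \<open>T\<close>.\<close>

definition rigged_metric ::
  "('a \<Rightarrow> ('a, 'e) tvec \<Rightarrow> ('a, 'e) tvec \<Rightarrow> real) \<Rightarrow> ('a \<Rightarrow> ('a, 'e) tvec) \<Rightarrow>
   'a \<Rightarrow> ('a, 'e) tvec \<Rightarrow> ('a, 'e) tvec \<Rightarrow> real" where
  "rigged_metric g \<zeta> p u v = g p u v + rigging_form g \<zeta> p u * rigging_form g \<zeta> p v"

definition rigged_vector_field ::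
  "('a::topological_space, 'e::euclidean_space) chart set \<Rightarrow>
   ('a \<Rightarrow> ('a, 'e) tvec \<Rightarrow> ('a, 'e) tvec \<Rightarrow> real) \<Rightarrow> 'a topology \<Rightarrow>
   ('a \<Rightarrow> ('a, 'e) tvec) \<Rightarrow> 'a \<Rightarrow> ('a, 'e) tvec" where
  "rigged_vector_field A g T \<zeta> p = (THE v. v \<in> sub_tangent_space A T p \<and>
     (\<forall>w\<in>sub_tangent_space A T p. rigged_metric g \<zeta> p v w = rigging_form g \<zeta> p w))"

definition screen_distribution ::
  "('a::topological_space, 'e::euclidean_space) chart set \<Rightarrow>
   ('a \<Rightarrow> ('a, 'e) tvec \<Rightarrow> ('a, 'e) tvec \<Rightarrow> real) \<Rightarrow> 'a topology \<Rightarrow>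
   ('a \<Rightarrow> ('a, 'e) tvec) \<Rightarrow> 'a \<Rightarrow> ('a, 'e) tvec set" where
  "screen_distribution A g T \<zeta> p = {v \<in> sub_tangent_space A T p. g p (\<zeta> p) v = 0}"

end

theory Submission
  imports Defs
begin

text \<open>
  On the tangent spaces of a null hypersurface the Lorentzian metric is positive semidefinite, with
  null directions spanned by the rigged field \<open>\<xi>\<close>, and \<open>\<omega>(\<xi>) = 1\<close>. Hence the rigged metric is positive
  definite, \<open>\<xi>\<close> has unit length, and \<open>\<bar>\<omega>(v)\<bar>\<close> is at most the rigged length of \<open>v\<close> (\<open>null_slice\<close>,
  \<open>rigged_metric_nonneg\<close>).

  Since \<open>\<omega>\<close> is closed and \<open>\<omega>(\<xi>) = 1\<close>, the flow \<open>\<phi>\<close> of \<open>\<xi>\<close> preserves \<open>\<omega>\<close> and maps leaves of the screen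
  distribution \<open>ker \<omega>\<close> to leaves. Let \<open>\<gamma>\<close> be a path that starts at \<open>p\<close>, and let \<open>\<sigma>(s)\<close> be the integral of
  \<open>\<omega>\<close> along \<open>\<gamma>\<close> up to the parameter \<open>s\<close>. Then \<open>s \<mapsto> \<phi>(-\<sigma>(s), \<gamma>(s))\<close> is a path in the leaf \<open>L\<close> of \<open>p\<close>
  (\<open>transport_along_curve\<close>), and \<open>\<bar>\<sigma>\<bar>\<close> is bounded by the length of \<open>\<gamma>\<close>. So the ball of radius \<open>r\<close> around
  \<open>p\<close> lies in the tube \<open>\<phi>([-r, r] \<times> L)\<close> (\<open>path_in_tube\<close>), which is compact because \<open>L\<close> is compact and the
  flow is complete (\<open>compactin_tube\<close>). A Cauchy sequence therefore has a cluster point for the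
  topology of the hypersurface, which is its limit for the distance (\<open>rigged_metric_complete\<close>).

  The argument is local in charts adapted to \<open>\<omega>\<close> (\<open>adapted_exists\<close>): slice charts of the hypersurface
  in which \<open>\<omega>\<close> is the differential of a linear coordinate. They come from a local primitive of \<open>\<omega>\<close>
  (\<open>poincare_ball\<close>) and the inverse function theorem. The level sets of the local primitives generate
  the leaf topology, finer than the topology of the hypersurface. Its components, with the subspace
  topology, are leaves of the screen distribution (\<open>leaf_through\<close>), so they are compact in the leaf
  topology. That the flow preserves \<open>\<omega>\<close> takes the form that, for each fixed time, it is continuous for
  the leaf topology (\<open>leaf_cont_all\<close>). This needs no smooth dependence of the flow on initial points:
  \<open>\<xi>\<close> is locally Lipschitz in charts (\<open>xi_lipschitz\<close>), and a Gronwall estimate suffices.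

  Bump functions (\<open>bump_derivative\<close>) keep integral curves inside charts for a uniform time and show
  that the rigged distance separates points.
\<close>

section \<open>Calculus of smooth maps\<close>

lemma Ck_on_subset: "Ck_on k S f \<Longrightarrow> S' \<subseteq> S \<Longrightarrow> Ck_on k S' f"
  by (induction k arbitrary: f) (auto intro: continuous_on_subset)

lemma Ck_on_cong_imp:
  assumes "Ck_on k S f" "open S" "\<And>x. x \<in> S \<Longrightarrow> f x = g x"
  shows "Ck_on k S g"
  using assms
proof (induction k arbitrary: f g)
  case 0
  then show ?case by (simp cong: continuous_on_cong)
next
  case (Suc k)
  have "(g has_derivative frechet_derivative f (at x)) (at x)" if "x \<in> S" for x
    by (rule has_derivative_transform_within_open[of f _ x UNIV S])
      (use Suc.prems that in \<open>auto simp: frechet_derivative_works[symmetric]\<close>)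
  then have "g differentiable (at x)" "frechet_derivative g (at x) = frechet_derivative f (at x)"
    if "x \<in> S" for x
    using that by (auto simp: differentiable_def intro: frechet_derivative_at[symmetric])
  note g = this
  have "Ck_on k S (\<lambda>x. frechet_derivative g (at x) v)" for v
    by (rule Suc.IH[of "\<lambda>x. frechet_derivative f (at x) v"]) (use Suc.prems g in auto)
  with g show ?case
    by auto
qed

text \<open>A derivative known in closed form can replace \<open>frechet_derivative\<close> in the definition of the
  class \<open>C\<^sup>k\<^sup>+\<^sup>1\<close>.\<close>

lemma Ck_on_SucI:
  assumes "open S" "\<And>x. x \<in> S \<Longrightarrow> (f has_derivative f' x) (at x)"
    and "\<And>v. Ck_on k S (\<lambda>x. f' x v)"
  shows "Ck_on (Suc k) S f"
proof -
  have "frechet_derivative f (at x) = f' x" if "x \<in> S" for x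
    using frechet_derivative_at[OF assms(2)[OF that]] by simp
  then show ?thesis
    using assms by (auto simp: differentiable_def intro: Ck_on_cong_imp[OF assms(3)])
qed

lemma Ck_on_has_derivative:
  "Ck_on (Suc k) S f \<Longrightarrow> x \<in> S \<Longrightarrow> (f has_derivative frechet_derivative f (at x)) (at x)"
  by (simp add: frechet_derivative_works[symmetric])

lemma Ck_on_SucD: "Ck_on (Suc k) S f \<Longrightarrow> Ck_on k S f"
proof (induction k arbitrary: f)
  case 0
  then show ?case
    by (auto intro!: continuous_at_imp_continuous_on differentiable_imp_continuous_within)
qed auto

lemma Ck_on_local:
  assumes "\<And>x. x \<in> S \<Longrightarrow> \<exists>U. open U \<and> x \<in> U \<and> Ck_on k U f"
  shows "Ck_on k S f"
  using assms
proof (induction k arbitrary: f)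
  case 0
  have "isCont f x" if "x \<in> S" for x
    using 0[OF that] by (auto simp: continuous_on_eq_continuous_at)
  then show ?case
    by (auto intro: continuous_at_imp_continuous_on)
next
  case (Suc k)
  have "f differentiable (at x)" if "x \<in> S" for x
    using Suc.prems[OF that] by auto
  moreover have "Ck_on k S (\<lambda>x. frechet_derivative f (at x) v)" for v
    using Suc.prems by (intro Suc.IH) fastforce
  ultimately show ?case by simp
qed

lemma Ck_on_const: "open S \<Longrightarrow> Ck_on k S (\<lambda>x. c)"
proof (induction k arbitrary: c)
  case (Suc k)
  then show ?case
    by (intro Ck_on_SucI[where f' = "\<lambda>_ _. 0"]) auto
qed auto

lemma Ck_on_id: "open S \<Longrightarrow> Ck_on k S (\<lambda>x. x)"
proof (cases k)
  case (Suc m)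
  assume "open S"
  then show ?thesis
    unfolding Suc by (intro Ck_on_SucI[where f' = "\<lambda>_ v. v"]) (auto intro: Ck_on_const)
qed auto

lemma Ck_on_linear:
  assumes "open S" "bounded_linear L" "Ck_on k S f"
  shows "Ck_on k S (\<lambda>x. L (f x))"
  using assms(3)
proof (induction k arbitrary: f)
  case 0
  then show ?case
    using bounded_linear.continuous_on[OF assms(2)] by simp
next
  case (Suc k)
  show ?case
  proof (rule Ck_on_SucI[where f' = "\<lambda>x v. L (frechet_derivative f (at x) v)"])
    show "Ck_on k S (\<lambda>x. L (frechet_derivative f (at x) v))" for v
      using Suc by simp
    show "((\<lambda>x. L (f x)) has_derivative (\<lambda>v. L (frechet_derivative f (at x) v))) (at x)" if "x \<in> S" for x
      by (rule bounded_linear.has_derivative[OF assms(2) Ck_on_has_derivative[OF Suc.prems that]])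
  qed (rule assms(1))
qed

lemma Ck_on_add:
  assumes "open S" "Ck_on k S f" "Ck_on k S g"
  shows "Ck_on k S (\<lambda>x. f x + g x)"
  using assms(2,3)
proof (induction k arbitrary: f g)
  case 0
  then show ?case by (auto intro: continuous_on_add)
next
  case (Suc k)
  show ?case
  proof (rule Ck_on_SucI[where f' = "\<lambda>x v. frechet_derivative f (at x) v + frechet_derivative g (at x) v"])
    show "Ck_on k S (\<lambda>x. frechet_derivative f (at x) v + frechet_derivative g (at x) v)" for v
      using Suc by simp
  qed (use assms(1) Suc in \<open>auto intro!: derivative_intros Ck_on_has_derivative\<close>)
qed

lemma Ck_on_sum:
  assumes "open S" "\<And>i. i \<in> I \<Longrightarrow> Ck_on k S (f i)"
  shows "Ck_on k S (\<lambda>x. \<Sum>i\<in>I. f i x)"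
  using assms(2)
  by (induction I rule: infinite_finite_induct) (auto intro!: Ck_on_const Ck_on_add assms(1))

lemma Ck_on_scaleR:
  fixes f :: "'a::euclidean_space \<Rightarrow> real" and g :: "'a \<Rightarrow> 'b::euclidean_space"
  assumes "open S" "Ck_on k S f" "Ck_on k S g"
  shows "Ck_on k S (\<lambda>x. f x *\<^sub>R g x)"
  using assms(2,3)
proof (induction k arbitrary: f g)
  case 0
  then show ?case by (auto intro: continuous_on_scaleR)
next
  case (Suc k)
  show ?case
  proof (rule Ck_on_SucI[where f' = "\<lambda>x v. f x *\<^sub>R frechet_derivative g (at x) v + frechet_derivative f (at x) v *\<^sub>R g x"])
    show "Ck_on k S (\<lambda>x. f x *\<^sub>R frechet_derivative g (at x) v + frechet_derivative f (at x) v *\<^sub>R g x)" for v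
      using Suc.prems Ck_on_SucD[OF Suc.prems(1)] Ck_on_SucD[OF Suc.prems(2)]
      by (intro Ck_on_add assms(1) Suc.IH) auto
  qed (use assms(1) Suc in \<open>auto intro!: derivative_intros Ck_on_has_derivative\<close>)
qed

lemma linear_expand_Basis:
  fixes L :: "'a::euclidean_space \<Rightarrow> 'b::real_vector"
  shows "linear L \<Longrightarrow> L w = (\<Sum>b\<in>Basis. (w \<bullet> b) *\<^sub>R L b)"
  by (subst euclidean_representation[symmetric]) (simp only: linear_sum linear_cmul)

text \<open>The derivative of a composition is expanded over the basis: this reduces the induction to sums
  and products of \<open>C\<^sup>k\<close> maps.\<close>

lemma Ck_on_compose:
  fixes f :: "'a::euclidean_space \<Rightarrow> 'b::euclidean_space" and g :: "'b \<Rightarrow> 'c::euclidean_space"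
  assumes "open S" "Ck_on k S f" "Ck_on k U g" "f ` S \<subseteq> U"
  shows "Ck_on k S (\<lambda>x. g (f x))"
  using assms(2-)
proof (induction k arbitrary: g)
  case 0
  then show ?case by (auto intro: continuous_on_compose2)
next
  case (Suc k)
  let ?f' = "\<lambda>x. frechet_derivative f (at x)" and ?g' = "\<lambda>x. frechet_derivative g (at x)"
  have f': "(f has_derivative ?f' x) (at x)" if "x \<in> S" for x
    using that Suc.prems by (auto intro: Ck_on_has_derivative)
  have g': "(g has_derivative ?g' (f x)) (at (f x))" if "x \<in> S" for x
    using that Suc.prems by (auto intro!: Ck_on_has_derivative)
  show ?case
  proof (rule Ck_on_SucI[where f' = "\<lambda>x v. \<Sum>b\<in>Basis. (?f' x v \<bullet> b) *\<^sub>R ?g' (f x) b"])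
    fix x assume x: "x \<in> S"
    have "linear (?g' (f x))"
      using g'[OF x] has_derivative_linear by blast
    then have "(\<lambda>v. \<Sum>b\<in>Basis. (?f' x v \<bullet> b) *\<^sub>R ?g' (f x) b) = (\<lambda>v. ?g' (f x) (?f' x v))"
      by (intro ext linear_expand_Basis[symmetric])
    then show "((\<lambda>x. g (f x)) has_derivative (\<lambda>v. \<Sum>b\<in>Basis. (?f' x v \<bullet> b) *\<^sub>R ?g' (f x) b)) (at x)"
      using has_derivative_compose[OF f'[OF x] g'[OF x]] by simp
  next
    fix v
    have "Ck_on k S (\<lambda>x. ?g' (f x) b)" for b
      using Suc.prems Ck_on_SucD[OF Suc.prems(1)] by (intro Suc.IH[of "\<lambda>y. ?g' y b"]) auto
    moreover have "Ck_on k S (\<lambda>x. ?f' x v \<bullet> b)" for b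
      using Suc.prems by (intro Ck_on_linear[OF assms(1) bounded_linear_inner_left]) auto
    ultimately show "Ck_on k S (\<lambda>x. \<Sum>b\<in>Basis. (?f' x v \<bullet> b) *\<^sub>R ?g' (f x) b)"
      by (intro Ck_on_sum Ck_on_scaleR assms(1))
  qed (rule assms(1))
qed

lemma Ck_on_inverse:
  fixes f :: "'a::euclidean_space \<Rightarrow> real"
  assumes "open S" "Ck_on k S f" "\<And>x. x \<in> S \<Longrightarrow> f x \<noteq> 0"
  shows "Ck_on k S (\<lambda>x. inverse (f x))"
  using assms(2)
proof (induction k)
  case 0
  then show ?case using assms(3) by (auto intro: continuous_on_inverse)
next
  case (Suc k)
  show ?case
  proof (rule Ck_on_SucI[where f' = "\<lambda>x v. (-1) *\<^sub>R (inverse (f x) *\<^sub>R frechet_derivative f (at x) v *\<^sub>R inverse (f x))"])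
    show "Ck_on k S (\<lambda>x. (-1) *\<^sub>R (inverse (f x) *\<^sub>R frechet_derivative f (at x) v *\<^sub>R inverse (f x)))" for v
      using Suc Ck_on_SucD[OF Suc.prems]
      by (intro Ck_on_scaleR[OF assms(1)] Ck_on_const[OF assms(1)]) auto
    show "((\<lambda>x. inverse (f x)) has_derivative
       (\<lambda>v. (-1) *\<^sub>R (inverse (f x) *\<^sub>R frechet_derivative f (at x) v *\<^sub>R inverse (f x)))) (at x)" if "x \<in> S" for x
      using Deriv.has_derivative_inverse[OF assms(3)[OF that] Ck_on_has_derivative[OF Suc.prems that]] by (simp add: mult.assoc)
  qed (rule assms(1))
qed

lemma smooth_on_subset: "smooth_on S f \<Longrightarrow> S' \<subseteq> S \<Longrightarrow> smooth_on S' f"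
  by (auto simp: smooth_on_def intro: Ck_on_subset)

lemma smooth_on_cong_imp:
  "smooth_on S f \<Longrightarrow> open S \<Longrightarrow> (\<And>x. x \<in> S \<Longrightarrow> f x = g x) \<Longrightarrow> smooth_on S g"
  by (auto simp: smooth_on_def intro: Ck_on_cong_imp)

lemma smooth_on_local:
  "(\<And>x. x \<in> S \<Longrightarrow> \<exists>U. open U \<and> x \<in> U \<and> smooth_on U f) \<Longrightarrow> smooth_on S f"
  unfolding smooth_on_def by (intro allI Ck_on_local) blast

lemma smooth_on_const: "open S \<Longrightarrow> smooth_on S (\<lambda>x. c)"
  and smooth_on_id: "open S \<Longrightarrow> smooth_on S (\<lambda>x. x)"
  and smooth_on_linear: "open S \<Longrightarrow> bounded_linear L \<Longrightarrow> smooth_on S f \<Longrightarrow> smooth_on S (\<lambda>x. L (f x))"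
  and smooth_on_add: "open S \<Longrightarrow> smooth_on S f \<Longrightarrow> smooth_on S g \<Longrightarrow> smooth_on S (\<lambda>x. f x + g x)"
  and smooth_on_sum: "open S \<Longrightarrow> (\<And>i. i \<in> I \<Longrightarrow> smooth_on S (F i)) \<Longrightarrow> smooth_on S (\<lambda>x. \<Sum>i\<in>I. F i x)"
  and smooth_on_scaleR: "open S \<Longrightarrow> smooth_on S r \<Longrightarrow> smooth_on S g \<Longrightarrow> smooth_on S (\<lambda>x. r x *\<^sub>R g x)"
  and smooth_on_mult: "open S \<Longrightarrow> smooth_on S r \<Longrightarrow> smooth_on S r' \<Longrightarrow> smooth_on S (\<lambda>x. r x * r' x :: real)"
  and smooth_on_compose: "open S \<Longrightarrow> smooth_on S f \<Longrightarrow> smooth_on U h \<Longrightarrow> f ` S \<subseteq> U \<Longrightarrow> smooth_on S (\<lambda>x. h (f x))"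
  unfolding smooth_on_def
  using Ck_on_scaleR[where 'b = real, simplified]
  by (blast intro: Ck_on_const Ck_on_id Ck_on_linear Ck_on_add Ck_on_sum Ck_on_scaleR Ck_on_compose)+

lemma smooth_on_diff: "open S \<Longrightarrow> smooth_on S f \<Longrightarrow> smooth_on S g \<Longrightarrow> smooth_on S (\<lambda>x. f x - g x)"
  using smooth_on_add[of S f "\<lambda>x. - g x"] smooth_on_linear[OF _ bounded_linear_minus[OF bounded_linear_ident], of S g]
  by simp

lemma smooth_on_has_derivative:
  "smooth_on S f \<Longrightarrow> x \<in> S \<Longrightarrow> (f has_derivative frechet_derivative f (at x)) (at x)"
  using Ck_on_has_derivative unfolding smooth_on_def by blast

lemma smooth_on_differentiable: "smooth_on S f \<Longrightarrow> x \<in> S \<Longrightarrow> f differentiable (at x)"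
  using smooth_on_has_derivative differentiableI by blast

lemma smooth_on_frechet: "smooth_on S f \<Longrightarrow> smooth_on S (\<lambda>x. frechet_derivative f (at x) v)"
  unfolding smooth_on_def by (metis Ck_on.simps(2))

lemma smooth_on_continuous: "smooth_on S f \<Longrightarrow> continuous_on S f"
  unfolding smooth_on_def by (metis Ck_on.simps(1))

lemma smooth_onI:
  assumes "open S" "\<And>x. x \<in> S \<Longrightarrow> (f has_derivative f' x) (at x)" "\<And>v. smooth_on S (\<lambda>x. f' x v)"
  shows "smooth_on S f"
  unfolding smooth_on_def
proof
  fix k show "Ck_on k S f"
    using Ck_on_SucI[OF assms(1,2), of k] assms(3) Ck_on_SucD unfolding smooth_on_def by blast
qed

text \<open>A map that is linear in its second argument depends smoothly on both arguments as soon as it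
  depends smoothly on the first one.\<close>

lemma smooth_on_linear_family:
  fixes L :: "'a::euclidean_space \<Rightarrow> 'b::euclidean_space \<Rightarrow> 'c::euclidean_space"
  assumes "open S" "\<And>x. x \<in> S \<Longrightarrow> linear (L x)" "\<And>u. smooth_on S (\<lambda>x. L x u)" "smooth_on S f"
  shows "smooth_on S (\<lambda>x. L x (f x))"
proof (rule smooth_on_cong_imp)
  show "smooth_on S (\<lambda>x. \<Sum>b\<in>Basis. (f x \<bullet> b) *\<^sub>R L x b)"
    by (intro smooth_on_sum smooth_on_scaleR assms smooth_on_linear[OF _ bounded_linear_inner_left])
  show "(\<Sum>b\<in>Basis. (f x \<bullet> b) *\<^sub>R L x b) = L x (f x)" if "x \<in> S" for x
    using linear_expand_Basis[OF assms(2)[OF that]] by metis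
qed (rule assms(1))

lemma continuous_on_linear_family:
  fixes L :: "'x::topological_space \<Rightarrow> 'b::euclidean_space \<Rightarrow> 'c::real_normed_vector"
  assumes "\<And>x. x \<in> S \<Longrightarrow> linear (L x)" "\<And>u. continuous_on S (\<lambda>x. L x u)" "continuous_on S f"
  shows "continuous_on S (\<lambda>x. L x (f x))"
proof -
  have "continuous_on S (\<lambda>x. \<Sum>b\<in>Basis. (f x \<bullet> b) *\<^sub>R L x b)"
    by (intro continuous_intros assms)
  then show ?thesis
    using linear_expand_Basis[OF assms(1)] by (subst continuous_on_cong) auto
qed


section \<open>Closed one-forms on a ball are exact\<close>

text \<open>The primitive is \<open>F x = \<integral>\<^sub>0\<^sup>1 \<alpha> (x0 + t (x - x0)) (x - x0) dt\<close>. Differentiating under the integral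
  and using closedness, the integrand becomes the derivative of \<open>t \<alpha> (x0 + t (x - x0)) u\<close>.\<close>

lemma poincare_ball:
  fixes \<alpha> :: "'e::euclidean_space \<Rightarrow> 'e \<Rightarrow> real"
  assumes lin: "\<And>x. x \<in> ball x0 r \<Longrightarrow> linear (\<alpha> x)"
    and sm: "\<And>u. smooth_on (ball x0 r) (\<lambda>x. \<alpha> x u)"
    and closed: "\<And>x u v. x \<in> ball x0 r \<Longrightarrow>
      frechet_derivative (\<lambda>y. \<alpha> y v) (at x) u = frechet_derivative (\<lambda>y. \<alpha> y u) (at x) v"
  obtains F where "\<And>x. x \<in> ball x0 r \<Longrightarrow> (F has_derivative \<alpha> x) (at x)" "smooth_on (ball x0 r) F"
proof -
  let ?B = "ball x0 r"
  define z where "z x t = x0 + t *\<^sub>R (x - x0)" for x and t :: real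
  define D where "D x u v = frechet_derivative (\<lambda>y. \<alpha> y v) (at x) u" for x u v
  have zB: "z x t \<in> ?B" if "x \<in> ?B" "t \<in> {0..1}" for x t
  proof -
    have "dist x0 (z x t) = t * dist x0 x"
      using that by (simp add: z_def dist_norm norm_minus_commute)
    also have "\<dots> \<le> dist x0 x"
      using that by (simp add: mult_left_le_one_le)
    finally show ?thesis using that by simp
  qed
  have D: "((\<lambda>y. \<alpha> y v) has_derivative (\<lambda>u. D x u v)) (at x)" if "x \<in> ?B" for x v
    unfolding D_def using smooth_on_has_derivative[OF sm that] by simp
  have Dlin1: "linear (\<lambda>u. D x u v)" if "x \<in> ?B" for x v
    using D[OF that] has_derivative_linear by blast
  have Dlin2: "linear (D x u)" if "x \<in> ?B" for x u
    proof -
    have "D x u v = D x v u" for v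
      unfolding D_def by (rule closed[OF that])
    then have "D x u = (\<lambda>v. D x v u)" by (intro ext)
    then show ?thesis using Dlin1[OF that, of u] by simp
  qed
  have contD: "continuous_on ?B (\<lambda>x. D x u v)" for u v
    unfolding D_def by (intro smooth_on_continuous smooth_on_frechet sm)
  have conta: "continuous_on ?B (\<lambda>x. \<alpha> x u)" for u
    by (intro smooth_on_continuous sm)
  let ?U = "?B \<times> cbox 0 (1::real)"
  have contz: "continuous_on ?U (\<lambda>(x,t). z x t)"
    unfolding z_def split_beta by (intro continuous_intros)
  have zsub: "(\<lambda>(x,t). z x t) ` ?U \<subseteq> ?B"
    using zB by auto
  define f where "f x t = \<alpha> (z x t) (x - x0)" for x t
  define fx0 where "fx0 x t u = \<alpha> (z x t) u + t * D (z x t) u (x - x0)" for x t u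
  define fx where "fx x t = Blinfun (fx0 x t)" for x t
  have fxlin: "linear (fx0 x t)" if "x \<in> ?B" "t \<in> {0..1}" for x t
    unfolding fx0_def using linear_add[OF lin[OF zB[OF that]]] linear_add[OF Dlin1[OF zB[OF that]]]
      linear_cmul[OF lin[OF zB[OF that]]] linear_cmul[OF Dlin1[OF zB[OF that]]]
    by (intro linearI) (auto simp: algebra_simps)
  then have fxapp: "blinfun_apply (fx x t) = fx0 x t" if "x \<in> ?B" "t \<in> {0..1}" for x t
    unfolding fx_def using that by (simp add: bounded_linear_Blinfun_apply linear_conv_bounded_linear)
  have dz: "((\<lambda>x. z x t) has_derivative (\<lambda>u. t *\<^sub>R u)) (at x)" for x t
    unfolding z_def by (auto intro!: derivative_eq_intros)
  have dfx: "((\<lambda>x. f x t) has_derivative fx0 x t) (at x)" if x: "x \<in> ?B" and t: "t \<in> {0..1}" for x t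
  proof -
    have "((\<lambda>y. \<Sum>b\<in>Basis. ((y - x0) \<bullet> b) * \<alpha> (z y t) b) has_derivative
       (\<lambda>u. \<Sum>b\<in>Basis. ((x - x0) \<bullet> b) * D (z x t) (t *\<^sub>R u) b + (u \<bullet> b) * \<alpha> (z x t) b)) (at x)"
      by (rule derivative_eq_intros has_derivative_compose[OF dz D] refl zB[OF x t])+ auto
    moreover have "(\<lambda>u. \<Sum>b\<in>Basis. ((x - x0) \<bullet> b) * D (z x t) (t *\<^sub>R u) b + (u \<bullet> b) * \<alpha> (z x t) b) = fx0 x t"
    proof
      fix u
      have "\<alpha> (z x t) u = (\<Sum>b\<in>Basis. (u \<bullet> b) * \<alpha> (z x t) b)"
        using linear_expand_Basis[OF lin[OF zB[OF x t]], of u] by simp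
      moreover have "D (z x t) (t *\<^sub>R u) (x - x0) = (\<Sum>b\<in>Basis. ((x - x0) \<bullet> b) * D (z x t) (t *\<^sub>R u) b)"
        using linear_expand_Basis[OF Dlin2[OF zB[OF x t]], of "t *\<^sub>R u" "x - x0"] by simp
      moreover have "D (z x t) (t *\<^sub>R u) (x - x0) = t * D (z x t) u (x - x0)"
        using linear_cmul[OF Dlin1[OF zB[OF x t]], of t u "x - x0"] by simp
      ultimately show "(\<Sum>b\<in>Basis. ((x - x0) \<bullet> b) * D (z x t) (t *\<^sub>R u) b + (u \<bullet> b) * \<alpha> (z x t) b) = fx0 x t u"
        unfolding fx0_def sum.distrib by linarith
    qed
    ultimately have *: "((\<lambda>y. \<Sum>b\<in>Basis. ((y - x0) \<bullet> b) * \<alpha> (z y t) b) has_derivative fx0 x t) (at x)"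
      by simp
    show ?thesis
    proof (rule has_derivative_transform_within_open[OF *, of ?B])
      show "(\<Sum>b\<in>Basis. ((y - x0) \<bullet> b) * \<alpha> (z y t) b) = f y t" if "y \<in> ?B" for y
        unfolding f_def using linear_expand_Basis[OF lin[OF zB[OF that t]], of "y - x0"] by simp
    qed (use x in auto)
  qed
  have contfx: "continuous_on ?U (\<lambda>(x,t). fx x t)"
  proof (rule continuous_on_blinfun_componentwise)
    fix b :: 'e
    have "continuous_on ?U (\<lambda>p. \<alpha> (case p of (x,t) \<Rightarrow> z x t) b +
       snd p * (\<Sum>i\<in>Basis. ((fst p - x0) \<bullet> i) * D (case p of (x,t) \<Rightarrow> z x t) b i))"
      by (intro continuous_intros continuous_on_compose2[OF conta contz zsub] continuous_on_compose2[OF contD contz zsub])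
    then show "continuous_on ?U (\<lambda>p. blinfun_apply (case p of (x,t) \<Rightarrow> fx x t) b)"
    proof (rule continuous_on_eq)
      fix p assume p: "p \<in> ?U"
      show "\<alpha> (case p of (x,t) \<Rightarrow> z x t) b +
       snd p * (\<Sum>i\<in>Basis. ((fst p - x0) \<bullet> i) * D (case p of (x,t) \<Rightarrow> z x t) b i) =
       blinfun_apply (case p of (x,t) \<Rightarrow> fx x t) b"
        using p linear_expand_Basis[OF Dlin2[OF zB], of "fst p" "snd p" b "fst p - x0"]
        by (auto simp: fxapp fx0_def split: prod.splits)
    qed
  qed
  have contf: "continuous_on {0..1} (f x)" if x: "x \<in> ?B" for x
    unfolding f_def
    by (rule continuous_on_compose2[OF conta]) (use zB x in \<open>auto simp: z_def intro!: continuous_intros\<close>)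
  define F where "F x = integral (cbox 0 1) (f x)" for x
  have dF: "(F has_derivative \<alpha> x) (at x)" if x: "x \<in> ?B" for x
  proof -
    have "(F has_derivative integral (cbox 0 1) (fx x)) (at x within ?B)"
      unfolding F_def
    proof (rule leibniz_rule)
      show "((\<lambda>y. f y t) has_derivative blinfun_apply (fx y t)) (at y within ?B)"
        if "y \<in> ?B" "t \<in> cbox 0 1" for y t
        using that dfx[of y t] fxapp[of y t] by (auto intro: has_derivative_at_withinI)
      show "f y integrable_on cbox 0 1" if "y \<in> ?B" for y
        using contf[OF that] by (auto intro: integrable_continuous_interval)
    qed (use x contfx in auto)
    then have *: "(F has_derivative integral (cbox 0 1) (fx x)) (at x)"
      by (simp only: at_within_open[OF x open_ball])
    have "blinfun_apply (integral (cbox 0 1) (fx x)) u = \<alpha> x u" for u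
    proof -
      have "continuous_on (cbox 0 1) (\<lambda>t. case (x, t) of (x, t) \<Rightarrow> fx x t)"
        by (rule continuous_on_compose2[OF contfx]) (use x in \<open>auto intro!: continuous_intros\<close>)
      then have "(fx x has_integral integral (cbox 0 1) (fx x)) (cbox 0 1)"
        by (simp add: integrable_integral integrable_continuous_interval)
      from has_integral_linear[OF this blinfun.bounded_linear_left[of u]]
      have "((\<lambda>t. blinfun_apply (fx x t) u) has_integral blinfun_apply (integral (cbox 0 1) (fx x)) u) {0..1}"
        by (simp add: o_def)
      moreover have "((\<lambda>t. blinfun_apply (fx x t) u) has_integral (1 * \<alpha> (z x 1) u - 0 * \<alpha> (z x 0) u)) {0..1}"
      proof (rule fundamental_theorem_of_calculus[where f = "\<lambda>t. t * \<alpha> (z x t) u"])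
        fix t :: real assume t: "t \<in> {0..1}"
        have "((\<lambda>t. z x t) has_derivative (\<lambda>s. s *\<^sub>R (x - x0))) (at t)"
          unfolding z_def by (auto intro!: derivative_eq_intros)
        from has_derivative_compose[OF this D[OF zB[OF x t], of u]]
        have "((\<lambda>t. \<alpha> (z x t) u) has_real_derivative D (z x t) (x - x0) u) (at t)"
          using linear_cmul[OF Dlin1[OF zB[OF x t]]] by (simp add: has_field_derivative_def mult_commute_abs)
        then have "((\<lambda>t. t * \<alpha> (z x t) u) has_real_derivative (1 * \<alpha> (z x t) u + D (z x t) (x - x0) u * t)) (at t)"
          by (intro derivative_intros DERIV_mult) auto
        moreover have "D (z x t) (x - x0) u = D (z x t) u (x - x0)"
          unfolding D_def using closed[OF zB[OF x t]] by simp
        ultimately show "((\<lambda>t. t * \<alpha> (z x t) u) has_vector_derivative blinfun_apply (fx x t) u) (at t within {0..1})"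
          by (simp add: fxapp[OF x t] fx0_def has_real_derivative_iff_has_vector_derivative mult.commute
              has_vector_derivative_at_within)
      qed simp
      ultimately show ?thesis
        by (auto dest: has_integral_unique simp: z_def)
    qed
    then have "blinfun_apply (integral (cbox 0 1) (fx x)) = \<alpha> x"
      by (rule ext)
    then show ?thesis
      using * by simp
  qed
  show ?thesis
  proof
    show "smooth_on ?B F"
      by (rule smooth_onI[OF _ dF sm]) auto
  qed (use dF in auto)
qed


section \<open>A smooth local change of coordinates\<close>

text \<open>Near a point where the derivative of \<open>F\<close> in the direction of the unit vector \<open>e\<close> does not
  vanish, the coordinate along \<open>e\<close> can be replaced by \<open>F\<close>.\<close>

lemma smooth_inverse_shear:
  fixes F :: "'e::euclidean_space \<Rightarrow> real"
  assumes Q: "open Q" "x0 \<in> Q" and F: "smooth_on Q F" and e: "norm e = 1"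
    and F0: "frechet_derivative F (at x0) e \<noteq> 0"
  defines "G \<equiv> \<lambda>y. y - x0 - ((y - x0) \<bullet> e) *\<^sub>R e + (F y - F x0) *\<^sub>R e"
  obtains Q' \<rho> H where "open Q'" "Q' \<subseteq> Q" "x0 \<in> Q'" "\<rho> > 0" "homeomorphism Q' (ball 0 \<rho>) G H"
    "smooth_on (ball 0 \<rho>) H" "smooth_on Q G"
proof -
  \<comment> \<open>\<open>P\<close> is the orthogonal projection along \<open>e\<close>, \<open>G'\<close> the derivative of \<open>G\<close>, and \<open>I\<close> its inverse.\<close>
  define P where "P v = v - (v \<bullet> e) *\<^sub>R e" for v
  have blP: "bounded_linear P"
    unfolding P_def by (intro bounded_linear_intros)
  have linP: "linear P"
    using blP by (simp add: linear_conv_bounded_linear)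
  have ee: "e \<bullet> e = 1" using e by (simp add: dot_square_norm)
  define F' where "F' x = frechet_derivative F (at x)" for x
  have F': "(F has_derivative F' x) (at x)" if "x \<in> Q" for x
    unfolding F'_def using smooth_on_has_derivative[OF F that] .
  have linF: "linear (F' x)" if "x \<in> Q" for x
    using F'[OF that] has_derivative_linear by blast
  have smF: "smooth_on Q (\<lambda>x. F' x v)" for v
    unfolding F'_def by (rule smooth_on_frechet[OF F])
  define S where "S = {x\<in>Q. F' x e \<noteq> 0}"
  have "S = Q \<inter> (\<lambda>x. F' x e) -` (- {0})"
    by (auto simp: S_def)
  then have "open S"
    using continuous_open_preimage[OF smooth_on_continuous[OF smF[of e]] Q(1), of "- {0}"] by auto
  have S: "S \<subseteq> Q" "x0 \<in> S" "\<And>x. x \<in> S \<Longrightarrow> F' x e \<noteq> 0"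
    using F0 Q by (auto simp: S_def F'_def)
  have "smooth_on Q (\<lambda>y. P (y - x0) + (F y - F x0) *\<^sub>R e)"
    by (intro smooth_on_add smooth_on_scaleR smooth_on_diff smooth_on_linear[OF _ blP] Q F smooth_on_const smooth_on_id)
  then have Gsm: "smooth_on Q G"
    by (simp add: G_def P_def)
  define G' where "G' x v = P v + F' x v *\<^sub>R e" for x v
  have linG: "linear (G' x)" if "x \<in> Q" for x
    unfolding G'_def using linear_add[OF linP] linear_cmul[OF linP] linear_add[OF linF[OF that]] linear_cmul[OF linF[OF that]]
    by (intro linearI) (auto simp: algebra_simps)
  have G': "(G has_derivative G' x) (at x)" if "x \<in> Q" for x
    unfolding G_def G'_def P_def
    by (rule derivative_eq_intros F'[OF that] refl)+ auto
  define I where "I x w = P w + (inverse (F' x e) * (w \<bullet> e - F' x (P w))) *\<^sub>R e" for x w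
  have Pe: "P e = 0" and PP: "P (P v) = P v" "P v \<bullet> e = 0" for v
    by (simp_all add: P_def ee inner_diff_left)
  have linI: "linear (I x)" if "x \<in> Q" for x
    unfolding I_def using linear_add[OF linP] linear_cmul[OF linP] linear_add[OF linF[OF that]] linear_cmul[OF linF[OF that]]
    by (intro linearI) (auto simp: algebra_simps)
  have vdec: "v = P v + (v \<bullet> e) *\<^sub>R e" for v
    by (simp add: P_def)
  have IG: "I x (G' x v) = v" and GI: "G' x (I x v) = v" if "x \<in> S" for x v
  proof -
    have xO: "x \<in> Q" using that S by auto
    have Fv: "F' x v = F' x (P v) + (v \<bullet> e) * F' x e"
      by (subst vdec) (simp only: linear_add[OF linF[OF xO]] linear_cmul[OF linF[OF xO]] real_scaleR_def)
    have "P (G' x v) = P v"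
      unfolding G'_def by (simp add: linear_add[OF linP] linear_cmul[OF linP] PP Pe)
    moreover have "G' x v \<bullet> e = F' x v"
      by (simp add: G'_def inner_add_left PP ee)
    ultimately show "I x (G' x v) = v"
      using S(3)[OF that] Fv vdec[of v] by (simp add: I_def field_simps)
    have "P (I x v) = P v"
      unfolding I_def by (simp add: linear_add[OF linP] linear_cmul[OF linP] PP Pe)
    moreover have "F' x (I x v) = v \<bullet> e"
      unfolding I_def using S(3)[OF that]
      by (simp add: linear_add[OF linF[OF xO]] linear_cmul[OF linF[OF xO]] field_simps)
    ultimately show "G' x (I x v) = v"
      using vdec[of v] by (simp add: G'_def)
  qed
  define g' where "g' x = Blinfun (G' x)" for x
  have g'app: "blinfun_apply (g' x) = G' x" if "x \<in> Q" for x
    unfolding g'_def using linG[OF that] by (simp add: bounded_linear_Blinfun_apply linear_conv_bounded_linear)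
  have contg': "continuous_on S g'"
  proof (rule continuous_on_blinfun_componentwise)
    fix b :: 'e
    have "continuous_on S (\<lambda>x. P b + F' x b *\<^sub>R e)"
      using S(1) continuous_on_subset[OF smooth_on_continuous[OF smF]] by (intro continuous_intros) auto
    then show "continuous_on S (\<lambda>x. blinfun_apply (g' x) b)"
      by (rule continuous_on_eq) (use S(1) g'app in \<open>auto simp: G'_def\<close>)
  qed
  have inv0: "Blinfun (I x0) o\<^sub>L g' x0 = id_blinfun"
    using S linI[of x0] g'app[of x0] IG[of x0]
    by (intro blinfun_eqI) (auto simp: bounded_linear_Blinfun_apply linear_conv_bounded_linear)
  obtain U' V H H' where U': "open U'" "U' \<subseteq> S" "x0 \<in> U'" "open V" "G x0 \<in> V" "homeomorphism U' V G H"
    and H': "\<And>y. y \<in> V \<Longrightarrow> (H has_derivative H' y) (at y)"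
    "\<And>y. y \<in> V \<Longrightarrow> H' y = inv (blinfun_apply (g' (H y)))"
  proof (rule inverse_function_theorem[of S G g' x0 "Blinfun (I x0)"])
    show "(G has_derivative blinfun_apply (g' x)) (at x)" if "x \<in> S" for x
      using that S G' g'app by auto
  qed (use \<open>open S\<close> contg' S inv0 in auto)
  have HU: "H y \<in> U'" if "y \<in> V" for y
    using U'(6) that by (auto simp: homeomorphism_def)
  have HI: "H' y = I (H y)" if "y \<in> V" for y
  proof -
    have *: "H y \<in> S" using HU[OF that] U' by auto
    have "inv (G' (H y)) = I (H y)"
      by (rule inv_equality) (use IG[OF *] GI[OF *] in auto)
    then show ?thesis using H'(2)[OF that] g'app * S(1) by auto
  qed
  \<comment> \<open>The derivative of the inverse \<open>H\<close> is an explicit expression in \<open>H\<close>, which raises its regularity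
    by one at each step.\<close>
  have HC: "Ck_on k V H" for k
  proof (induction k)
    case 0
    then show ?case using U' by (simp add: homeomorphism_def)
  next
    case (Suc k)
    have cF: "Ck_on k V (\<lambda>y. F' (H y) v)" for v
      using Ck_on_compose[OF U'(4) Suc, of Q "\<lambda>x. F' x v"] smF[of v] HU U' S by (auto simp: smooth_on_def)
    show ?case
    proof (rule Ck_on_SucI[OF U'(4)])
      show "(H has_derivative I (H y)) (at y)" if "y \<in> V" for y
        using H'(1) HI that by metis
      have cI: "Ck_on k V (\<lambda>y. inverse (F' (H y) e))"
        using cF S(3) HU U' by (intro Ck_on_inverse) auto
      have cJ: "Ck_on k V (\<lambda>y. v \<bullet> e + (-1) *\<^sub>R F' (H y) (P v))" for v
        by (intro Ck_on_add Ck_on_const Ck_on_scaleR U' cF)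
      have "Ck_on k V (\<lambda>y. P v + (inverse (F' (H y) e) *\<^sub>R (v \<bullet> e + (-1) *\<^sub>R F' (H y) (P v))) *\<^sub>R e)" for v
        by (intro Ck_on_add Ck_on_const Ck_on_scaleR U' cI cJ)
      then show "Ck_on k V (\<lambda>y. I (H y) v)" for v
        by (simp add: I_def)
    qed
  qed
  have G0: "G x0 = 0" by (simp add: G_def)
  then obtain \<rho> where \<rho>: "\<rho> > 0" "ball 0 \<rho> \<subseteq> V"
    using U' open_contains_ball by metis
  show ?thesis
  proof
    show "homeomorphism (H ` ball 0 \<rho>) (ball 0 \<rho>) G H"
      by (rule homeomorphism_symD, rule homeomorphism_of_subsets[OF homeomorphism_symD[OF U'(6)]])
        (use HU \<rho>(2) in auto)
    have "H ` ball 0 \<rho> = U' \<inter> G -` ball 0 \<rho>"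
    proof
      show "H ` ball 0 \<rho> \<subseteq> U' \<inter> G -` ball 0 \<rho>"
        using HU \<rho>(2) homeomorphism_apply2[OF U'(6)] by auto
      show "U' \<inter> G -` ball 0 \<rho> \<subseteq> H ` ball 0 \<rho>"
        using homeomorphism_apply1[OF U'(6)] by (metis IntE image_eqI subsetI vimageE)
    qed
    moreover have "continuous_on U' G"
      using U'(6) by (simp add: homeomorphism_def)
    ultimately show "open (H ` ball 0 \<rho>)"
      using continuous_open_preimage[OF _ U'(1) open_ball, of G 0 \<rho>] by simp
    show "H ` ball 0 \<rho> \<subseteq> Q"
      using HU \<rho>(2) U'(2) S(1) by blast
    show "x0 \<in> H ` ball 0 \<rho>"
      using U'(3,6) G0 \<rho> unfolding homeomorphism_def by (metis centre_in_ball image_eqI)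
    show "smooth_on (ball 0 \<rho>) H"
      using HC \<rho>(2) Ck_on_subset unfolding smooth_on_def by blast
  qed (use \<rho> Gsm in auto)
qed


section \<open>Charts, tangent vectors and curves\<close>

lemma is_chartD:
  assumes "is_chart c"
  shows "open (fst c)" "open (snd c ` fst c)" "continuous_on (fst c) (snd c)"
    "continuous_on (snd c ` fst c) (chart_inv c)"
    "\<And>p. p \<in> fst c \<Longrightarrow> chart_inv c (snd c p) = p"
    "\<And>x. x \<in> snd c ` fst c \<Longrightarrow> snd c (chart_inv c x) = x"
    "\<And>x. x \<in> snd c ` fst c \<Longrightarrow> chart_inv c x \<in> fst c"
    "inj_on (snd c) (fst c)"
  using assms unfolding is_chart_def homeomorphism_def by (auto intro: inj_on_inverseI)

lemma chart_open_image:
  assumes "is_chart c" "open S"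
  shows "open (snd c ` (fst c \<inter> S))"
proof -
  have "snd c ` (fst c \<inter> S) = snd c ` fst c \<inter> chart_inv c -` S"
    using is_chartD(5-7)[OF assms(1)] by force
  then show ?thesis
    using continuous_open_preimage[OF is_chartD(4,2)[OF assms(1)] assms(2)] by simp
qed

lemma chart_open_vimage:
  assumes "is_chart c" "open S"
  shows "open (fst c \<inter> snd c -` S)"
  using continuous_open_preimage[OF is_chartD(3,1)[OF assms(1)] assms(2)] .

text \<open>A smooth manifold, given as in the definitions by an atlas on a whole type.\<close>

locale atlas =
  fixes A :: "('a::{t2_space, second_countable_topology}, 'e::euclidean_space) chart set"
  assumes smooth_atlas: "smooth_atlas A"
begin

lemma max_chart: "c \<in> max_atlas A \<Longrightarrow> is_chart c"
  by (simp add: max_atlas_def)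

lemmas chartD = is_chartD[OF max_chart]

lemma atlas_subset_max: "c \<in> A \<Longrightarrow> c \<in> max_atlas A"
  using smooth_atlas by (simp add: max_atlas_def smooth_atlas_def)

lemma chart_around: obtains d where "d \<in> A" "p \<in> fst d"
  using smooth_atlas unfolding smooth_atlas_def by blast

lemma chart_domain_open: "c \<in> max_atlas A \<Longrightarrow> d \<in> max_atlas A \<Longrightarrow> open (snd c ` (fst c \<inter> fst d))"
  using chart_open_image max_chart is_chartD(1) by blast

lemma transition_smooth:
  assumes c: "c \<in> max_atlas A" and e: "e \<in> max_atlas A"
  shows "smooth_on (snd c ` (fst c \<inter> fst e)) (transition c e)"
proof (rule smooth_on_local)
  fix x assume "x \<in> snd c ` (fst c \<inter> fst e)"
  then obtain p where p: "p \<in> fst c" "p \<in> fst e" "x = snd c p" by auto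
  obtain d where d: "d \<in> A" "p \<in> fst d" by (rule chart_around)
  let ?U = "snd c ` (fst c \<inter> (fst d \<inter> fst e))"
  have dm: "d \<in> max_atlas A" using d by (simp add: atlas_subset_max)
  have opU: "open ?U"
    using chart_open_image[OF max_chart[OF c]] is_chartD(1)[OF max_chart[OF e]] is_chartD(1)[OF max_chart[OF dm]]
    by blast
  have cd: "smooth_on (snd c ` (fst c \<inter> fst d)) (transition c d)"
    and de: "smooth_on (snd d ` (fst d \<inter> fst e)) (transition d e)"
    using c d e unfolding max_atlas_def compatible_def by (auto simp: Int_commute)
  have "smooth_on ?U (\<lambda>x. transition d e (transition c d x))"
  proof (rule smooth_on_compose[OF opU smooth_on_subset[OF cd] de])
    show "transition c d ` ?U \<subseteq> snd d ` (fst d \<inter> fst e)"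
      using chartD(5)[OF c] by (auto simp: transition_def)
  qed auto
  then have "smooth_on ?U (transition c e)"
    by (rule smooth_on_cong_imp[OF _ opU]) (use chartD(5)[OF c] chartD(5)[OF dm] in \<open>auto simp: transition_def\<close>)
  then show "\<exists>U. open U \<and> x \<in> U \<and> smooth_on U (transition c e)"
    using opU p d by blast
qed

text \<open>The chain rule for Jacobians holds for all charts of the maximal atlas, so that every such
  chart, and not only those of \<open>A\<close>, gives components of tangent vectors.\<close>

lemma jacobian_has_derivative:
  assumes "c \<in> max_atlas A" "e \<in> max_atlas A" "p \<in> fst c" "p \<in> fst e"
  shows "(transition c e has_derivative jacobian c e p) (at (snd c p))"
  unfolding jacobian_def using assms
  by (intro smooth_on_has_derivative[OF transition_smooth]) auto

lemma jacobian_linear: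
  assumes "c \<in> max_atlas A" "e \<in> max_atlas A" "p \<in> fst c" "p \<in> fst e"
  shows "linear (jacobian c e p)"
  using jacobian_has_derivative[OF assms] has_derivative_linear by blast

lemma jacobian_compose:
  assumes c: "c \<in> max_atlas A" "p \<in> fst c" and d: "d \<in> max_atlas A" "p \<in> fst d" and e: "e \<in> max_atlas A" "p \<in> fst e"
  shows "jacobian d e p (jacobian c d p u) = jacobian c e p u"
proof -
  have td: "transition c d (snd c p) = snd d p"
    using chartD(5)[OF c] by (simp add: transition_def)
  have "((\<lambda>x. transition d e (transition c d x)) has_derivative (\<lambda>u. jacobian d e p (jacobian c d p u))) (at (snd c p))"
    by (rule has_derivative_compose) (use jacobian_has_derivative c d e td in auto)
  then have "(transition c e has_derivative (\<lambda>u. jacobian d e p (jacobian c d p u))) (at (snd c p))"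
  proof (rule has_derivative_transform_within_open[OF _ chart_domain_open[OF c(1) d(1)]])
    show "transition d e (transition c d x) = transition c e x" if "x \<in> snd c ` (fst c \<inter> fst d)" for x
      using that chartD(5)[OF c(1)] chartD(5)[OF d(1)] by (auto simp: transition_def)
  qed (use c d in auto)
  from has_derivative_unique[OF this jacobian_has_derivative[OF c(1) e(1) c(2) e(2)]]
  show ?thesis by metis
qed

lemma jacobian_self:
  assumes c: "c \<in> max_atlas A" "p \<in> fst c"
  shows "jacobian c c p u = u"
proof -
  have "((\<lambda>x. x) has_derivative (\<lambda>u. u)) (at (snd c p))" by simp
  then have "(transition c c has_derivative (\<lambda>u. u)) (at (snd c p))"
    by (rule has_derivative_transform_within_open[OF _ chartD(2)[OF c(1)]])
      (use c chartD(6)[OF c(1)] in \<open>auto simp: transition_def\<close>)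
  from has_derivative_unique[OF this jacobian_has_derivative[OF c(1) c(1) c(2) c(2)]]
  show ?thesis by metis
qed

lemma jacobian_inverse:
  assumes "c \<in> max_atlas A" "p \<in> fst c" "d \<in> max_atlas A" "p \<in> fst d"
  shows "jacobian d c p (jacobian c d p u) = u"
  using jacobian_compose[OF assms assms(1,2)] jacobian_self assms by simp

lemma jacobian_bij:
  assumes "c \<in> max_atlas A" "p \<in> fst c" "d \<in> max_atlas A" "p \<in> fst d"
  shows "bij (jacobian c d p)"
  by (rule o_bij[of "jacobian d c p"])
    (use jacobian_inverse[OF assms] jacobian_inverse[OF assms(3,4,1,2)] in \<open>auto simp: fun_eq_iff\<close>)

lemma coord_vec_component:
  "d \<in> A \<Longrightarrow> p \<in> fst d \<Longrightarrow> coord_vec A c p u d = jacobian c d p u"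
  by (simp add: coord_vec_def)

lemma coord_vec_self: "d \<in> A \<Longrightarrow> p \<in> fst d \<Longrightarrow> coord_vec A d p u d = u"
  by (simp add: coord_vec_def jacobian_self atlas_subset_max)

lemma coord_vec_tangent:
  assumes "c \<in> max_atlas A" "p \<in> fst c"
  shows "coord_vec A c p u \<in> tangent_space A p"
  unfolding tangent_space_def
proof (intro CollectI conjI allI ballI impI)
  fix d e assume d: "d \<in> A" and e: "e \<in> A" and p: "p \<in> fst d \<inter> fst e"
  then show "coord_vec A c p u e = jacobian d e p (coord_vec A c p u d)"
    using jacobian_compose[OF assms atlas_subset_max[OF d] _ atlas_subset_max[OF e]]
    by (metis IntE coord_vec_component)
qed (auto simp: coord_vec_def)

lemma coord_vec_change:
  assumes "c \<in> max_atlas A" "p \<in> fst c" "d \<in> max_atlas A" "p \<in> fst d"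
  shows "coord_vec A c p u = coord_vec A d p (jacobian c d p u)"
proof
  fix e
  have "jacobian d e p (jacobian c d p u) = jacobian c e p u" if "e \<in> A" "p \<in> fst e"
    using jacobian_compose[OF assms] that atlas_subset_max by blast
  then show "coord_vec A c p u e = coord_vec A d p (jacobian c d p u) e"
    by (auto simp: coord_vec_def)
qed

lemma tangent_space_coord_vec:
  assumes "c \<in> max_atlas A" "p \<in> fst c" "v \<in> tangent_space A p"
  obtains u where "v = coord_vec A c p u"
proof -
  obtain d where d: "d \<in> A" "p \<in> fst d" by (rule chart_around)
  have "v = coord_vec A d p (v d)"
  proof
    fix e
    have "v e = jacobian d e p (v d)" if "e \<in> A" "p \<in> fst e"
      using assms(3) d that unfolding tangent_space_def by blast
    moreover have "v e = 0" if "e \<notin> A \<or> p \<notin> fst e"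
      using assms(3) that unfolding tangent_space_def by blast
    ultimately show "v e = coord_vec A d p (v d) e"
      unfolding coord_vec_def by presburger
  qed
  also have "\<dots> = coord_vec A c p (jacobian d c p (v d))"
    by (rule coord_vec_change) (use d assms in \<open>auto simp: atlas_subset_max\<close>)
  finally show ?thesis using that by blast
qed

lemma coord_vec_eq_iff:
  assumes "c \<in> max_atlas A" "p \<in> fst c"
  shows "coord_vec A c p u = coord_vec A c p v \<longleftrightarrow> u = v"
proof
  assume *: "coord_vec A c p u = coord_vec A c p v"
  obtain d where d: "d \<in> A" "p \<in> fst d" by (rule chart_around)
  then have "jacobian c d p u = jacobian c d p v"
    using fun_cong[OF *, of d] by (simp add: coord_vec_component)
  then show "u = v"
    using jacobian_inverse[OF assms atlas_subset_max[OF d(1)] d(2)] by metis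
qed auto

lemma coord_vec_scale:
  assumes "c \<in> max_atlas A" "p \<in> fst c"
  shows "(\<lambda>d. r *\<^sub>R coord_vec A c p u d) = coord_vec A c p (r *\<^sub>R u)"
proof
  fix d
  have "jacobian c d p (r *\<^sub>R u) = r *\<^sub>R jacobian c d p u" if "d \<in> A" "p \<in> fst d"
    using jacobian_linear[OF assms(1) atlas_subset_max assms(2)] that linear_cmul by blast
  then show "r *\<^sub>R coord_vec A c p u d = coord_vec A c p (r *\<^sub>R u) d"
    by (auto simp: coord_vec_def)
qed

lemma coord_vec_zero:
  assumes "c \<in> max_atlas A" "p \<in> fst c"
  shows "coord_vec A c p 0 = (\<lambda>_. 0)"
  using coord_vec_scale[OF assms, of 0 0] by (simp add: fun_eq_iff)

text \<open>Ambient smoothness of a curve, without reference to a submanifold.\<close>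

definition ambient_curve :: "real set \<Rightarrow> (real \<Rightarrow> 'a) \<Rightarrow> bool" where
  "ambient_curve J \<gamma> \<longleftrightarrow> open J \<and> continuous_on J \<gamma> \<and> (\<forall>c\<in>A. smooth_on (J \<inter> \<gamma> -` fst c) (snd c \<circ> \<gamma>))"

lemma ambient_curve_open:
  assumes "ambient_curve J \<gamma>" "open S"
  shows "open (J \<inter> \<gamma> -` S)"
  using assms continuous_open_preimage unfolding ambient_curve_def by blast

lemma ambient_curve_smooth:
  assumes \<gamma>: "ambient_curve J \<gamma>" and c: "c \<in> max_atlas A"
  shows "smooth_on (J \<inter> \<gamma> -` fst c) (snd c \<circ> \<gamma>)"
proof (rule smooth_on_local)
  fix t assume t: "t \<in> J \<inter> \<gamma> -` fst c"
  obtain d where d: "d \<in> A" "\<gamma> t \<in> fst d" by (rule chart_around)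
  have dm: "d \<in> max_atlas A" using d atlas_subset_max by auto
  let ?U = "J \<inter> \<gamma> -` (fst c \<inter> fst d)"
  have opU: "open ?U"
    by (rule ambient_curve_open[OF \<gamma> open_Int[OF chartD(1)[OF c] chartD(1)[OF dm]]])
  have "smooth_on (J \<inter> \<gamma> -` fst d) (snd d \<circ> \<gamma>)"
    using \<gamma> d by (auto simp: ambient_curve_def)
  then have "smooth_on ?U (snd d \<circ> \<gamma>)"
    by (rule smooth_on_subset) auto
  then have "smooth_on ?U (\<lambda>t. transition d c ((snd d \<circ> \<gamma>) t))"
    by (rule smooth_on_compose[OF opU _ transition_smooth[OF dm c]]) auto
  then have "smooth_on ?U (snd c \<circ> \<gamma>)"
    by (rule smooth_on_cong_imp[OF _ opU]) (use chartD(5)[OF dm] in \<open>auto simp: transition_def\<close>)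
  then show "\<exists>U. open U \<and> t \<in> U \<and> smooth_on U (snd c \<circ> \<gamma>)"
    using opU t d by blast
qed

lemma smooth_on_real_derivative:
  fixes f :: "real \<Rightarrow> 'b::euclidean_space"
  assumes "smooth_on J f" "t \<in> J"
  shows "(f has_vector_derivative vector_derivative f (at t)) (at t)"
  using smooth_on_differentiable[OF assms] by (simp add: vector_derivative_works)

text \<open>In any chart of the maximal atlas, the components of the velocity are the derivative of the
  coordinates.\<close>

lemma velocity_coord:
  assumes "isCont \<gamma> t" and c: "c \<in> max_atlas A" "\<gamma> t \<in> fst c"
    and w: "((snd c \<circ> \<gamma>) has_vector_derivative w) (at t)"
  shows "velocity A \<gamma> t = coord_vec A c (\<gamma> t) w"
proof
  fix d
  show "velocity A \<gamma> t d = coord_vec A c (\<gamma> t) w d"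
  proof (cases "d \<in> A \<and> \<gamma> t \<in> fst d")
    case True
    then have dm: "d \<in> max_atlas A" using atlas_subset_max by auto
    have J: "(transition c d has_derivative jacobian c d (\<gamma> t)) (at (snd c (\<gamma> t)))"
      using jacobian_has_derivative[OF c(1) dm c(2)] True by simp
    have "((\<lambda>s. transition c d ((snd c \<circ> \<gamma>) s)) has_derivative (\<lambda>s. jacobian c d (\<gamma> t) (s *\<^sub>R w))) (at t)"
      using has_derivative_compose[OF w[unfolded has_vector_derivative_def], of "transition c d"] J by auto
    moreover have "\<forall>\<^sub>F s in at t. \<gamma> s \<in> fst c"
      using assms(1) c chartD(1)[OF c(1)] unfolding isCont_def by (rule_tac topological_tendstoD) auto
    then have "\<forall>\<^sub>F s in at t. transition c d ((snd c \<circ> \<gamma>) s) = (snd d \<circ> \<gamma>) s"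
      by eventually_elim (use chartD(5)[OF c(1)] in \<open>auto simp: transition_def\<close>)
    ultimately have "((snd d \<circ> \<gamma>) has_derivative (\<lambda>s. jacobian c d (\<gamma> t) (s *\<^sub>R w))) (at t)"
      by (rule has_derivative_transform_eventually) (use chartD(5)[OF c(1)] c in \<open>auto simp: transition_def\<close>)
    then have "((snd d \<circ> \<gamma>) has_vector_derivative jacobian c d (\<gamma> t) w) (at t)"
      using jacobian_linear[OF c(1) dm c(2)] True by (simp add: has_vector_derivative_def linear_cmul)
    then show ?thesis
      using True vector_derivative_at by (auto simp: velocity_def coord_vec_def)
  qed (auto simp: velocity_def coord_vec_def)
qed

lemma ambient_curve_deriv:
  assumes "ambient_curve J \<gamma>" "c \<in> max_atlas A" "t \<in> J" "\<gamma> t \<in> fst c"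
  shows "((snd c \<circ> \<gamma>) has_vector_derivative vector_derivative (snd c \<circ> \<gamma>) (at t)) (at t)"
  by (rule smooth_on_real_derivative[OF ambient_curve_smooth[OF assms(1,2)]]) (use assms in auto)

lemma ambient_curve_isCont: "ambient_curve J \<gamma> \<Longrightarrow> t \<in> J \<Longrightarrow> isCont \<gamma> t"
  by (auto simp: ambient_curve_def continuous_on_eq_continuous_at)

lemma ambient_curve_velocity:
  assumes "ambient_curve J \<gamma>" "c \<in> max_atlas A" "t \<in> J" "\<gamma> t \<in> fst c"
  shows "velocity A \<gamma> t = coord_vec A c (\<gamma> t) (vector_derivative (snd c \<circ> \<gamma>) (at t))"
  by (rule velocity_coord[OF ambient_curve_isCont[OF assms(1,3)] assms(2,4) ambient_curve_deriv[OF assms]])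

lemma chart_curve:
  fixes y :: "real \<Rightarrow> 'e"
  assumes c: "c \<in> max_atlas A" and J: "open J" and y: "smooth_on J y" "y ` J \<subseteq> snd c ` fst c"
  shows "ambient_curve J (chart_inv c \<circ> y)"
  unfolding ambient_curve_def
proof (intro conjI ballI J)
  have cont: "continuous_on J y" using y smooth_on_continuous by blast
  then show cont': "continuous_on J (chart_inv c \<circ> y)"
    by (intro continuous_on_compose continuous_on_subset[OF chartD(4)[OF c]] y)
  fix d assume d: "d \<in> A"
  let ?U = "J \<inter> (chart_inv c \<circ> y) -` fst d"
  have opU: "open ?U"
    by (rule continuous_open_preimage[OF cont' J]) (use chartD(1) d atlas_subset_max in auto)
  have "smooth_on ?U (\<lambda>t. transition c d (y t))"
  proof (rule smooth_on_compose[OF opU smooth_on_subset[OF y(1)] transition_smooth[OF c atlas_subset_max[OF d]]])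
    show "y ` ?U \<subseteq> snd c ` (fst c \<inter> fst d)"
    proof
      fix x assume "x \<in> y ` ?U"
      then obtain t where t: "t \<in> J" "chart_inv c (y t) \<in> fst d" "x = y t" by auto
      then have "y t \<in> snd c ` fst c" using y(2) by auto
      then show "x \<in> snd c ` (fst c \<inter> fst d)"
        using chartD(6,7)[OF c, of "y t"] t by (metis IntI image_eqI)
    qed
  qed auto
  then show "smooth_on ?U (snd d \<circ> (chart_inv c \<circ> y))"
    by (simp add: transition_def o_def)
qed

lemma chart_curve_velocity:
  assumes c: "c \<in> max_atlas A" and J: "open J" and y: "smooth_on J y" "y ` J \<subseteq> snd c ` fst c"
    and t: "t \<in> J" and w: "(y has_vector_derivative w) (at t)"
  shows "velocity A (chart_inv c \<circ> y) t = coord_vec A c (chart_inv c (y t)) w"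
proof -
  have "((snd c \<circ> (chart_inv c \<circ> y)) has_vector_derivative w) (at t)"
    by (rule has_vector_derivative_transform_within_open[OF w J t]) (use y chartD(6)[OF c] in auto)
  then show ?thesis
    using velocity_coord[OF ambient_curve_isCont[OF chart_curve[OF c J y] t] c] chartD(7)[OF c] y t
    by auto
qed

lemma ambient_curve_affine:
  assumes "ambient_curve J \<gamma>"
  shows "ambient_curve ((\<lambda>t. a * t + b) -` J) (\<lambda>t. \<gamma> (a * t + b))"
  unfolding ambient_curve_def
proof (intro conjI ballI)
  let ?f = "\<lambda>t::real. a * t + b"
  have contf: "continuous_on UNIV ?f" by (intro continuous_intros)
  show "open (?f -` J)"
    by (rule open_vimage[OF _ contf]) (use assms in \<open>simp add: ambient_curve_def\<close>)
  show "continuous_on (?f -` J) (\<lambda>t. \<gamma> (?f t))"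
    by (rule continuous_on_compose2[of J \<gamma>]) (use assms in \<open>auto simp: ambient_curve_def intro!: continuous_intros\<close>)
  fix c assume c: "c \<in> A"
  have sm: "smooth_on (J \<inter> \<gamma> -` fst c) (snd c \<circ> \<gamma>)"
    using assms c by (auto simp: ambient_curve_def)
  have opJ: "open (?f -` (J \<inter> \<gamma> -` fst c))"
    by (rule open_vimage[OF ambient_curve_open[OF assms chartD(1)[OF atlas_subset_max[OF c]]] contf])
  have "smooth_on (?f -` (J \<inter> \<gamma> -` fst c)) ?f"
    by (intro smooth_on_add smooth_on_mult smooth_on_const smooth_on_id opJ)
  then have "smooth_on (?f -` (J \<inter> \<gamma> -` fst c)) (\<lambda>t. (snd c \<circ> \<gamma>) (?f t))"
    by (rule smooth_on_compose[OF opJ _ sm]) auto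
  then show "smooth_on (?f -` J \<inter> (\<lambda>t. \<gamma> (?f t)) -` fst c) (snd c \<circ> (\<lambda>t. \<gamma> (?f t)))"
    by (simp add: o_def vimage_Int) (simp add: vimage_def)
qed

lemma velocity_affine:
  assumes "ambient_curve J \<gamma>" "a * t + b \<in> J"
  shows "velocity A (\<lambda>t. \<gamma> (a * t + b)) t = (\<lambda>c. a *\<^sub>R velocity A \<gamma> (a * t + b) c)"
proof
  fix c
  show "velocity A (\<lambda>t. \<gamma> (a * t + b)) t c = a *\<^sub>R velocity A \<gamma> (a * t + b) c"
  proof (cases "c \<in> A \<and> \<gamma> (a * t + b) \<in> fst c")
    case True
    have "((\<lambda>t. a * t + b) has_real_derivative a) (at t)"
      by (auto intro!: derivative_eq_intros)
    moreover have "((snd c \<circ> \<gamma>) has_vector_derivative vector_derivative (snd c \<circ> \<gamma>) (at (a * t + b))) (at (a * t + b))"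
      by (rule ambient_curve_deriv[OF assms(1)]) (use True assms atlas_subset_max in auto)
    ultimately have "(((snd c \<circ> \<gamma>) \<circ> (\<lambda>t. a * t + b)) has_vector_derivative a *\<^sub>R vector_derivative (snd c \<circ> \<gamma>) (at (a * t + b))) (at t)"
      using vector_diff_chain_at[of "\<lambda>t. a * t + b" a t] by (simp add: has_real_derivative_iff_has_vector_derivative)
    then have "vector_derivative (snd c \<circ> (\<lambda>t. \<gamma> (a * t + b))) (at t) = a *\<^sub>R vector_derivative (snd c \<circ> \<gamma>) (at (a * t + b))"
      using vector_derivative_at by (force simp: o_def)
    then show ?thesis
      using True by (simp add: velocity_def)
  qed (auto simp: velocity_def)
qed

lemma velocity_cong:
  assumes "\<And>s. s \<in> S \<Longrightarrow> \<gamma> s = \<eta> s" "open S" "t \<in> S"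
  shows "velocity A \<gamma> t = velocity A \<eta> t"
proof -
  have "vector_derivative (snd c \<circ> \<gamma>) (at t) = vector_derivative (snd c \<circ> \<eta>) (at t)" for c :: "('a,'e) chart"
    by (rule vector_derivative_cong_eq) 
      (use assms in \<open>auto simp: eventually_nhds intro!: exI[of _ S]\<close>)
  then show ?thesis
    using assms by (auto simp: velocity_def fun_eq_iff)
qed

end


section \<open>Linear algebra of Lorentz forms\<close>

lemma bilinear_pullback:
  assumes "bilinear f" "linear g"
  shows "bilinear (\<lambda>u v. f (g u) (g v))"
  using assms unfolding bilinear_def by (auto intro: linear_compose[unfolded o_def])

text \<open>In the coordinates \<open>M\<close>, a Lorentz form is the Euclidean inner product with the sign of one
  direction \<open>b0\<close> reversed.\<close>

lemma lorentz_form_minkowski: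
  fixes B :: "'e::euclidean_space \<Rightarrow> 'e \<Rightarrow> real"
  assumes "lorentz_form B"
  shows "\<exists>(M :: 'e \<Rightarrow> 'e) b0. linear M \<and> bij M \<and> b0 \<in> Basis \<and>
    (\<forall>x y. B x y = M x \<bullet> M y - 2 * (M x \<bullet> b0) * (M y \<bullet> b0))"
proof -
  obtain L :: "'e \<Rightarrow> 'e" and b0 where L: "linear L" "bij L" "b0 \<in> Basis"
    and B: "\<And>x y. B (L x) (L y) = (\<Sum>b\<in>Basis - {b0}. (x \<bullet> b) * (y \<bullet> b)) - (x \<bullet> b0) * (y \<bullet> b0)"
    using assms unfolding lorentz_form_def by blast
  have B': "B (L x) (L y) = x \<bullet> y - 2 * (x \<bullet> b0) * (y \<bullet> b0)" for x y
    unfolding B euclidean_inner[of x y] using L(3) by (simp add: sum.remove[of Basis b0] algebra_simps)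
  have "linear (inv L)"
    using L inj_linear_imp_inv_linear bij_is_inj by blast
  moreover have "B x y = inv L x \<bullet> inv L y - 2 * (inv L x \<bullet> b0) * (inv L y \<bullet> b0)" for x y
    using B'[of "inv L x" "inv L y"] L(2) by (simp add: bij_is_surj surj_f_inv_f)
  ultimately show ?thesis
    using bij_imp_bij_inv[OF L(2)] L(3) by blast
qed

lemma lorentz_form_bilinear:
  fixes B :: "'e::euclidean_space \<Rightarrow> 'e \<Rightarrow> real"
  assumes "lorentz_form B"
  shows "bilinear B"
proof -
  obtain M :: "'e \<Rightarrow> 'e" and b0 where M: "linear M" "bij M" "b0 \<in> Basis" "\<And>x y. B x y = M x \<bullet> M y - 2 * (M x \<bullet> b0) * (M y \<bullet> b0)"
    using lorentz_form_minkowski[OF assms] by blast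
  show ?thesis
    unfolding bilinear_def M(4) using linear_add[OF M(1)] linear_cmul[OF M(1)]
    by (auto intro!: linearI simp: inner_add_left inner_add_right algebra_simps)
qed

lemma lorentz_form_sym:
  assumes "lorentz_form B"
  shows "B x y = B y x"
  using lorentz_form_minkowski[OF assms] by (auto simp: inner_commute mult_ac)

lemma lorentz_form_nondegenerate:
  fixes B :: "'e::euclidean_space \<Rightarrow> 'e \<Rightarrow> real"
  assumes "lorentz_form B" "\<And>y. B x y = 0"
  shows "x = 0"
proof -
  obtain M :: "'e \<Rightarrow> 'e" and b0 where M: "linear M" "bij M" "b0 \<in> Basis"
      "\<And>x y. B x y = M x \<bullet> M y - 2 * (M x \<bullet> b0) * (M y \<bullet> b0)"
    using lorentz_form_minkowski[OF assms(1)] by blast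
  obtain y where My: "M y = M x - (2 * (M x \<bullet> b0)) *\<^sub>R b0"
    using M(2) by (metis bij_pointE)
  have "B x y = M x \<bullet> M x"
    unfolding M(4) My using M(3) by (simp add: inner_diff_left inner_diff_right algebra_simps)
  then have "M x = 0" using assms(2) by simp
  then show ?thesis
    using M(1,2) by (metis bij_pointE linear_0)
qed

text \<open>The orthogonal complement of a null vector is positive semidefinite, with that vector
  spanning its null directions.\<close>

lemma lorentz_form_null_orthogonal:
  fixes B :: "'e::euclidean_space \<Rightarrow> 'e \<Rightarrow> real"
  assumes "lorentz_form B" "B v v = 0" "v \<noteq> 0" "B u v = 0"
  shows "B u u \<ge> 0" and "B u u = 0 \<Longrightarrow> \<exists>k. u = k *\<^sub>R v"
proof -
  obtain M :: "'e \<Rightarrow> 'e" and b0 where M: "linear M" "bij M" "b0 \<in> Basis"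
      "\<And>x y. B x y = M x \<bullet> M y - 2 * (M x \<bullet> b0) * (M y \<bullet> b0)"
    using lorentz_form_minkowski[OF assms(1)] by blast
  define a where "a = M u \<bullet> b0"
  define b where "b = M v \<bullet> b0"
  \<comment> \<open>The identity \<open>z \<bullet> z = b\<^sup>2 B u u\<close> gives both claims.\<close>
  define z where "z = b *\<^sub>R M u - a *\<^sub>R M v"
  have Mv: "M v \<noteq> 0"
    using assms(3) M(1,2) by (metis bij_pointE linear_0)
  have vv: "M v \<bullet> M v = 2 * b * b" and uv: "M u \<bullet> M v = 2 * a * b"
    using assms(2,4) by (simp_all add: M(4) a_def b_def)
  have "b \<noteq> 0" using vv Mv by auto
  have "z \<bullet> z = b * b * (M u \<bullet> M u) - 2 * a * b * (M u \<bullet> M v) + a * a * (M v \<bullet> M v)"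
    by (simp add: z_def inner_diff_left inner_diff_right inner_commute algebra_simps)
  also have "\<dots> = b * b * B u u"
    by (simp add: vv uv M(4) a_def[symmetric]) algebra
  finally have *: "z \<bullet> z = b * b * B u u" .
  moreover have bb: "b * b > 0" using \<open>b \<noteq> 0\<close> by (auto simp: mult_less_0_iff zero_less_mult_iff linorder_neq_iff)
  ultimately show "B u u \<ge> 0"
    by (metis inner_ge_zero zero_le_mult_iff less_le_not_le)
  assume "B u u = 0"
  then have "z = 0" using * by simp
  then have "b *\<^sub>R M u = M (a *\<^sub>R v)"
    by (simp add: z_def linear_cmul[OF M(1)])
  then have "M (b *\<^sub>R u) = M (a *\<^sub>R v)"
    by (simp add: linear_cmul[OF M(1)])
  then have "b *\<^sub>R u = a *\<^sub>R v"
    using M(2) by (metis bij_is_inj injD)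
  then have "u = (a / b) *\<^sub>R v"
    using \<open>b \<noteq> 0\<close> by (metis divide_inverse_commute pth_1 real_vector_eq_affinity scaleR_scaleR left_inverse)
  then show "\<exists>k. u = k *\<^sub>R v" by blast
qed

lemma hyperplane_decomposition:
  fixes V :: "'e::euclidean_space set"
  assumes "subspace V" "dim V = DIM('e) - 1" "z \<notin> V"
  obtains w s where "w \<in> V" "x = w + s *\<^sub>R z"
proof -
  have "dim (insert z V) = DIM('e)"
    using assms DIM_positive[where 'a = 'e] by (simp add: dim_insert span_eq_iff[THEN iffD2])
  then have "x \<in> span (insert z V)"
    using dim_eq_full by blast
  then obtain k where "x - k *\<^sub>R z \<in> V"
    using assms(1) by (auto simp: span_breakdown_eq span_eq_iff[THEN iffD2])
  then show ?thesis using that[of "x - k *\<^sub>R z" k] by simp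
qed

lemma vector_derivative_in_subspace:
  fixes f :: "real \<Rightarrow> 'e::euclidean_space"
  assumes "subspace V" "open J" "t \<in> J" "\<And>s. s \<in> J \<Longrightarrow> f s \<in> V" "(f has_vector_derivative w) (at t)"
  shows "w \<in> V"
proof -
  \<comment> \<open>The component \<open>z\<close> of \<open>w\<close> orthogonal to \<open>V\<close> vanishes because \<open>f \<bullet> z\<close> does.\<close>
  obtain y z where yz: "y \<in> span V" "\<And>x. x \<in> span V \<Longrightarrow> orthogonal z x" "w = y + z"
    using orthogonal_subspace_decomp_exists[of V w] by metis
  have "((\<lambda>s. f s \<bullet> z) has_vector_derivative w \<bullet> z) (at t)"
    by (rule bounded_linear.has_vector_derivative[OF bounded_linear_inner_left assms(5)])
  moreover have "((\<lambda>s. f s \<bullet> z) has_vector_derivative 0) (at t)"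
    by (rule has_vector_derivative_transform_within_open[of "\<lambda>_. 0" _ _ J])
      (use assms yz(2)[OF span_base] in \<open>auto simp: orthogonal_def inner_commute[of _ z]\<close>)
  ultimately have "w \<bullet> z = 0"
    using vector_derivative_unique_at by blast
  then have "z = 0"
    using yz(2)[OF yz(1)] by (simp add: yz(3) inner_add_left orthogonal_def inner_commute[of y z])
  then show ?thesis
    using yz assms(1) by (simp add: span_eq_iff[THEN iffD2])
qed


section \<open>Submanifolds in slice charts\<close>

context atlas
begin

text \<open>A slice chart \<open>c\<close> of the submanifold \<open>T\<close>: \<open>U\<close> is the piece of \<open>T\<close> that the chart maps onto the
  part of its image in the subspace \<open>V\<close>. The dimension of \<open>V\<close> is left open.\<close>

definition slice :: "'a topology \<Rightarrow> ('a, 'e) chart \<Rightarrow> 'a set \<Rightarrow> 'e set \<Rightarrow> bool" where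
  "slice T c U V \<longleftrightarrow> openin T U \<and> subtopology T U = top_of_set U \<and> c \<in> max_atlas A \<and> U \<subseteq> fst c \<and>
     subspace V \<and> snd c ` U = snd c ` fst c \<inter> V"

lemma submanifold_slice:
  assumes "submanifold A k T" "p \<in> topspace T"
  obtains c U V where "slice T c U V" "p \<in> U" "dim V = k"
  using assms unfolding submanifold_def slice_def by metis

lemma slice_mem:
  assumes "slice T c U V" "q \<in> fst c"
  shows "q \<in> U \<longleftrightarrow> snd c q \<in> V"
  using assms chartD(8)[of c] unfolding slice_def by (blast dest: inj_onD)

lemma slice_inv:
  assumes "slice T c U V" "x \<in> snd c ` fst c" "x \<in> V"
  shows "chart_inv c x \<in> U"
  using assms slice_mem[OF assms(1)] chartD(6,7)[of c x] unfolding slice_def by metis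

lemma slice_openin:
  assumes "slice T c U V" "open S"
  shows "openin T (U \<inter> S)"
proof -
  have "openin (top_of_set U) (U \<inter> S)" using assms(2) by (rule openin_open_Int)
  then show ?thesis
    using assms(1) unfolding slice_def by (metis openin_trans_full)
qed

lemma submanifold_continuous_map:
  assumes "submanifold A k T"
  shows "continuous_map T euclidean id"
proof -
  have "openin T {p \<in> topspace T. p \<in> S}" if "open S" for S
  proof (subst openin_subopen, intro ballI)
    fix p assume p: "p \<in> {p \<in> topspace T. p \<in> S}"
    then have "p \<in> topspace T" by simp
    then obtain c U V where s: "slice T c U V" "p \<in> U" "dim V = k"
      by (rule submanifold_slice[OF assms])
    then have "U \<subseteq> topspace T" unfolding slice_def by (simp add: openin_subset)
    then show "\<exists>Q. openin T Q \<and> p \<in> Q \<and> Q \<subseteq> {p \<in> topspace T. p \<in> S}"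
      using slice_openin[OF s(1) that] p s by (intro exI[of _ "U \<inter> S"]) auto
  qed
  then show ?thesis by (simp add: continuous_map_def)
qed

lemma submanifold_openin_ambient:
  assumes "submanifold A k T" "open S"
  shows "openin T (topspace T \<inter> S)"
proof -
  have "openin T {p \<in> topspace T. id p \<in> S}"
    by (rule openin_continuous_map_preimage[OF submanifold_continuous_map[OF assms(1)]]) (use assms(2) in simp)
  moreover have "{p \<in> topspace T. id p \<in> S} = topspace T \<inter> S" by auto
  ultimately show ?thesis by simp
qed

lemma submanifold_Hausdorff:
  assumes "submanifold A k T"
  shows "Hausdorff_space T"
proof -
  have "\<exists>U V. openin T U \<and> openin T V \<and> x \<in> U \<and> y \<in> V \<and> disjnt U V"
    if xy: "x \<in> topspace T" "y \<in> topspace T" "x \<noteq> y" for x y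
  proof -
    obtain U V where "open U" "open V" "x \<in> U" "y \<in> V" "U \<inter> V = {}"
      using hausdorff[OF xy(3)] by blast
    then show ?thesis
      using submanifold_openin_ambient[OF assms] xy
      by (intro exI[of _ "topspace T \<inter> U"] exI[of _ "topspace T \<inter> V"]) (auto simp: disjnt_def)
  qed
  then show ?thesis by (auto simp: Hausdorff_space_def)
qed

lemma smooth_curve_ambient:
  assumes "submanifold A k T" "open J" "smooth_curve A T J \<gamma>"
  shows "ambient_curve J \<gamma>" "continuous_map (top_of_set J) T \<gamma>" "\<And>t. t \<in> J \<Longrightarrow> \<gamma> t \<in> topspace T"
proof -
  show c: "continuous_map (top_of_set J) T \<gamma>"
    using assms(3) by (simp add: smooth_curve_def)
  from continuous_map_compose[OF this submanifold_continuous_map[OF assms(1)]]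
  have "continuous_on J \<gamma>" by simp
  then show "ambient_curve J \<gamma>"
    using assms unfolding ambient_curve_def smooth_curve_def by simp
  show "\<And>t. t \<in> J \<Longrightarrow> \<gamma> t \<in> topspace T"
    using c continuous_map_image_subset_topspace by fastforce
qed

lemma smooth_curveI:
  assumes "ambient_curve J \<gamma>" "continuous_map (top_of_set J) T \<gamma>"
  shows "smooth_curve A T J \<gamma>"
  using assms unfolding smooth_curve_def ambient_curve_def by simp

lemma smooth_curve_in_slice:
  assumes "slice T c U V" "ambient_curve J \<gamma>" "\<gamma> ` J \<subseteq> U"
  shows "smooth_curve A T J \<gamma>"
proof (rule smooth_curveI[OF assms(2)])
  have "continuous_map (top_of_set J) (subtopology T U) \<gamma>"
    using assms unfolding slice_def ambient_curve_def by (auto simp: image_subset_iff_funcset)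
  then show "continuous_map (top_of_set J) T \<gamma>"
    by (rule continuous_map_into_fulltopology)
qed

lemma curve_open_preimage:
  assumes "continuous_map (top_of_set J) T \<gamma>" "open (J::real set)" "openin T U"
  shows "open (J \<inter> \<gamma> -` U)"
proof -
  have "openin (top_of_set J) {t \<in> topspace (top_of_set J). \<gamma> t \<in> U}"
    by (rule openin_continuous_map_preimage[OF assms(1,3)])
  moreover have "{t \<in> topspace (top_of_set J). \<gamma> t \<in> U} = J \<inter> \<gamma> -` U" by auto
  ultimately show ?thesis
    using openin_open_eq[OF assms(2)] by simp
qed

lemma slice_curve_derivative:
  assumes "submanifold A k T" "slice T c U V" "open J" "smooth_curve A T J \<gamma>" "t \<in> J" "\<gamma> t \<in> U"
  obtains w where "w \<in> V" "((snd c \<circ> \<gamma>) has_vector_derivative w) (at t)" "velocity A \<gamma> t = coord_vec A c (\<gamma> t) w"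
proof -
  have c: "c \<in> max_atlas A" "\<gamma> t \<in> fst c" using assms unfolding slice_def by auto
  note amb = smooth_curve_ambient[OF assms(1,3,4)]
  let ?w = "vector_derivative (snd c \<circ> \<gamma>) (at t)"
  note d = ambient_curve_deriv[OF amb(1) c(1) assms(5) c(2)]
  have "?w \<in> V"
  proof (rule vector_derivative_in_subspace[OF _ _ _ _ d])
    show "open (J \<inter> \<gamma> -` U)"
      by (rule curve_open_preimage[OF amb(2) assms(3)]) (use assms(2) in \<open>simp add: slice_def\<close>)
  qed (use assms slice_mem[OF assms(2)] in \<open>auto simp: slice_def\<close>)
  then show ?thesis
    using that d ambient_curve_velocity[OF amb(1) c(1) assms(5) c(2)] by blast
qed

lemma slice_nhd:
  assumes s: "slice T c U V" and S: "openin T S" "q0 \<in> S" "q0 \<in> U"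
  obtains r where "r > 0" "ball (snd c q0) r \<subseteq> snd c ` fst c" "{q\<in>U. dist (snd c q) (snd c q0) < r} \<subseteq> S"
proof -
  have c: "c \<in> max_atlas A" and U: "U \<subseteq> fst c" "subtopology T U = top_of_set U"
    using s unfolding slice_def by auto
  have "openin (subtopology T U) (U \<inter> S)"
    using S(1) by (metis inf_commute openin_subtopology)
  then obtain S' where S': "open S'" "U \<inter> S = U \<inter> S'"
    unfolding U(2) by (auto simp: openin_open)
  have "open (snd c ` (fst c \<inter> S'))" by (rule chart_open_image[OF max_chart[OF c] S'(1)])
  moreover have "snd c q0 \<in> snd c ` (fst c \<inter> S')" using S S' U by blast
  ultimately obtain r where r: "r > 0" "ball (snd c q0) r \<subseteq> snd c ` (fst c \<inter> S')"
    using open_contains_ball by metis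
  have "q \<in> S" if q: "q \<in> U" "dist (snd c q) (snd c q0) < r" for q
  proof -
    have "snd c q \<in> snd c ` (fst c \<inter> S')" using q r(2) by (auto simp: dist_commute)
    then have "q \<in> S'" using chartD(8)[OF c] q U by (auto dest: inj_onD)
    then show ?thesis using S'(2) q by blast
  qed
  then show ?thesis using that[OF r(1)] r(2) by blast
qed

text \<open>Straight lines in a slice chart are smooth curves in the submanifold, on the open set of
  parameters for which they stay in the open part \<open>B\<close> of the image of the chart.\<close>

lemma slice_affine:
  assumes s: "slice T c U V" and x: "x0 \<in> V" "u \<in> V" and B: "open B" "B \<subseteq> snd c ` fst c"
  defines "y \<equiv> \<lambda>t::real. x0 + t *\<^sub>R u"
  shows "open (y -` B)" "smooth_curve A T (y -` B) (chart_inv c \<circ> y)"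
    "\<And>t. t \<in> y -` B \<Longrightarrow> chart_inv c (y t) \<in> U"
    "\<And>t. t \<in> y -` B \<Longrightarrow> snd c (chart_inv c (y t)) = y t"
    "\<And>t. t \<in> y -` B \<Longrightarrow> velocity A (chart_inv c \<circ> y) t = coord_vec A c (chart_inv c (y t)) u"
proof -
  have c: "c \<in> max_atlas A" "subspace V"
    using s unfolding slice_def by auto
  show op: "open (y -` B)"
    unfolding y_def by (rule open_vimage[OF B(1)]) (intro continuous_intros)
  have sm: "smooth_on (y -` B) y"
    using op unfolding y_def by (intro smooth_on_add smooth_on_scaleR smooth_on_const smooth_on_id)
  have sub: "y ` (y -` B) \<subseteq> snd c ` fst c" using B by auto
  have V: "y t \<in> V" for t using c x by (simp add: y_def subspace_add subspace_scale)
  have dy: "(y has_vector_derivative u) (at t)" for t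
    unfolding y_def by (auto intro!: derivative_eq_intros)
  show U: "chart_inv c (y t) \<in> U" if "t \<in> y -` B" for t
    using slice_inv[OF s] sub V that by blast
  show "smooth_curve A T (y -` B) (chart_inv c \<circ> y)"
    by (rule smooth_curve_in_slice[OF s chart_curve[OF c(1) op sm sub]]) (use U in auto)
  show "velocity A (chart_inv c \<circ> y) t = coord_vec A c (chart_inv c (y t)) u" if "t \<in> y -` B" for t
    by (rule chart_curve_velocity[OF c(1) op sm sub that dy])
  show "snd c (chart_inv c (y t)) = y t" if "t \<in> y -` B" for t
    using chartD(6)[OF c(1)] sub that by blast
qed

lemma slice_tangent_space:
  assumes "submanifold A k T" "slice T c U V" "p \<in> U"
  shows "sub_tangent_space A T p = coord_vec A c p ` V"
proof (intro equalityI subsetI)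
  fix v assume "v \<in> sub_tangent_space A T p"
  then obtain \<gamma> e where *: "v = velocity A \<gamma> 0" "e > 0" "smooth_curve A T {-e<..<e} \<gamma>" "\<gamma> 0 = p"
    unfolding sub_tangent_space_def by blast
  then show "v \<in> coord_vec A c p ` V"
    using slice_curve_derivative[OF assms(1,2) open_greaterThanLessThan *(3), of 0] assms(3) by auto
next
  fix v assume "v \<in> coord_vec A c p ` V"
  then obtain u where u: "u \<in> V" "v = coord_vec A c p u" by blast
  have c: "c \<in> max_atlas A" "p \<in> fst c" "snd c p \<in> V"
    using assms slice_mem[OF assms(2)] unfolding slice_def by auto
  define y where "y = (\<lambda>t::real. snd c p + t *\<^sub>R u)"
  note l = slice_affine[OF assms(2) c(3) u(1) chartD(2)[OF c(1)] order_refl, folded y_def]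
  have "0 \<in> y -` (snd c ` fst c)" using c by (auto simp: y_def)
  then obtain e where e: "e > 0" "ball 0 e \<subseteq> y -` (snd c ` fst c)"
    using l(1) open_contains_ball by metis
  have b: "ball 0 e = {-e<..<e}" by (auto simp: dist_real_def)
  have "smooth_curve A T {-e<..<e} (chart_inv c \<circ> y)"
    using l(2) e(2) unfolding b smooth_curve_def
    by (auto intro: smooth_on_subset continuous_map_from_subtopology_mono)
  moreover have "(chart_inv c \<circ> y) 0 = p" using chartD(5)[OF c(1,2)] by (simp add: y_def)
  moreover have "velocity A (chart_inv c \<circ> y) 0 = v"
    using l(5)[OF \<open>0 \<in> _\<close>] u(2) chartD(5)[OF c(1,2)] by (simp add: y_def)
  ultimately show "v \<in> sub_tangent_space A T p"
    unfolding sub_tangent_space_def using e(1) by blast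
qed

lemma smooth_curve_velocity_tangent:
  assumes "submanifold A k T" "open J" "smooth_curve A T J \<gamma>" "t \<in> J"
  shows "velocity A \<gamma> t \<in> sub_tangent_space A T (\<gamma> t)"
proof -
  obtain c U V where s: "slice T c U V" "\<gamma> t \<in> U"
    using submanifold_slice[OF assms(1) smooth_curve_ambient(3)[OF assms]] by metis
  then show ?thesis
    using slice_curve_derivative[OF assms(1) s(1) assms(2-4) s(2)] slice_tangent_space[OF assms(1) s]
    by (metis imageI)
qed

lemma sub_tangent_space_tangent:
  assumes "submanifold A k T" "p \<in> topspace T" "v \<in> sub_tangent_space A T p"
  shows "v \<in> tangent_space A p"
proof -
  obtain c U V where s: "slice T c U V" "p \<in> U"
    using submanifold_slice[OF assms(1,2)] by metis
  then show ?thesis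
    using slice_tangent_space[OF assms(1) s] assms(3) coord_vec_tangent[of c p] unfolding slice_def by auto
qed

text \<open>A field of bilinear forms that is smooth in the charts of \<open>A\<close> is smooth in every chart of the
  maximal atlas.\<close>

lemma bilinear_field_max:
  fixes B :: "'a \<Rightarrow> ('a, 'e) tvec \<Rightarrow> ('a, 'e) tvec \<Rightarrow> real"
  assumes W: "open W"
    and bil: "\<And>d p. d \<in> A \<Longrightarrow> p \<in> fst d \<inter> W \<Longrightarrow> bilinear (\<lambda>u v. B p (coord_vec A d p u) (coord_vec A d p v))"
    and sm: "\<And>d u v. d \<in> A \<Longrightarrow> smooth_on (snd d ` (fst d \<inter> W))
        (\<lambda>x. B (chart_inv d x) (coord_vec A d (chart_inv d x) u) (coord_vec A d (chart_inv d x) v))"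
    and c: "c \<in> max_atlas A"
  shows "p \<in> fst c \<inter> W \<Longrightarrow> bilinear (\<lambda>u v. B p (coord_vec A c p u) (coord_vec A c p v))"
    and "smooth_on (snd c ` (fst c \<inter> W))
        (\<lambda>x. B (chart_inv c x) (coord_vec A c (chart_inv c x) u) (coord_vec A c (chart_inv c x) v))"
proof -
  show "bilinear (\<lambda>u v. B p (coord_vec A c p u) (coord_vec A c p v))" if p: "p \<in> fst c \<inter> W" for p
  proof -
    obtain d where d: "d \<in> A" "p \<in> fst d" by (rule chart_around)
    have dm: "d \<in> max_atlas A" using d atlas_subset_max by auto
    show ?thesis
      using bilinear_pullback[OF bil[OF d(1), of p] jacobian_linear[OF c dm]] p d
      by (simp add: coord_vec_change[OF c _ dm])
  qed
  show "smooth_on (snd c ` (fst c \<inter> W))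
        (\<lambda>x. B (chart_inv c x) (coord_vec A c (chart_inv c x) u) (coord_vec A c (chart_inv c x) v))" (is "smooth_on _ ?f")
  proof (rule smooth_on_local)
    fix x assume "x \<in> snd c ` (fst c \<inter> W)"
    then obtain p where p: "p \<in> fst c" "p \<in> W" "x = snd c p" by auto
    obtain d where d: "d \<in> A" "p \<in> fst d" by (rule chart_around)
    have dm: "d \<in> max_atlas A" using d atlas_subset_max by auto
    let ?U = "snd c ` (fst c \<inter> (fst d \<inter> W))"
    have opU: "open ?U"
      by (rule chart_open_image[OF max_chart[OF c] open_Int[OF chartD(1)[OF dm] W]])
    let ?b = "\<lambda>y u v. B (chart_inv d y) (coord_vec A d (chart_inv d y) u) (coord_vec A d (chart_inv d y) v)"
    let ?\<tau> = "transition c d" and ?J = "\<lambda>x. frechet_derivative (transition c d) (at x)"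
    have tr: "smooth_on ?U ?\<tau>"
      by (rule smooth_on_subset[OF transition_smooth[OF c dm]]) auto
    have J: "smooth_on ?U (\<lambda>x. ?J x w)" for w
      by (rule smooth_on_frechet[OF tr])
    have inU: "chart_inv c x \<in> fst c" "chart_inv c x \<in> fst d" "chart_inv c x \<in> W" "snd c (chart_inv c x) = x"
      "chart_inv d (?\<tau> x) = chart_inv c x" if "x \<in> ?U" for x
      using that chartD(5)[OF c] chartD(5)[OF dm] by (auto simp: transition_def)
    have bilx: "bilinear (?b (?\<tau> x))" if "x \<in> ?U" for x
      using bil[OF d(1), of "chart_inv c x"] inU[OF that] by simp
    have base: "smooth_on ?U (\<lambda>x. ?b (?\<tau> x) u v)" for u v
      by (rule smooth_on_compose[OF opU tr sm[OF d(1)]]) (use inU in \<open>auto simp: transition_def\<close>)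
    have s1: "smooth_on ?U (\<lambda>x. ?b (?\<tau> x) w (?J x v))" for w
      by (rule smooth_on_linear_family[where L = "\<lambda>x. ?b (?\<tau> x) w", OF opU _ base J])
        (use bilx in \<open>simp add: bilinear_def\<close>)
    have s2: "smooth_on ?U (\<lambda>x. ?b (?\<tau> x) (?J x u) (?J x v))"
      by (rule smooth_on_linear_family[where L = "\<lambda>x w. ?b (?\<tau> x) w (?J x v)", OF opU _ s1 J])
        (use bilx in \<open>simp add: bilinear_def\<close>)
    have "smooth_on ?U ?f"
    proof (rule smooth_on_cong_imp[OF s2 opU])
      fix x assume x: "x \<in> ?U"
      note i = inU[OF x]
      have "coord_vec A c (chart_inv c x) w = coord_vec A d (chart_inv c x) (?J x w)" for w
        using coord_vec_change[OF c i(1) dm i(2)] i(4) by (simp add: jacobian_def)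
      then show "?b (?\<tau> x) (?J x u) (?J x v) = ?f x"
        using i by simp
    qed
    then show "\<exists>U. open U \<and> x \<in> U \<and> smooth_on U ?f"
      using opU p d by blast
  qed
qed

end


section \<open>Null hypersurfaces with a rigging\<close>

text \<open>A null hypersurface \<open>T\<close> with a closed rigging \<open>\<zeta>\<close>, defined on \<open>W\<close>. Here \<open>\<omega>\<close> is the rigging form, \<open>h\<close> the
  rigged metric and \<open>\<xi>\<close> the rigged vector field.\<close>

locale null_normalization = atlas A
  for A :: "('a::{t2_space, second_countable_topology}, 'e::euclidean_space) chart set" +
  fixes g :: "'a \<Rightarrow> ('a, 'e) tvec \<Rightarrow> ('a, 'e) tvec \<Rightarrow> real"
    and T :: "'a topology" and W :: "'a set" and \<zeta> :: "'a \<Rightarrow> ('a, 'e) tvec"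
  assumes lorentzian: "lorentzian_metric A g"
    and normalization: "closed_normalization A g T W \<zeta>"
begin

abbreviation \<omega> :: "'a \<Rightarrow> ('a, 'e) tvec \<Rightarrow> real" where "\<omega> \<equiv> rigging_form g \<zeta>"
abbreviation h :: "'a \<Rightarrow> ('a, 'e) tvec \<Rightarrow> ('a, 'e) tvec \<Rightarrow> real" where "h \<equiv> rigged_metric g \<zeta>"
abbreviation \<xi> :: "'a \<Rightarrow> ('a, 'e) tvec" where "\<xi> \<equiv> rigged_vector_field A g T \<zeta>"

text \<open>The form \<open>\<omega>\<close> and the metric \<open>h\<close> at \<open>p\<close> on vectors given by their components in the chart \<open>c\<close>.\<close>

definition \<omega>c :: "('a, 'e) chart \<Rightarrow> 'a \<Rightarrow> 'e \<Rightarrow> real" where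
  "\<omega>c c p u = \<omega> p (coord_vec A c p u)"
definition hc :: "('a, 'e) chart \<Rightarrow> 'a \<Rightarrow> 'e \<Rightarrow> 'e \<Rightarrow> real" where
  "hc c p u v = h p (coord_vec A c p u) (coord_vec A c p v)"

lemma submfd: "submanifold A (DIM('e) - 1) T"
  and openW: "open W" and TW: "topspace T \<subseteq> W"
  and zeta_smooth: "smooth_vector_field A W \<zeta>"
  and zeta_transversal: "p \<in> topspace T \<Longrightarrow> \<zeta> p \<notin> sub_tangent_space A T p"
  and null: "p \<in> topspace T \<Longrightarrow> \<exists>v\<in>sub_tangent_space A T p. v \<noteq> (\<lambda>_. 0) \<and> (\<forall>w\<in>sub_tangent_space A T p. g p v w = 0)"
  and alpha_closed: "closed_form_on A W \<omega>"
  using normalization unfolding closed_normalization_def null_hypersurface_def rigging_def by auto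

lemma lorentz_chart:
  assumes "c \<in> max_atlas A" "p \<in> fst c"
  shows "lorentz_form (\<lambda>u v. g p (coord_vec A c p u) (coord_vec A c p v))"
proof -
  obtain d where d: "d \<in> A" "p \<in> fst d" by (rule chart_around)
  have dm: "d \<in> max_atlas A" using d atlas_subset_max by auto
  let ?J = "jacobian c d p" and ?K = "jacobian d c p"
  have KJ: "?J (?K u) = u" for u
    by (rule jacobian_inverse[OF dm d(2) assms])
  have "lorentz_form (\<lambda>u v. g p (coord_vec A d p u) (coord_vec A d p v))"
    using lorentzian d unfolding lorentzian_metric_def by blast
  then obtain L :: "'e \<Rightarrow> 'e" and b0 where L: "linear L" "bij L" "b0 \<in> Basis"
    "\<And>x y. g p (coord_vec A d p (L x)) (coord_vec A d p (L y)) = (\<Sum>b\<in>Basis - {b0}. (x \<bullet> b) * (y \<bullet> b)) - (x \<bullet> b0) * (y \<bullet> b0)"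
    unfolding lorentz_form_def by blast
  have "linear (?K \<circ> L)"
    by (rule linear_compose[OF L(1) jacobian_linear[OF dm assms(1) d(2) assms(2)]])
  moreover have "bij (?K \<circ> L)"
    by (rule bij_comp[OF L(2) jacobian_bij[OF dm d(2) assms]])
  moreover have "g p (coord_vec A c p ((?K \<circ> L) x)) (coord_vec A c p ((?K \<circ> L) y)) =
    (\<Sum>b\<in>Basis - {b0}. (x \<bullet> b) * (y \<bullet> b)) - (x \<bullet> b0) * (y \<bullet> b0)" for x y
    using L(4) coord_vec_change[OF assms dm d(2)] KJ by simp
  ultimately show ?thesis
    unfolding lorentz_form_def using L(3) by blast
qed

lemma zeta_tangent: "p \<in> W \<Longrightarrow> \<zeta> p \<in> tangent_space A p"
  using zeta_smooth unfolding smooth_vector_field_def by blast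

lemma zeta_coord:
  assumes "d \<in> A" "p \<in> fst d" "p \<in> W"
  shows "\<zeta> p = coord_vec A d p (\<zeta> p d)"
  by (metis assms atlas_subset_max coord_vec_self tangent_space_coord_vec zeta_tangent)

lemma \<omega>c_linear:
  assumes "c \<in> max_atlas A" "p \<in> fst c" "p \<in> W"
  shows "linear (\<omega>c c p)"
proof -
  obtain z where z: "\<zeta> p = coord_vec A c p z"
    using tangent_space_coord_vec[OF assms(1,2) zeta_tangent[OF assms(3)]] .
  then show ?thesis
    using lorentz_form_bilinear[OF lorentz_chart[OF assms(1,2)]]
    unfolding \<omega>c_def rigging_form_def bilinear_def by simp
qed

lemma hc_eq: "hc c p u v = g p (coord_vec A c p u) (coord_vec A c p v) + \<omega>c c p u * \<omega>c c p v"
  by (simp add: hc_def \<omega>c_def rigged_metric_def)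

lemma hc_bilinear:
  assumes "c \<in> max_atlas A" "p \<in> fst c" "p \<in> W"
  shows "bilinear (hc c p)"
proof -
  have "linear (\<lambda>v. \<omega>c c p u * \<omega>c c p v)" "linear (\<lambda>v. \<omega>c c p v * \<omega>c c p u)" for u
    using linear_add[OF \<omega>c_linear[OF assms]] linear_cmul[OF \<omega>c_linear[OF assms]]
    by (auto intro!: linearI simp: algebra_simps)
  then show ?thesis
    using lorentz_form_bilinear[OF lorentz_chart[OF assms(1,2)]]
    unfolding bilinear_def hc_eq by (auto intro!: linear_compose_add)
qed

lemma \<omega>c_smooth:
  assumes d: "d \<in> A"
  shows "smooth_on (snd d ` (fst d \<inter> W)) (\<lambda>x. \<omega>c d (chart_inv d x) u)"
proof -
  have dm: "d \<in> max_atlas A" using d atlas_subset_max by auto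
  let ?S = "snd d ` (fst d \<inter> W)"
  have op: "open ?S" by (rule chart_open_image[OF max_chart[OF dm] openW])
  let ?G = "\<lambda>x u v. g (chart_inv d x) (coord_vec A d (chart_inv d x) u) (coord_vec A d (chart_inv d x) v)"
  have i: "chart_inv d x \<in> fst d" "chart_inv d x \<in> W" if "x \<in> ?S" for x
    using that chartD(5)[OF dm] by auto
  have sg: "smooth_on ?S (\<lambda>x. ?G x u v)" for u v
    by (rule smooth_on_subset[of "snd d ` fst d"]) (use lorentzian d in \<open>auto simp: lorentzian_metric_def\<close>)
  have "smooth_on ?S (\<lambda>x. ?G x (\<zeta> (chart_inv d x) d) u)"
  proof (rule smooth_on_linear_family[where L = "\<lambda>x w. ?G x w u", OF op _ sg])
    show "linear (\<lambda>w. ?G x w u)" if "x \<in> ?S" for x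
      using lorentz_form_bilinear[OF lorentz_chart[OF dm i(1)[OF that]]] unfolding bilinear_def by simp
    show "smooth_on ?S (\<lambda>x. \<zeta> (chart_inv d x) d)"
      using zeta_smooth d unfolding smooth_vector_field_def by blast
  qed
  then show ?thesis
    by (rule smooth_on_cong_imp[OF _ op])
      (use zeta_coord[OF d] i in \<open>simp add: \<omega>c_def rigging_form_def\<close>)
qed

lemma hc_smooth:
  assumes c: "c \<in> max_atlas A"
  shows "smooth_on (snd c ` (fst c \<inter> W)) (\<lambda>x. hc c (chart_inv c x) u v)"
  unfolding hc_def
proof (rule bilinear_field_max(2)[OF openW _ _ c])
  fix d u v assume d: "d \<in> A"
  have dm: "d \<in> max_atlas A" using d atlas_subset_max by auto
  show "bilinear (\<lambda>u v. h p (coord_vec A d p u) (coord_vec A d p v))" if "p \<in> fst d \<inter> W" for p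
    using hc_bilinear[OF dm, of p] that unfolding hc_def[abs_def] by simp
  let ?S = "snd d ` (fst d \<inter> W)"
  have op: "open ?S" by (rule chart_open_image[OF max_chart[OF dm] openW])
  have sg: "smooth_on ?S (\<lambda>x. g (chart_inv d x) (coord_vec A d (chart_inv d x) u) (coord_vec A d (chart_inv d x) v))"
    by (rule smooth_on_subset[of "snd d ` fst d"]) (use lorentzian d in \<open>auto simp: lorentzian_metric_def\<close>)
  show "smooth_on ?S (\<lambda>x. h (chart_inv d x) (coord_vec A d (chart_inv d x) u) (coord_vec A d (chart_inv d x) v))"
    unfolding hc_def[symmetric] hc_eq
    by (intro smooth_on_add smooth_on_mult \<omega>c_smooth d op sg)
qed

text \<open>The null direction \<open>n\<close> of the tangent hyperplane \<open>V\<close> is not in the kernel of \<open>\<omega>\<close>, since otherwise it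
  would be orthogonal to \<open>V\<close> and to \<open>\<zeta>\<close>, hence to all vectors. So it can be normalized by \<open>\<omega> n = 1\<close>. As the
  metric is positive semidefinite on \<open>V\<close> with null directions spanned by \<open>n\<close>, the rigged metric is
  positive definite on \<open>V\<close>.\<close>

lemma null_slice:
  assumes s: "slice T c U V" "p \<in> U" and dimV: "dim V = DIM('e) - 1"
  obtains n where "n \<in> V" "\<omega>c c p n = 1" "\<And>w. w \<in> V \<Longrightarrow> hc c p n w = \<omega>c c p w"
    and "\<And>u. u \<in> V \<Longrightarrow> g p (coord_vec A c p u) (coord_vec A c p u) \<ge> 0"
    and "\<And>u. u \<in> V \<Longrightarrow> u \<noteq> 0 \<Longrightarrow> hc c p u u > 0"
proof -
  have c: "c \<in> max_atlas A" "p \<in> fst c" and V: "subspace V" and pT: "p \<in> topspace T"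
    using s openin_subset unfolding slice_def by blast+
  have pW: "p \<in> W" using pT TW by blast
  let ?B = "\<lambda>u v. g p (coord_vec A c p u) (coord_vec A c p v)"
  note lf = lorentz_chart[OF c]
  note tan = slice_tangent_space[OF submfd s]
  note lin = \<omega>c_linear[OF c pW]
  obtain z where z: "\<zeta> p = coord_vec A c p z"
    using tangent_space_coord_vec[OF c zeta_tangent[OF pW]] .
  have zV: "z \<notin> V" using zeta_transversal[OF pT] z tan by auto
  have om: "\<omega>c c p u = ?B z u" for u by (simp add: \<omega>c_def rigging_form_def z)
  obtain v0 where v0: "v0 \<in> V" "v0 \<noteq> 0" "\<And>w. w \<in> V \<Longrightarrow> ?B v0 w = 0"
    using null[OF pT] unfolding tan using coord_vec_zero[OF c] by auto
  have k: "\<omega>c c p v0 \<noteq> 0"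
  proof
    assume *: "\<omega>c c p v0 = 0"
    have "?B v0 x = 0" for x
    proof -
      obtain w r where "w \<in> V" "x = w + r *\<^sub>R z"
        using hyperplane_decomposition[OF V dimV zV] by blast
      moreover have "linear (?B v0)"
        using lorentz_form_bilinear[OF lf] unfolding bilinear_def by blast
      ultimately show ?thesis
        using v0(3) * om[of v0] lorentz_form_sym[OF lf, of v0 z]
        by (simp add: linear_add[of "?B v0"] linear_cmul[of "?B v0"])
    qed
    then show False using lorentz_form_nondegenerate[OF lf] v0(2) by blast
  qed
  have Bn: "?B u v0 = 0" if "u \<in> V" for u
    using v0(3)[OF that] lorentz_form_sym[OF lf, of v0 u] by simp
  note nonneg = lorentz_form_null_orthogonal[OF lf v0(3)[OF v0(1)] v0(2) Bn]
  define n where "n = inverse (\<omega>c c p v0) *\<^sub>R v0"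
  have lB: "linear (\<lambda>v. ?B v w)" for w
    using lorentz_form_bilinear[OF lf] unfolding bilinear_def by blast
  have n1: "\<omega>c c p n = 1"
    unfolding n_def linear_cmul[OF lin] using k by simp
  show ?thesis
  proof
    show "n \<in> V" using v0 V by (simp add: n_def subspace_scale)
    show "hc c p n w = \<omega>c c p w" if "w \<in> V" for w
      using v0(3)[OF that] n1 linear_cmul[OF lB, of "inverse (\<omega>c c p v0)" v0 w] by (simp add: hc_eq n_def)
    show "hc c p u u > 0" if u: "u \<in> V" "u \<noteq> 0" for u
    proof (cases "?B u u = 0")
      case True
      then obtain a where "u = a *\<^sub>R v0" using nonneg(2)[OF u(1)] by blast
      then have "\<omega>c c p u \<noteq> 0" using k u by (simp add: linear_cmul[OF lin])
      then show ?thesis using True by (auto simp: hc_eq zero_less_mult_iff linorder_neq_iff)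
    next
      case False
      then show ?thesis
        unfolding hc_eq using nonneg(1)[OF u(1)] zero_le_square[of "\<omega>c c p u"] by linarith
    qed
  qed (use n1 nonneg(1) in auto)
qed

text \<open>The vector \<open>n\<close> of the preceding lemma satisfies the equations that define the rigged vector
  field, and positive definiteness makes it the only one.\<close>

lemma rigged_field_slice:
  assumes s: "slice T c U V" "p \<in> U" and dimV: "dim V = DIM('e) - 1"
  obtains n where "n \<in> V" "\<xi> p = coord_vec A c p n" "\<omega>c c p n = 1" "\<And>w. w \<in> V \<Longrightarrow> hc c p n w = \<omega>c c p w"
proof -
  have c: "c \<in> max_atlas A" "p \<in> fst c" and V: "subspace V" and pT: "p \<in> topspace T"
    using s openin_subset unfolding slice_def by blast+
  have pW: "p \<in> W" using pT TW by blast
  note tan = slice_tangent_space[OF submfd s]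
  obtain n where n: "n \<in> V" "\<omega>c c p n = 1" "\<And>w. w \<in> V \<Longrightarrow> hc c p n w = \<omega>c c p w"
    and pos: "\<And>u. u \<in> V \<Longrightarrow> u \<noteq> 0 \<Longrightarrow> hc c p u u > 0"
    using null_slice[OF assms] by metis
  have "\<xi> p = coord_vec A c p n"
    unfolding rigged_vector_field_def tan
  proof (rule the_equality)
    show "coord_vec A c p n \<in> coord_vec A c p ` V \<and>
      (\<forall>w\<in>coord_vec A c p ` V. h p (coord_vec A c p n) w = \<omega> p w)"
      using n(1,3) unfolding hc_def \<omega>c_def by auto
    fix v assume v: "v \<in> coord_vec A c p ` V \<and> (\<forall>w\<in>coord_vec A c p ` V. h p v w = \<omega> p w)"
    then obtain u where u: "u \<in> V" "v = coord_vec A c p u" by blast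
    have "hc c p u w = \<omega>c c p w" if "w \<in> V" for w
      using v u that unfolding hc_def \<omega>c_def by auto
    then have "hc c p (u - n) w = 0" if "w \<in> V" for w
      using bilinear_lsub[OF hc_bilinear[OF c pW], of u n w] n(3)[OF that] that by simp
    moreover have "u - n \<in> V" using u n V by (simp add: subspace_diff)
    ultimately have "u - n = 0" using pos by force
    then show "v = coord_vec A c p n" using u by simp
  qed
  then show ?thesis using that n by blast
qed

lemma rigged_metric_nonneg:
  assumes "p \<in> topspace T" "v \<in> sub_tangent_space A T p"
  shows "\<bar>\<omega> p v\<bar> \<le> sqrt (h p v v)"
proof -
  obtain c U V where s: "slice T c U V" "p \<in> U" "dim V = DIM('e) - 1"
    using submanifold_slice[OF submfd assms(1)] by metis
  obtain u where u: "u \<in> V" "v = coord_vec A c p u"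
    using assms(2) slice_tangent_space[OF submfd s(1,2)] by auto
  have "g p v v \<ge> 0"
    using null_slice[OF s] u by metis
  then have "(\<omega> p v)\<^sup>2 \<le> h p v v"
    by (simp add: rigged_metric_def power2_eq_square)
  then show ?thesis
    using real_sqrt_le_mono by fastforce
qed

end


section \<open>Local primitives of the rigging form and adapted charts\<close>

context atlas
begin

text \<open>A chart composed with a diffeomorphism of an open part of its image is again a chart.\<close>

lemma max_atlas_change:
  assumes c: "c \<in> max_atlas A" and Q: "open Q" "Q \<subseteq> snd c ` fst c" and B: "open B"
    and hom: "homeomorphism Q B G H" and sm: "smooth_on Q G" "smooth_on B H"
  defines "c' \<equiv> (fst c \<inter> snd c -` Q, G \<circ> snd c)"
  shows "c' \<in> max_atlas A" "snd c' ` fst c' = B" "\<And>x. x \<in> B \<Longrightarrow> chart_inv c' x = chart_inv c (H x)"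
proof -
  let ?D = "fst c \<inter> snd c -` Q"
  note cD = chartD[OF c]
  have opD: "open ?D" by (rule chart_open_vimage[OF max_chart[OF c] Q(1)])
  have imD: "snd c ` ?D = Q" using Q(2) by auto
  have "homeomorphism ?D Q (snd c) (chart_inv c)"
  proof (rule homeomorphism_of_subsets)
    show "homeomorphism (fst c) (snd c ` fst c) (snd c) (chart_inv c)"
      using max_chart[OF c] unfolding is_chart_def by blast
  qed (use Q(2) imD in simp_all)
  from homeomorphism_compose[OF this hom]
  have hom': "homeomorphism ?D B (G \<circ> snd c) (chart_inv c \<circ> H)" .
  show im: "snd c' ` fst c' = B"
    using homeomorphism_image1[OF hom'] by (simp add: c'_def)
  have inj: "inj_on (G \<circ> snd c) ?D"
    using homeomorphism_apply1[OF hom'] by (rule inj_on_inverseI)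
  have HB: "chart_inv c (H x) \<in> ?D" "G (snd c (chart_inv c (H x))) = x" if "x \<in> B" for x
    using homeomorphism_image2[OF hom'] homeomorphism_apply2[OF hom' that] that by auto
  show inv: "chart_inv c' x = chart_inv c (H x)" if "x \<in> B" for x
    unfolding chart_inv_def[of c'] using inv_into_f_eq[OF inj HB(1)[OF that]] HB(2)[OF that]
    by (simp add: c'_def)
  have "homeomorphism ?D B (G \<circ> snd c) (chart_inv c')"
    using homeomorphism_cong[OF hom'] inv by auto
  then have ch: "is_chart c'"
    unfolding is_chart_def im using opD B by (simp add: c'_def)
  have "compatible c' d" if d: "d \<in> A" for d
  proof -
    have dm: "d \<in> max_atlas A" using d atlas_subset_max by auto
    note dD = chartD[OF dm]
    let ?U = "snd c' ` (fst c' \<inter> fst d)"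
    have opU: "open ?U" by (rule chart_open_image[OF ch dD(1)])
    have UB: "?U \<subseteq> B" using im by auto
    have Ux: "chart_inv c (H x) \<in> fst d" "chart_inv c (H x) \<in> fst c" "H x \<in> Q" if x: "x \<in> ?U" for x
    proof -
      obtain q where q: "q \<in> fst c'" "q \<in> fst d" "x = snd c' q" using x by auto
      then have "chart_inv c' x = q" using is_chartD(5)[OF ch] by simp
      then show "chart_inv c (H x) \<in> fst d" using inv x UB q by auto
      show "chart_inv c (H x) \<in> fst c" using HB(1) x UB by auto
      show "H x \<in> Q" using homeomorphism_image2[OF hom] x UB by blast
    qed
    have "smooth_on ?U (\<lambda>x. transition c d (H x))"
    proof (rule smooth_on_compose[OF opU smooth_on_subset[OF sm(2) UB] transition_smooth[OF c dm]])
      show "H ` ?U \<subseteq> snd c ` (fst c \<inter> fst d)"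
      proof
        fix y assume "y \<in> H ` ?U"
        then obtain x where x: "x \<in> ?U" "y = H x" by auto
        have "H x \<in> snd c ` fst c" using Ux(3)[OF x(1)] Q(2) by blast
        then have "y = snd c (chart_inv c (H x))" using cD(6) x(2) by simp
        then show "y \<in> snd c ` (fst c \<inter> fst d)" using Ux[OF x(1)] by blast
      qed
    qed
    then have 1: "smooth_on ?U (transition c' d)"
      by (rule smooth_on_cong_imp[OF _ opU]) (use UB inv in \<open>auto simp: transition_def\<close>)
    let ?U' = "snd d ` (fst c' \<inter> fst d)"
    have "fst c' \<inter> fst d = fst d \<inter> ?D" by (auto simp: c'_def)
    then have opU': "open ?U'" using chart_open_image[OF max_chart[OF dm] opD] by simp
    have "smooth_on ?U' (\<lambda>x. G (transition d c x))"
      by (rule smooth_on_compose[OF opU' smooth_on_subset[OF transition_smooth[OF dm c]] sm(1)])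
        (use dD(5) in \<open>auto simp: transition_def c'_def\<close>)
    then have 2: "smooth_on ?U' (transition d c')"
      by (simp add: transition_def c'_def o_def)
    show ?thesis using 1 2 by (simp add: compatible_def)
  qed
  then show "c' \<in> max_atlas A" using ch by (simp add: max_atlas_def)
qed

end

context null_normalization
begin

text \<open>\<open>F\<close> is a primitive of the form \<open>\<omega>\<close>, i.e. \<open>dF = \<omega>\<close>, on the open subset \<open>S\<close> of the ambient manifold.\<close>

definition prim :: "('a \<Rightarrow> real) \<Rightarrow> 'a set \<Rightarrow> bool" where
  "prim F S \<longleftrightarrow> open S \<and> S \<subseteq> W \<and>
     (\<forall>c\<in>max_atlas A. \<forall>p\<in>fst c \<inter> S. ((F \<circ> chart_inv c) has_derivative \<omega>c c p) (at (snd c p)))"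

lemma primD:
  "prim F S \<Longrightarrow> open S" "prim F S \<Longrightarrow> S \<subseteq> W"
  "prim F S \<Longrightarrow> c \<in> max_atlas A \<Longrightarrow> p \<in> fst c \<Longrightarrow> p \<in> S \<Longrightarrow> ((F \<circ> chart_inv c) has_derivative \<omega>c c p) (at (snd c p))"
  by (auto simp: prim_def)

lemma prim_subset: "prim F S \<Longrightarrow> open S' \<Longrightarrow> S' \<subseteq> S \<Longrightarrow> prim F S'"
  unfolding prim_def by blast

lemma prim_change_chart:
  assumes c: "c \<in> max_atlas A" "p \<in> fst c" and d: "d \<in> max_atlas A" "p \<in> fst d"
    and der: "((F \<circ> chart_inv d) has_derivative \<omega>c d p) (at (snd d p))"
  shows "((F \<circ> chart_inv c) has_derivative \<omega>c c p) (at (snd c p))"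
proof -
  have "transition c d (snd c p) = snd d p"
    using chartD(5)[OF c] by (simp add: transition_def)
  then have "((\<lambda>x. (F \<circ> chart_inv d) (transition c d x)) has_derivative (\<lambda>u. \<omega>c d p (jacobian c d p u))) (at (snd c p))"
    using has_derivative_compose[OF jacobian_has_derivative[OF c(1) d(1) c(2) d(2)]] der by metis
  moreover have "(\<lambda>u. \<omega>c d p (jacobian c d p u)) = \<omega>c c p"
    by (simp add: \<omega>c_def coord_vec_change[OF c d] fun_eq_iff)
  ultimately have "((\<lambda>x. (F \<circ> chart_inv d) (transition c d x)) has_derivative \<omega>c c p) (at (snd c p))"
    by simp
  then show ?thesis
    by (rule has_derivative_transform_within_open[OF _ chart_domain_open[OF c(1) d(1)]])
      (use c d chartD(5)[OF c(1)] chartD(5)[OF d(1)] in \<open>auto simp: transition_def\<close>)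
qed

lemma prim_smooth:
  assumes F: "prim F S" and c: "c \<in> max_atlas A"
  shows "smooth_on (snd c ` (fst c \<inter> S)) (F \<circ> chart_inv c)"
proof (rule smooth_on_local)
  fix x assume "x \<in> snd c ` (fst c \<inter> S)"
  then obtain p where p: "p \<in> fst c" "p \<in> S" "x = snd c p" by auto
  obtain d where d: "d \<in> A" "p \<in> fst d" by (rule chart_around)
  have dm: "d \<in> max_atlas A" using d atlas_subset_max by auto
  let ?V = "snd d ` (fst d \<inter> S)"
  have opV: "open ?V" by (rule chart_open_image[OF max_chart[OF dm] primD(1)[OF F]])
  have "smooth_on ?V (F \<circ> chart_inv d)"
  proof (rule smooth_onI[OF opV, where f' = "\<lambda>x. \<omega>c d (chart_inv d x)"])
    show "((F \<circ> chart_inv d) has_derivative \<omega>c d (chart_inv d x)) (at x)" if "x \<in> ?V" for x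
      using that primD(3)[OF F dm] chartD(5)[OF dm] by auto
    show "smooth_on ?V (\<lambda>x. \<omega>c d (chart_inv d x) v)" for v
      by (rule smooth_on_subset[OF \<omega>c_smooth[OF d(1)]]) (use primD(2)[OF F] in auto)
  qed
  let ?U = "snd c ` (fst c \<inter> (fst d \<inter> S))"
  have opU: "open ?U"
    by (rule chart_open_image[OF max_chart[OF c] open_Int[OF chartD(1)[OF dm] primD(1)[OF F]]])
  have "smooth_on ?U (transition c d)"
    by (rule smooth_on_subset[OF transition_smooth[OF c dm]]) auto
  then have "smooth_on ?U (\<lambda>x. (F \<circ> chart_inv d) (transition c d x))"
    by (rule smooth_on_compose[OF opU _ \<open>smooth_on ?V (F \<circ> chart_inv d)\<close>])
      (use chartD(5)[OF c] in \<open>auto simp: transition_def\<close>)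
  then have "smooth_on ?U (F \<circ> chart_inv c)"
    by (rule smooth_on_cong_imp[OF _ opU])
      (use chartD(5)[OF c] chartD(5)[OF dm] in \<open>auto simp: transition_def\<close>)
  then show "\<exists>U. open U \<and> x \<in> U \<and> smooth_on U (F \<circ> chart_inv c)"
    using opU p d by blast
qed

lemma prim_curve:
  assumes F: "prim F S" and \<gamma>: "ambient_curve J \<gamma>" and t: "t \<in> J" "\<gamma> t \<in> S"
  shows "((F \<circ> \<gamma>) has_real_derivative \<omega> (\<gamma> t) (velocity A \<gamma> t)) (at t)"
proof -
  obtain c where c: "c \<in> A" "\<gamma> t \<in> fst c" by (rule chart_around)
  have cm: "c \<in> max_atlas A" using c atlas_subset_max by auto
  let ?w = "vector_derivative (snd c \<circ> \<gamma>) (at t)"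
  note d = ambient_curve_deriv[OF \<gamma> cm t(1) c(2)]
  have lin: "linear (\<omega>c c (\<gamma> t))"
    by (rule \<omega>c_linear[OF cm c(2)]) (use primD(2)[OF F] t in auto)
  have "((\<lambda>s. (F \<circ> chart_inv c) ((snd c \<circ> \<gamma>) s)) has_derivative (\<lambda>s. \<omega>c c (\<gamma> t) (s *\<^sub>R ?w))) (at t)"
    using has_derivative_compose[OF d[unfolded has_vector_derivative_def]] primD(3)[OF F cm c(2) t(2)]
    by (metis comp_apply)
  then have "((\<lambda>s. (F \<circ> chart_inv c) ((snd c \<circ> \<gamma>) s)) has_real_derivative \<omega>c c (\<gamma> t) ?w) (at t)"
    by (simp add: has_field_derivative_def linear_cmul[OF lin] mult_commute_abs)
  then have "((F \<circ> \<gamma>) has_real_derivative \<omega>c c (\<gamma> t) ?w) (at t)"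
    by (rule has_field_derivative_transform_within_open[OF _ ambient_curve_open[OF \<gamma> chartD(1)[OF cm]]])
      (use t c chartD(5)[OF cm] in auto)
  then show ?thesis
    using ambient_curve_velocity[OF \<gamma> cm t(1) c(2)] by (simp add: \<omega>c_def)
qed

lemma prim_exists:
  assumes "p \<in> W"
  obtains F S where "prim F S" "p \<in> S"
proof -
  obtain d where d: "d \<in> A" "p \<in> fst d" by (rule chart_around)
  have dm: "d \<in> max_atlas A" using d atlas_subset_max by auto
  note dD = chartD[OF dm]
  have "open (snd d ` (fst d \<inter> W))" by (rule chart_open_image[OF max_chart[OF dm] openW])
  moreover have "snd d p \<in> snd d ` (fst d \<inter> W)" using d assms by auto
  ultimately obtain r where r: "r > 0" "ball (snd d p) r \<subseteq> snd d ` (fst d \<inter> W)"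
    using open_contains_ball by metis
  let ?B = "ball (snd d p) r"
  have inv: "chart_inv d x \<in> fst d" "chart_inv d x \<in> W" if "x \<in> ?B" for x
    using r(2) that dD(5) by auto
  obtain F where F: "\<And>x. x \<in> ?B \<Longrightarrow> (F has_derivative \<omega>c d (chart_inv d x)) (at x)"
  proof (rule poincare_ball[of "snd d p" r "\<lambda>x. \<omega>c d (chart_inv d x)"])
    show "linear (\<omega>c d (chart_inv d x))" if "x \<in> ?B" for x
      using \<omega>c_linear[OF dm] inv[OF that] by blast
    show "smooth_on ?B (\<lambda>x. \<omega>c d (chart_inv d x) u)" for u
      by (rule smooth_on_subset[OF \<omega>c_smooth[OF d(1)] r(2)])
    show "frechet_derivative (\<lambda>y. \<omega>c d (chart_inv d y) v) (at x) u =
          frechet_derivative (\<lambda>y. \<omega>c d (chart_inv d y) u) (at x) v" if "x \<in> ?B" for x u v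
    proof -
      have "x \<in> snd d ` (fst d \<inter> W)" using r(2) that by blast
      with alpha_closed d(1) have "frechet_derivative (\<lambda>y. \<omega> (chart_inv d y) (coord_vec A d (chart_inv d y) v)) (at x) u -
        frechet_derivative (\<lambda>y. \<omega> (chart_inv d y) (coord_vec A d (chart_inv d y) u)) (at x) v = 0"
        unfolding closed_form_on_def by blast
      then show ?thesis unfolding \<omega>c_def by simp
    qed
  qed blast
  let ?S = "fst d \<inter> snd d -` ?B"
  have "prim (F \<circ> snd d) ?S"
    unfolding prim_def
  proof (intro conjI ballI)
    show "open ?S" by (rule chart_open_vimage[OF max_chart[OF dm] open_ball])
    show "?S \<subseteq> W" using inv(2) dD(5) by fastforce
    fix c q assume c: "c \<in> max_atlas A" and q: "q \<in> fst c \<inter> ?S"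
    have "(F has_derivative \<omega>c d q) (at (snd d q))"
      using F[of "snd d q"] q dD(5) by auto
    then have "((F \<circ> snd d \<circ> chart_inv d) has_derivative \<omega>c d q) (at (snd d q))"
      by (rule has_derivative_transform_within_open[OF _ dD(2)]) (use q dD(6) in auto)
    then show "((F \<circ> snd d \<circ> chart_inv c) has_derivative \<omega>c c q) (at (snd c q))"
      using prim_change_chart[OF c _ dm] q by blast
  qed
  then show ?thesis using that d r by auto
qed

lemma prim_unique:
  assumes F: "prim F S" and F': "prim F' S'" and p: "p \<in> S" "p \<in> S'"
  obtains N where "open N" "p \<in> N" "N \<subseteq> S \<inter> S'" "\<forall>q\<in>N. F q - F' q = F p - F' p"
proof -
  obtain d where d: "d \<in> A" "p \<in> fst d" by (rule chart_around)
  have dm: "d \<in> max_atlas A" using d atlas_subset_max by auto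
  note dD = chartD[OF dm]
  have "open (snd d ` (fst d \<inter> (S \<inter> S')))"
    by (rule chart_open_image[OF max_chart[OF dm] open_Int[OF primD(1)[OF F] primD(1)[OF F']]])
  moreover have "snd d p \<in> snd d ` (fst d \<inter> (S \<inter> S'))" using d p by auto
  ultimately obtain r where r: "r > 0" "ball (snd d p) r \<subseteq> snd d ` (fst d \<inter> (S \<inter> S'))"
    using open_contains_ball by metis
  let ?B = "ball (snd d p) r"
  let ?N = "fst d \<inter> snd d -` ?B"
  have inv: "chart_inv d x \<in> fst d" "chart_inv d x \<in> S" "chart_inv d x \<in> S'" "snd d (chart_inv d x) = x" if "x \<in> ?B" for x
    using r(2) that dD(5) by auto
  have "((\<lambda>x. (F \<circ> chart_inv d) x - (F' \<circ> chart_inv d) x) has_derivative (\<lambda>h. 0)) (at x within ?B)" if x: "x \<in> ?B" for x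
  proof -
    note i = inv[OF x]
    show ?thesis
      using has_derivative_diff[OF primD(3)[OF F dm i(1,2)] primD(3)[OF F' dm i(1,3)]] i(4)
      by (simp add: has_derivative_at_withinI)
  qed
  from has_derivative_zero_constant[OF convex_ball this]
  obtain k where k: "\<And>x. x \<in> ?B \<Longrightarrow> F (chart_inv d x) - F' (chart_inv d x) = k" by auto
  show ?thesis
  proof
    show "open ?N" by (rule chart_open_vimage[OF max_chart[OF dm] open_ball])
    show "?N \<subseteq> S \<inter> S'" using inv(2,3) dD(5) by fastforce
    show "\<forall>q\<in>?N. F q - F' q = F p - F' p"
      using k[of "snd d p"] k dD(5) d r by (metis IntE centre_in_ball vimageE)
  qed (use d r in auto)
qed

text \<open>An adapted chart around \<open>p\<close>: a slice chart with values in a ball around \<open>0 = c p\<close> in which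
  \<open>\<omega>\<close> is the differential of the linear coordinate along a unit vector \<open>e\<close>.\<close>

definition adapted :: "'a \<Rightarrow> ('a, 'e) chart \<Rightarrow> 'a set \<Rightarrow> 'e set \<Rightarrow> real \<Rightarrow> 'e \<Rightarrow> bool" where
  "adapted p c U V \<rho> e \<longleftrightarrow> slice T c U V \<and> dim V = DIM('e) - 1 \<and> p \<in> U \<and> snd c p = 0 \<and> \<rho> > 0 \<and>
     snd c ` fst c = ball 0 \<rho> \<and> e \<in> V \<and> norm e = 1 \<and> prim (\<lambda>q. snd c q \<bullet> e) (fst c)"

text \<open>A slice chart is corrected by the shear of \<open>smooth_inverse_shear\<close>, which replaces the
  coordinate along \<open>e\<close> by a primitive of \<open>\<omega>\<close>. The shear preserves \<open>V\<close> because \<open>e\<close> and the centre lie in \<open>V\<close>.\<close>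

lemma adapted_exists:
  assumes "p \<in> topspace T"
  obtains c U V \<rho> e where "adapted p c U V \<rho> e"
proof -
  obtain c U V where s: "slice T c U V" "p \<in> U" and dimV: "dim V = DIM('e) - 1"
    using submanifold_slice[OF submfd assms] by metis
  have c: "c \<in> max_atlas A" "p \<in> fst c" and V: "subspace V" and UT: "openin T U" "subtopology T U = top_of_set U" "U \<subseteq> fst c"
    using s unfolding slice_def by blast+
  note cD = chartD[OF c(1)]
  have pW: "p \<in> W" using assms TW by blast
  obtain F S where F: "prim F S" "p \<in> S" using prim_exists[OF pW] .
  let ?Q = "snd c ` (fst c \<inter> S)" and ?F = "F \<circ> chart_inv c" and ?x0 = "snd c p"
  have opQ: "open ?Q" by (rule chart_open_image[OF max_chart[OF c(1)] primD(1)[OF F(1)]])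
  have x0: "?x0 \<in> ?Q" "?x0 \<in> V" using c F slice_mem[OF s(1) c(2)] s(2) by auto
  obtain n where n: "n \<in> V" "\<omega>c c p n = 1"
    using rigged_field_slice[OF s dimV] by metis
  note lin = \<omega>c_linear[OF c pW]
  have "n \<noteq> 0" using n(2) linear_0[OF lin] by auto
  \<comment> \<open>Any vector of \<open>V\<close> outside the kernel of \<open>\<omega>\<close> would do for \<open>e\<close>; the null direction is one.\<close>
  define e where "e = inverse (norm n) *\<^sub>R n"
  have e: "norm e = 1" "e \<in> V" "\<omega>c c p e \<noteq> 0"
    using \<open>n \<noteq> 0\<close> n V by (auto simp: e_def linear_cmul[OF lin] subspace_scale)
  have dF: "frechet_derivative ?F (at ?x0) = \<omega>c c p"
    using frechet_derivative_at[OF primD(3)[OF F(1) c F(2)]] by simp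
  define G where "G y = y - ?x0 - ((y - ?x0) \<bullet> e) *\<^sub>R e + (?F y - ?F ?x0) *\<^sub>R e" for y
  obtain Q \<rho> H where Q: "open Q" "Q \<subseteq> ?Q" "?x0 \<in> Q" "\<rho> > 0" "homeomorphism Q (ball 0 \<rho>) G H"
    "smooth_on (ball 0 \<rho>) H" "smooth_on ?Q G"
    by (rule smooth_inverse_shear[OF opQ x0(1) prim_smooth[OF F(1) c(1)] e(1)])
      (use e(3) dF in \<open>auto simp: G_def[abs_def]\<close>)
  define c' where "c' = (fst c \<inter> snd c -` Q, G \<circ> snd c)"
  have Qsub: "Q \<subseteq> snd c ` fst c" using Q(2) by auto
  note ch = max_atlas_change[OF c(1) Q(1) Qsub open_ball Q(5) smooth_on_subset[OF Q(7,2)] Q(6), folded c'_def]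
  have GV: "G y \<in> V \<longleftrightarrow> y \<in> V" for y
  proof -
    have "G y = y + (- ?x0 + (- ((y - ?x0) \<bullet> e) + ?F y - ?F ?x0) *\<^sub>R e)" (is "_ = _ + ?r")
      by (simp add: G_def algebra_simps)
    moreover have "?r \<in> V"
      using x0(2) e(2) V by (intro subspace_add subspace_scale subspace_neg)
    ultimately show ?thesis
      using V by (metis add_diff_cancel_right' subspace_add subspace_diff)
  qed
  have Ge: "G y \<bullet> e = ?F y - ?F ?x0" for y
    using e(1) by (simp add: G_def inner_add_left inner_diff_left dot_square_norm)
  have fc': "fst c' = fst c \<inter> snd c -` Q" and sc': "snd c' q = G (snd c q)" for q
    by (simp_all add: c'_def)
  have opD: "open (fst c')" using chartD(1)[OF ch(1)] .
  have D: "fst c' \<subseteq> fst c" "fst c' \<subseteq> S"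
    using Q(2) cD(8) by (auto simp: fc' dest: inj_onD)
  have sc'e: "snd c' q \<bullet> e = F q - F p" if "q \<in> fst c'" for q
    using that cD(5) c(2) by (simp add: sc' Ge fc')
  have "slice T c' (U \<inter> fst c') V"
    unfolding slice_def
  proof (intro conjI)
    show "openin T (U \<inter> fst c')" by (rule slice_openin[OF s(1) opD])
    show "subtopology T (U \<inter> fst c') = top_of_set (U \<inter> fst c')"
      using UT(2) by (metis subtopology_subtopology)
    show "snd c' ` (U \<inter> fst c') = snd c' ` fst c' \<inter> V"
    proof (intro equalityI subsetI)
      fix y assume "y \<in> snd c' ` (U \<inter> fst c')"
      then show "y \<in> snd c' ` fst c' \<inter> V"
        using slice_mem[OF s(1)] D(1) by (auto simp: sc' GV)
    next
      fix y assume "y \<in> snd c' ` fst c' \<inter> V"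
      then obtain q where q: "q \<in> fst c'" "y = snd c' q" "y \<in> V" by auto
      then have "q \<in> U" using slice_mem[OF s(1), of q] D(1) by (auto simp: sc' GV)
      then show "y \<in> snd c' ` (U \<inter> fst c')" using q by blast
    qed
  qed (use ch V in auto)
  moreover have "p \<in> U \<inter> fst c'" using s(2) c Q(3) by (simp add: fc')
  moreover have "snd c' p = 0" by (simp add: sc' G_def)
  moreover have "prim (\<lambda>q. snd c' q \<bullet> e) (fst c')"
    unfolding prim_def
  proof (intro conjI ballI opD)
    show "fst c' \<subseteq> W" using D(2) primD(2)[OF F(1)] by auto
    fix d q assume d: "d \<in> max_atlas A" and q: "q \<in> fst d \<inter> fst c'"
    have "((F \<circ> chart_inv d) has_derivative \<omega>c d q) (at (snd d q))"
      by (rule primD(3)[OF F(1) d]) (use q D in auto)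
    then have "((\<lambda>x. (F \<circ> chart_inv d) x - F p) has_derivative \<omega>c d q) (at (snd d q))"
      using has_derivative_diff[OF _ has_derivative_const] by fastforce
    then show "((\<lambda>q. snd c' q \<bullet> e) \<circ> chart_inv d has_derivative \<omega>c d q) (at (snd d q))"
      by (rule has_derivative_transform_within_open[OF _ chart_domain_open[OF d ch(1)]])
        (use q sc'e chartD(5)[OF d] in auto)
  qed
  ultimately have "adapted p c' (U \<inter> fst c') V \<rho> e"
    using dimV Q(4) ch(2) e unfolding adapted_def by blast
  then show ?thesis using that by blast
qed

lemma adaptedD:
  assumes "adapted p c U V \<rho> e"
  shows "slice T c U V" "dim V = DIM('e) - 1" "p \<in> U" "snd c p = 0" "\<rho> > 0" "snd c ` fst c = ball 0 \<rho>"
    "e \<in> V" "norm e = 1" "prim (\<lambda>q. snd c q \<bullet> e) (fst c)" "c \<in> max_atlas A" "subspace V" "U \<subseteq> fst c"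
    "openin T U" "subtopology T U = top_of_set U" "snd c ` U = ball 0 \<rho> \<inter> V" "U \<subseteq> topspace T"
proof -
  show "slice T c U V" "dim V = DIM('e) - 1" "p \<in> U" "snd c p = 0" "\<rho> > 0" "snd c ` fst c = ball 0 \<rho>"
    "e \<in> V" "norm e = 1" "prim (\<lambda>q. snd c q \<bullet> e) (fst c)"
    using assms unfolding adapted_def by blast+
  then show "c \<in> max_atlas A" "subspace V" "U \<subseteq> fst c" "subtopology T U = top_of_set U" "snd c ` U = ball 0 \<rho> \<inter> V"
    and *: "openin T U"
    unfolding slice_def by auto
  from openin_subset[OF *] show "U \<subseteq> topspace T" .
qed

lemma adapted_form:
  assumes a: "adapted p c U V \<rho> e" and q: "q \<in> fst c"
  shows "\<omega>c c q u = u \<bullet> e"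
proof -
  note aD = adaptedD[OF a]
  have "((\<lambda>x. x \<bullet> e) has_derivative (\<lambda>u. u \<bullet> e)) (at (snd c q))"
    by (auto intro!: derivative_eq_intros)
  then have "((\<lambda>q. snd c q \<bullet> e) \<circ> chart_inv c has_derivative (\<lambda>u. u \<bullet> e)) (at (snd c q))"
    by (rule has_derivative_transform_within_open[OF _ chartD(2)[OF aD(10)]])
      (use q chartD(6)[OF aD(10)] in auto)
  from has_derivative_unique[OF this primD(3)[OF aD(9,10) q q]]
  show ?thesis by metis
qed

lemma adapted_openin:
  assumes a: "adapted p c U V \<rho> e" and B: "open B"
  shows "openin T {q\<in>U. snd c q \<in> B}"
proof -
  note aD = adaptedD[OF a]
  have "{q\<in>U. snd c q \<in> B} = U \<inter> (fst c \<inter> snd c -` B)" using aD(12) by auto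
  then show ?thesis
    using slice_openin[OF aD(1) chart_open_vimage[OF max_chart[OF aD(10)] B]] by simp
qed

lemma adapted_compact:
  assumes a: "adapted p c U V \<rho> e" and r: "r < \<rho>"
  shows "compactin T {q\<in>U. norm (snd c q) \<le> r}"
proof -
  note aD = adaptedD[OF a]
  have sub: "cball 0 r \<inter> V \<subseteq> snd c ` fst c" using aD(6) r by auto
  have "compact (cball 0 r \<inter> V)"
    by (intro compact_Int_closed closed_subspace aD) auto
  then have "compact (chart_inv c ` (cball 0 r \<inter> V))"
    by (intro compact_continuous_image continuous_on_subset[OF chartD(4)[OF aD(10)] sub])
  moreover have "chart_inv c ` (cball 0 r \<inter> V) = {q\<in>U. norm (snd c q) \<le> r}"
  proof (intro equalityI subsetI)
    fix q assume "q \<in> chart_inv c ` (cball 0 r \<inter> V)"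
    then obtain x where x: "q = chart_inv c x" "norm x \<le> r" "x \<in> V" "x \<in> snd c ` fst c" using sub by auto
    then show "q \<in> {q\<in>U. norm (snd c q) \<le> r}"
      using slice_inv[OF aD(1) x(4,3)] chartD(6)[OF aD(10) x(4)] by simp
  next
    fix q assume q: "q \<in> {q\<in>U. norm (snd c q) \<le> r}"
    then have "q = chart_inv c (snd c q)" "snd c q \<in> V"
      using chartD(5)[OF aD(10)] aD(12,15) by auto
    then show "q \<in> chart_inv c ` (cball 0 r \<inter> V)" using q by auto
  qed
  ultimately have "compactin (subtopology T U) {q\<in>U. norm (snd c q) \<le> r}"
    unfolding aD(14) by (auto simp: compactin_subtopology)
  then show ?thesis by (simp add: compactin_subtopology)
qed

end


section \<open>The leaves of the screen distribution\<close>

context null_normalization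
begin

text \<open>The leaf topology on the hypersurface: its basic open sets are the level sets, in open subsets
  of the hypersurface, of the local primitives of \<open>\<omega>\<close>. Its components are the leaves.\<close>

definition leaf_open :: "'a set \<Rightarrow> bool" where
  "leaf_open S \<longleftrightarrow> S \<subseteq> topspace T \<and>
     (\<forall>x\<in>S. \<exists>F Q U. prim F Q \<and> x \<in> Q \<and> openin T U \<and> x \<in> U \<and> {y\<in>U \<inter> Q. F y = F x} \<subseteq> S)"

definition leaf_top :: "'a topology" where
  "leaf_top = topology leaf_open"

lemma openin_T_ambient: "openin T U \<Longrightarrow> open N \<Longrightarrow> openin T (U \<inter> N)"
proof -
  assume U: "openin T U" and "open N"
  then have "openin T (U \<inter> (topspace T \<inter> N))"
    using submanifold_openin_ambient[OF submfd] by blast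
  moreover have "U \<inter> (topspace T \<inter> N) = U \<inter> N" using openin_subset[OF U] by blast
  ultimately show ?thesis by simp
qed

lemma leaf_openE:
  assumes "leaf_open S" "x \<in> S"
  obtains F Q U where "prim F Q" "x \<in> Q" "openin T U" "x \<in> U" "{y\<in>U \<inter> Q. F y = F x} \<subseteq> S"
  using assms unfolding leaf_open_def by blast

lemma openin_leaf_top: "openin leaf_top = leaf_open"
  unfolding leaf_top_def
proof (rule topology_inverse', unfold istopology_def, intro conjI allI impI)
  fix S S' assume S: "leaf_open S" and S': "leaf_open S'"
  show "leaf_open (S \<inter> S')"
    unfolding leaf_open_def
  proof (intro conjI ballI)
    show "S \<inter> S' \<subseteq> topspace T" using S by (auto simp: leaf_open_def)
    fix x assume "x \<in> S \<inter> S'"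
    then have x: "x \<in> S" "x \<in> S'" by auto
    obtain F Q U where *: "prim F Q" "x \<in> Q" "openin T U" "x \<in> U" "{y\<in>U \<inter> Q. F y = F x} \<subseteq> S"
      by (rule leaf_openE[OF S x(1)])
    obtain F' Q' U' where **: "prim F' Q'" "x \<in> Q'" "openin T U'" "x \<in> U'" "{y\<in>U' \<inter> Q'. F' y = F' x} \<subseteq> S'"
      by (rule leaf_openE[OF S' x(2)])
    obtain N where N: "open N" "x \<in> N" "N \<subseteq> Q \<inter> Q'" "\<forall>q\<in>N. F q - F' q = F x - F' x"
      by (rule prim_unique[OF *(1) **(1) *(2) **(2)])
    have "{y\<in>(U \<inter> U') \<inter> N. F y = F x} \<subseteq> S \<inter> S'"
      using N(3,4) *(5) **(5) by fastforce
    moreover have "prim F N" using prim_subset[OF *(1) N(1)] N(3) by blast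
    ultimately show "\<exists>F Q U. prim F Q \<and> x \<in> Q \<and> openin T U \<and> x \<in> U \<and> {y\<in>U \<inter> Q. F y = F x} \<subseteq> S \<inter> S'"
      using N(2) *(3,4) **(3,4) by (intro exI[of _ F] exI[of _ N] exI[of _ "U \<inter> U'"]) auto
  qed
next
  fix \<K> assume *: "\<forall>K\<in>\<K>. leaf_open K"
  show "leaf_open (\<Union>\<K>)"
    unfolding leaf_open_def
  proof (intro conjI ballI)
    show "\<Union>\<K> \<subseteq> topspace T" using * by (auto simp: leaf_open_def)
    fix x assume "x \<in> \<Union>\<K>"
    then obtain K where K: "K \<in> \<K>" "leaf_open K" "x \<in> K" using * by blast
    obtain F Q U where "prim F Q" "x \<in> Q" "openin T U" "x \<in> U" "{y\<in>U \<inter> Q. F y = F x} \<subseteq> K"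
      by (rule leaf_openE[OF K(2,3)])
    with K(1) show "\<exists>F Q U. prim F Q \<and> x \<in> Q \<and> openin T U \<and> x \<in> U \<and> {y\<in>U \<inter> Q. F y = F x} \<subseteq> \<Union>\<K>"
      by (intro exI[of _ F] exI[of _ Q] exI[of _ U]) auto
  qed
qed

text \<open>Neighbourhoods in the leaf topology can be tested with any given local primitive, because two
  primitives differ by a local constant.\<close>

lemma leaf_nhd:
  assumes S: "openin leaf_top S" "x \<in> S" and F: "prim F Q" "x \<in> Q"
  obtains U where "openin T U" "x \<in> U" "U \<subseteq> Q" "{y\<in>U. F y = F x} \<subseteq> S"
proof -
  obtain F' Q' U' where *: "prim F' Q'" "x \<in> Q'" "openin T U'" "x \<in> U'" "{y\<in>U' \<inter> Q'. F' y = F' x} \<subseteq> S"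
    by (rule leaf_openE[OF S[unfolded openin_leaf_top]])
  obtain N where N: "open N" "x \<in> N" "N \<subseteq> Q \<inter> Q'" "\<forall>q\<in>N. F q - F' q = F x - F' x"
    by (rule prim_unique[OF F(1) *(1) F(2) *(2)])
  have "{y\<in>U' \<inter> N. F y = F x} \<subseteq> S" using N(3,4) *(5) by fastforce
  then show ?thesis
    using that[of "U' \<inter> N"] openin_T_ambient[OF *(3) N(1)] * N by auto
qed

lemma openin_plaque:
  assumes "prim F Q" "openin T U"
  shows "openin leaf_top {y\<in>U \<inter> Q. F y = k}"
  unfolding openin_leaf_top leaf_open_def using assms openin_subset by fastforce

lemma openin_leaf_top_T:
  assumes "openin T U"
  shows "openin leaf_top U"
  unfolding openin_leaf_top leaf_open_def
proof (intro conjI ballI)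
  show "U \<subseteq> topspace T" using openin_subset[OF assms] .
  fix x assume "x \<in> U"
  then have "x \<in> W" using openin_subset[OF assms] TW by blast
  then obtain F Q where "prim F Q" "x \<in> Q" by (rule prim_exists)
  then show "\<exists>F Q U'. prim F Q \<and> x \<in> Q \<and> openin T U' \<and> x \<in> U' \<and> {y\<in>U' \<inter> Q. F y = F x} \<subseteq> U"
    using assms \<open>x \<in> U\<close> by blast
qed

lemma topspace_leaf_top [simp]: "topspace leaf_top = topspace T"
proof
  show "topspace leaf_top \<subseteq> topspace T"
    using openin_topspace[of leaf_top] unfolding openin_leaf_top leaf_open_def by blast
  show "topspace T \<subseteq> topspace leaf_top"
    using openin_subset[OF openin_leaf_top_T[OF openin_topspace]] .
qed

lemma leaf_top_continuous_map: "continuous_map leaf_top T id"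
  unfolding continuous_map_def using openin_leaf_top_T openin_subset
  by (auto simp: Collect_conj_eq Int_absorb1 intro: openin_subopen[THEN iffD2])

text \<open>Inside a level set of the coordinate along \<open>e\<close>, the leaf topology is the ambient one.\<close>

lemma plaque_subtopology:
  assumes a: "adapted p c U V \<rho> e" and P: "P \<subseteq> {q\<in>U. snd c q \<bullet> e = k}"
  shows "subtopology leaf_top P = top_of_set P"
proof -
  note aD = adaptedD[OF a]
  have PU: "P \<subseteq> U" using P by auto
  have "subtopology T P = top_of_set P"
    using aD(14) PU by (metis inf.absorb_iff2 subtopology_subtopology)
  moreover have "openin (subtopology leaf_top P) X = openin (subtopology T P) X" for X
  proof
    assume "openin (subtopology leaf_top P) X"
    then obtain S where S: "openin leaf_top S" "X = S \<inter> P" by (auto simp: openin_subtopology)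
    show "openin (subtopology T P) X"
    proof (subst openin_subopen, intro ballI)
      fix x assume x: "x \<in> X"
      then have xc: "x \<in> fst c" and xS: "x \<in> S" using S PU aD(12) by auto
      obtain U' where U': "openin T U'" "x \<in> U'" "U' \<subseteq> fst c" "{y\<in>U'. snd c y \<bullet> e = snd c x \<bullet> e} \<subseteq> S"
        by (rule leaf_nhd[OF S(1) xS aD(9) xc])
      have "U' \<inter> P \<subseteq> X" using U'(4) S(2) x P by auto
      then show "\<exists>Y. openin (subtopology T P) Y \<and> x \<in> Y \<and> Y \<subseteq> X"
        using U' x S(2) by (intro exI[of _ "U' \<inter> P"]) (auto simp: openin_subtopology)
    qed
  next
    assume "openin (subtopology T P) X"
    then show "openin (subtopology leaf_top P) X"
      using openin_leaf_top_T by (auto simp: openin_subtopology)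
  qed
  ultimately show ?thesis by (metis topology_eq)
qed

lemma plaque_openin:
  assumes a: "adapted p c U V \<rho> e"
  shows "openin leaf_top {q\<in>U. snd c q \<bullet> e = k}"
proof -
  note aD = adaptedD[OF a]
  have "{q\<in>U. snd c q \<bullet> e = k} = {y\<in>U \<inter> fst c. snd c y \<bullet> e = k}" using aD(12) by auto
  then show ?thesis using openin_plaque[OF aD(9,13)] by simp
qed

lemma plaque_connected:
  assumes a: "adapted p c U V \<rho> e"
  shows "connectedin leaf_top {q\<in>U. snd c q \<bullet> e = 0}"
proof -
  note aD = adaptedD[OF a]
  let ?P = "{q\<in>U. snd c q \<bullet> e = 0}" and ?C = "ball 0 \<rho> \<inter> V \<inter> {x. x \<bullet> e = 0}"
  have "convex {x. x \<bullet> e = 0}" using convex_hyperplane[of e 0] by (simp add: inner_commute)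
  then have "connected ?C"
    by (intro convex_connected convex_Int convex_ball subspace_imp_convex[OF aD(11)])
  moreover have sub: "?C \<subseteq> snd c ` fst c" using aD(6) by auto
  ultimately have "connected (chart_inv c ` ?C)"
    by (intro connected_continuous_image continuous_on_subset[OF chartD(4)[OF aD(10)]])
  moreover have "chart_inv c ` ?C = ?P"
  proof (intro equalityI subsetI)
    fix q assume "q \<in> chart_inv c ` ?C"
    then obtain x where x: "q = chart_inv c x" "x \<in> V" "x \<in> snd c ` fst c" "x \<bullet> e = 0" using sub by auto
    then show "q \<in> ?P"
      using slice_inv[OF aD(1) x(3,2)] chartD(6)[OF aD(10) x(3)] by simp
  next
    fix q assume q: "q \<in> ?P"
    then have "q = chart_inv c (snd c q)" "snd c q \<in> ball 0 \<rho> \<inter> V"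
      using chartD(5)[OF aD(10)] aD(12,15) by auto
    then show "q \<in> chart_inv c ` ?C" using q by auto
  qed
  ultimately have "connected ?P" by simp
  then have "connectedin (subtopology leaf_top ?P) ?P"
    using plaque_subtopology[OF a order_refl, of 0] by (simp add: connectedin_subtopology)
  then show ?thesis by (simp add: connectedin_subtopology)
qed

text \<open>The point set of the leaf through \<open>p\<close>.\<close>

abbreviation leaf_set :: "'a \<Rightarrow> 'a set" where
  "leaf_set p \<equiv> connected_component_of_set leaf_top p"

lemma leaf_set_eq: "q \<in> leaf_set p \<Longrightarrow> leaf_set q = leaf_set p"
  by (metis connected_component_of_eq mem_Collect_eq connected_component_of_equiv)

lemma plaque_subset_leaf:
  assumes a: "adapted q c U V \<rho> e" and q: "q \<in> leaf_set p"
  shows "{x\<in>U. snd c x \<bullet> e = 0} \<subseteq> leaf_set p"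
proof -
  note aD = adaptedD[OF a]
  have "{x\<in>U. snd c x \<bullet> e = 0} \<subseteq> leaf_set q"
    by (rule connected_component_of_maximal[OF plaque_connected[OF a]]) (use aD(3,4) in auto)
  then show ?thesis using leaf_set_eq[OF q] by simp
qed

lemma leaf_set_subset: "leaf_set p \<subseteq> topspace T"
  using connected_component_of_subset_topspace[of leaf_top p] by simp

text \<open>An adapted chart is a slice chart for the leaf through its centre. No translation is needed,
  since the centre has coordinate \<open>0\<close>.\<close>

lemma leaf_slice:
  assumes a: "adapted q c U V \<rho> e" and q: "q \<in> leaf_set p"
  shows "slice (subtopology leaf_top (leaf_set p)) c {x\<in>U. snd c x \<bullet> e = 0} (V \<inter> {x. x \<bullet> e = 0})"
    and "dim (V \<inter> {x. x \<bullet> e = 0}) = DIM('e) - 2"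
proof -
  note aD = adaptedD[OF a]
  let ?P = "{x\<in>U. snd c x \<bullet> e = 0}" and ?N = "subtopology leaf_top (leaf_set p)" and ?V = "V \<inter> {x. x \<bullet> e = 0}"
  have sub: "?P \<subseteq> leaf_set p" by (rule plaque_subset_leaf[OF a q])
  have ssV: "subspace ?V"
    using aD(11) subspace_hyperplane[of e] by (intro subspace_inter) (auto simp: inner_commute)
  show "slice ?N c ?P ?V"
    unfolding slice_def
  proof (intro conjI)
    show "openin ?N ?P"
      using openin_subtopology_Int[OF plaque_openin[OF a, of 0], of "leaf_set p"] sub by (simp only: Int_absorb2)
    show "subtopology ?N ?P = top_of_set ?P"
      using plaque_subtopology[OF a order_refl, of 0] sub by (simp add: subtopology_subtopology inf.absorb2)
    show "snd c ` ?P = snd c ` fst c \<inter> ?V"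
      using aD(6,15) by (auto simp: image_iff set_eq_iff) metis+
  qed (use aD ssV in auto)
  have ee: "e \<bullet> e = 1" using aD(8) by (simp add: dot_square_norm)
  have "span (insert e ?V) = V"
  proof
    show "span (insert e ?V) \<subseteq> V" by (rule span_minimal) (use aD in auto)
    show "V \<subseteq> span (insert e ?V)"
    proof
      fix x assume "x \<in> V"
      then have "x - (x \<bullet> e) *\<^sub>R e \<in> ?V"
        using aD(7,11) ee by (auto simp: subspace_diff subspace_scale inner_diff_left)
      then show "x \<in> span (insert e ?V)"
        unfolding span_breakdown_eq by (intro exI[of _ "x \<bullet> e"] span_base)
    qed
  qed
  then have "dim V = dim (insert e ?V)" by (metis dim_span)
  also have "\<dots> = dim ?V + 1"
    using ee ssV by (simp add: dim_insert span_eq_iff[THEN iffD2])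
  finally show "dim ?V = DIM('e) - 2" using aD(2) by simp
qed

lemma integral_leaf:
  assumes "p \<in> topspace T"
  shows "integral_manifold A T (screen_distribution A g T \<zeta>) (subtopology leaf_top (leaf_set p))" (is "integral_manifold A T ?D ?N")
proof -
  have top: "topspace ?N = leaf_set p" using leaf_set_subset by auto
  have pL: "p \<in> leaf_set p"
    using assms by (simp add: connected_component_of_refl)
  have ex: "\<exists>c U V \<rho> e. adapted q c U V \<rho> e" if "q \<in> leaf_set p" for q
    using adapted_exists[OF subsetD[OF leaf_set_subset that]] by metis
  have sub: "submanifold A (DIM('e) - 2) ?N"
    unfolding submanifold_def top
  proof
    fix q assume q: "q \<in> leaf_set p"
    then obtain c U V \<rho> e where a: "adapted q c U V \<rho> e" using ex by blast
    show "\<exists>U c V. openin ?N U \<and> q \<in> U \<and> subtopology ?N U = top_of_set U \<and> c \<in> max_atlas A \<and> U \<subseteq> fst c \<and>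
        subspace V \<and> dim V = DIM('e) - 2 \<and> snd c ` U = snd c ` fst c \<inter> V"
      using leaf_slice[OF a q] adaptedD(3,4)[OF a] unfolding slice_def
      by (intro exI[of _ "{x\<in>U. snd c x \<bullet> e = 0}"] exI[of _ c] exI[of _ "V \<inter> {x. x \<bullet> e = 0}"]) auto
  qed
  have tan: "sub_tangent_space A ?N q = ?D q" if q: "q \<in> leaf_set p" for q
  proof -
    obtain c U V \<rho> e where a: "adapted q c U V \<rho> e" using ex[OF q] by blast
    note aD = adaptedD[OF a]
    have "sub_tangent_space A ?N q = coord_vec A c q ` (V \<inter> {x. x \<bullet> e = 0})"
      by (rule slice_tangent_space[OF sub leaf_slice(1)[OF a q]]) (use aD in auto)
    moreover have "sub_tangent_space A T q = coord_vec A c q ` V"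
      by (rule slice_tangent_space[OF submfd aD(1,3)])
    moreover have "g q (\<zeta> q) (coord_vec A c q u) = u \<bullet> e" for u
      using adapted_form[OF a, of q u] aD(3,12) by (auto simp: \<omega>c_def rigging_form_def)
    ultimately show ?thesis
      unfolding screen_distribution_def by auto
  qed
  have "connected_space ?N"
    using connectedin_connected_component_of[of leaf_top p] by (simp add: connectedin_def)
  moreover have "continuous_map ?N T id"
    using leaf_top_continuous_map continuous_map_from_subtopology by blast
  ultimately show ?thesis
    unfolding integral_manifold_def top using sub tan pL leaf_set_subset by blast
qed

text \<open>Local primitives are constant along straight lines in a slice chart of an integral manifold
  \<open>N\<close>. So \<open>N\<close> maps continuously into the leaf topology and, being connected, into a single leaf: this is
  the maximality of the leaves.\<close>

lemma integral_manifold_leaf_continuous: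
  assumes "integral_manifold A T (screen_distribution A g T \<zeta>) N"
  shows "continuous_map N leaf_top id"
proof -
  obtain k where k: "submanifold A k N" and NT: "topspace N \<subseteq> topspace T" and cont: "continuous_map N T id"
    and tan: "\<And>q. q \<in> topspace N \<Longrightarrow> sub_tangent_space A N q = screen_distribution A g T \<zeta> q"
    using assms unfolding integral_manifold_def by blast
  have "openin N {x \<in> topspace N. id x \<in> S}" if S: "openin leaf_top S" for S
  proof (subst openin_subopen, intro ballI)
    fix x assume "x \<in> {x \<in> topspace N. id x \<in> S}"
    then have x: "x \<in> topspace N" "x \<in> S" by auto
    then have "x \<in> W" using NT TW by blast
    then obtain F Q where F: "prim F Q" "x \<in> Q" by (rule prim_exists)
    obtain U where U: "openin T U" "x \<in> U" "U \<subseteq> Q" "{y\<in>U. F y = F x} \<subseteq> S"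
      by (rule leaf_nhd[OF S x(2) F])
    have opN: "openin N {y \<in> topspace N. id y \<in> U}"
      by (rule openin_continuous_map_preimage[OF cont U(1)])
    obtain c U1 V where s: "slice N c U1 V" "x \<in> U1"
      using submanifold_slice[OF k x(1)] by metis
    have c: "c \<in> max_atlas A" "U1 \<subseteq> fst c" "subspace V" "openin N U1" using s(1) unfolding slice_def by auto
    obtain r where r: "r > 0" "ball (snd c x) r \<subseteq> snd c ` fst c"
      "{q\<in>U1. dist (snd c q) (snd c x) < r} \<subseteq> {y \<in> topspace N. id y \<in> U}"
      by (rule slice_nhd[OF s(1) opN]) (use x U s in auto)
    let ?B = "ball (snd c x) r"
    let ?R = "{q\<in>U1. dist (snd c q) (snd c x) < r}"
    have "?R = U1 \<inter> (fst c \<inter> snd c -` ?B)" using c(2) by (auto simp: dist_commute)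
    then have opR: "openin N ?R"
      using slice_openin[OF s(1) chart_open_vimage[OF max_chart[OF c(1)] open_ball]] by simp
    have "y \<in> S" if y: "y \<in> ?R" for y
    proof -
      define \<eta> where "\<eta> = (\<lambda>t::real. snd c x + t *\<^sub>R (snd c y - snd c x))"
      have V: "snd c x \<in> V" "snd c y - snd c x \<in> V"
        using y s(2) c slice_mem[OF s(1)] by (auto intro: subspace_diff)
      note l = slice_affine[OF s(1) V open_ball r(2), folded \<eta>_def]
      let ?J = "\<eta> -` ?B"
      let ?\<gamma> = "chart_inv c \<circ> \<eta>"
      have J: "{0..1} \<subseteq> ?J"
      proof
        fix t :: real assume t: "t \<in> {0..1}"
        have "dist (snd c x) (\<eta> t) = t * dist (snd c y) (snd c x)"
          using t by (simp add: \<eta>_def dist_norm)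
        also have "\<dots> \<le> dist (snd c y) (snd c x)" using t by (simp add: mult_left_le_one_le)
        finally show "t \<in> ?J" using y by simp
      qed
      note amb = smooth_curve_ambient[OF k l(1,2)]
      have "((F \<circ> ?\<gamma>) has_real_derivative 0) (at t)" if t: "t \<in> {0..1}" for t
      proof -
        have tJ: "t \<in> ?J" using t J by blast
        have "?\<gamma> t \<in> ?R" using l(3,4)[OF tJ] tJ by (simp add: dist_commute \<eta>_def)
        then have g: "?\<gamma> t \<in> topspace N" "?\<gamma> t \<in> Q" using r(3) U(3) by auto
        have "velocity A ?\<gamma> t \<in> sub_tangent_space A N (?\<gamma> t)"
          by (rule smooth_curve_velocity_tangent[OF k l(1,2) tJ])
        then have "\<omega> (?\<gamma> t) (velocity A ?\<gamma> t) = 0"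
          unfolding tan[OF g(1)] by (simp add: screen_distribution_def rigging_form_def)
        then show ?thesis using prim_curve[OF F(1) amb(1) tJ g(2)] by metis
      qed
      from has_field_derivative_zero_constant[OF convex_real_interval(5) has_field_derivative_at_within[OF this]]
      obtain k where "\<And>t. t \<in> {0..1} \<Longrightarrow> (F \<circ> ?\<gamma>) t = k" by metis
      then have "(F \<circ> ?\<gamma>) 0 = (F \<circ> ?\<gamma>) 1" by simp
      then have "F x = F y"
        using chartD(5)[OF c(1) subsetD[OF c(2)], of x] chartD(5)[OF c(1) subsetD[OF c(2)], of y] y s(2)
        by (simp add: \<eta>_def)
      then show ?thesis using U(4) r(3) y by auto
    qed
    then show "\<exists>R. openin N R \<and> x \<in> R \<and> R \<subseteq> {x \<in> topspace N. id x \<in> S}"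
      using opR r(1,3) s(2) by (intro exI[of _ ?R]) auto
  qed
  then show ?thesis using NT by (auto simp: continuous_map_def)
qed

lemma leaf_through:
  assumes "p \<in> topspace T"
  shows "leaf A T (screen_distribution A g T \<zeta>) (subtopology leaf_top (leaf_set p))"
  unfolding leaf_def
proof (intro conjI allI impI integral_leaf[OF assms])
  have top: "topspace (subtopology leaf_top (leaf_set p)) = leaf_set p" using leaf_set_subset by auto
  fix N assume N: "integral_manifold A T (screen_distribution A g T \<zeta>) N \<and>
    topspace (subtopology leaf_top (leaf_set p)) \<subseteq> topspace N"
  then have "connectedin N (topspace N)"
    by (simp add: integral_manifold_def connectedin_topspace)
  from connectedin_continuous_map_image[OF integral_manifold_leaf_continuous this]
  have "connectedin leaf_top (topspace N)" using N by simp
  moreover have "p \<in> topspace N"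
    using N top assms by (auto simp: connected_component_of_refl)
  ultimately have "topspace N \<subseteq> leaf_set p"
    by (rule connected_component_of_maximal)
  then show "topspace N = topspace (subtopology leaf_top (leaf_set p))"
    using N top by auto
qed

end


section \<open>Estimates in adapted charts\<close>

lemma smooth_on_ball_lipschitz:
  fixes f :: "'e::euclidean_space \<Rightarrow> real"
  assumes f: "smooth_on (ball 0 \<rho>) f" and r: "r < \<rho>"
  obtains L where "L \<ge> 0" "\<And>x z. x \<in> cball 0 r \<Longrightarrow> z \<in> cball 0 r \<Longrightarrow> \<bar>f x - f z\<bar> \<le> L * norm (x - z)"
proof -
  let ?D = "\<lambda>x. frechet_derivative f (at x)"
  let ?s = "\<lambda>x. \<Sum>b\<in>Basis. \<bar>?D x b\<bar>"
  have sub: "cball 0 r \<subseteq> ball (0::'e) \<rho>" using r by auto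
  have "continuous_on (cball 0 r) ?s"
    by (intro continuous_intros continuous_on_subset[OF smooth_on_continuous[OF smooth_on_frechet[OF f]] sub])
  then have "bounded (?s ` cball 0 r)"
    by (intro compact_imp_bounded compact_continuous_image compact_cball)
  then obtain L where L: "\<And>x. x \<in> cball 0 r \<Longrightarrow> \<bar>?s x\<bar> \<le> L" "L > 0"
    unfolding bounded_pos by (metis image_eqI real_norm_def)
  have D: "(f has_derivative ?D x) (at x)" if "x \<in> cball 0 r" for x
    by (rule smooth_on_has_derivative[OF f]) (use that sub in blast)
  have "norm (f x - f z) \<le> L * norm (x - z)" if xz: "x \<in> cball 0 r" "z \<in> cball 0 r" for x z
  proof (rule differentiable_bound[OF convex_cball has_derivative_at_withinI[OF D] _ xz])
    fix y :: 'e assume y: "y \<in> cball 0 r"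
    show "onorm (?D y) \<le> L"
    proof (rule onorm_le)
      fix v
      have "linear (?D y)" using D[OF y] has_derivative_linear by blast
      then have "\<bar>?D y v\<bar> \<le> (\<Sum>b\<in>Basis. \<bar>(v \<bullet> b) * ?D y b\<bar>)"
        by (subst linear_expand_Basis[of "?D y" v]) (auto intro: sum_abs)
      also have "\<dots> \<le> (\<Sum>b\<in>Basis. norm v * \<bar>?D y b\<bar>)"
        by (intro sum_mono) (simp add: abs_mult mult_right_mono Basis_le_norm)
      also have "\<dots> = norm v * ?s y" by (simp add: sum_distrib_left)
      also have "\<dots> \<le> norm v * L" using L(1)[OF y] by (intro mult_left_mono) auto
      finally show "norm (?D y v) \<le> L * norm v" by (simp add: mult.commute)
    qed
  qed
  then show ?thesis using that[of L] L(2) by auto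
qed

text \<open>The function \<open>exp (- L s) * f s\<close> is nonincreasing.\<close>

lemma gronwall_forward:
  fixes f :: "real \<Rightarrow> real"
  assumes "\<And>s. 0 \<le> s \<Longrightarrow> s \<le> b \<Longrightarrow> (f has_real_derivative f' s) (at s)"
    and "\<And>s. 0 \<le> s \<Longrightarrow> s \<le> b \<Longrightarrow> f' s \<le> L * f s" and "0 \<le> b"
  shows "f b \<le> exp (L * b) * f 0"
proof -
  have "exp (- L * b) * f b \<le> exp (- L * 0) * f 0"
  proof (rule DERIV_nonpos_imp_nonincreasing[OF assms(3)])
    fix s assume s: "0 \<le> s" "s \<le> b"
    have "((\<lambda>s. exp (- L * s) * f s) has_real_derivative (exp (- L * s) * (f' s - L * f s))) (at s)"
      by (auto intro!: derivative_eq_intros assms(1)[OF s] simp: algebra_simps)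
    moreover have "exp (- L * s) * (f' s - L * f s) \<le> 0"
      using assms(2)[OF s] by (simp add: mult_le_0_iff)
    ultimately show "\<exists>y. ((\<lambda>s. exp (- L * s) * f s) has_real_derivative y) (at s) \<and> y \<le> 0" by blast
  qed
  then have "exp (L * b) * (exp (- L * b) * f b) \<le> exp (L * b) * f 0" by simp
  then show ?thesis by (simp add: mult.assoc[symmetric] exp_add[symmetric])
qed

lemma gronwall:
  fixes f :: "real \<Rightarrow> real"
  assumes d: "\<And>s. \<bar>s\<bar> \<le> b \<Longrightarrow> (f has_real_derivative f' s) (at s)"
    and L: "\<And>s. \<bar>s\<bar> \<le> b \<Longrightarrow> \<bar>f' s\<bar> \<le> L * f s" and s: "\<bar>s\<bar> \<le> b"
  shows "f s \<le> exp (L * \<bar>s\<bar>) * f 0"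
proof (cases "s \<ge> 0")
  case True
  then show ?thesis
    using gronwall_forward[of s f f' L] d L s by (auto simp: abs_le_iff)
next
  case False
  have "((\<lambda>t. f (- t)) has_real_derivative - f' (- t)) (at t)" if "\<bar>t\<bar> \<le> b" for t
    using DERIV_mirror[of f "f' (- t)" "t"] d[of "- t"] that by simp
  then have "(\<lambda>t. f (- t)) (- s) \<le> exp (L * (- s)) * (\<lambda>t. f (- t)) 0"
    using False s L[of "- t" for t]
    by (intro gronwall_forward[where f' = "\<lambda>t. - f' (- t)"]) (auto simp: abs_le_iff)
  then show ?thesis using False by simp
qed

context null_normalization
begin

lemma adapted_inW:
  assumes a: "adapted p c U V \<rho> e" and "q \<in> fst c"
  shows "q \<in> W"
  using primD(2)[OF adaptedD(9)[OF a]] assms(2) by blast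

lemma adapted_smooth:
  assumes a: "adapted p c U V \<rho> e"
  shows "smooth_on (ball 0 \<rho>) (\<lambda>x. hc c (chart_inv c x) u v)"
    and "x \<in> ball 0 \<rho> \<Longrightarrow> bilinear (hc c (chart_inv c x))"
proof -
  note aD = adaptedD[OF a]
  have "fst c \<inter> W = fst c" using adapted_inW[OF a] by blast
  then show "smooth_on (ball 0 \<rho>) (\<lambda>x. hc c (chart_inv c x) u v)"
    using hc_smooth[OF aD(10), of u v] aD(6) by simp
  assume "x \<in> ball 0 \<rho>"
  then have "chart_inv c x \<in> fst c" using chartD(7)[OF aD(10)] aD(6) by simp
  then show "bilinear (hc c (chart_inv c x))"
    using hc_bilinear[OF aD(10)] adapted_inW[OF a] by blast
qed

lemma adapted_bounds:
  assumes a: "adapted p c U V \<rho> e" and r: "0 \<le> r" "r < \<rho>"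
  obtains m C where "m > 0" "C > 0"
    "\<And>q u. q \<in> U \<Longrightarrow> norm (snd c q) \<le> r \<Longrightarrow> u \<in> V \<Longrightarrow> m * (norm u)\<^sup>2 \<le> hc c q u u \<and> hc c q u u \<le> C * (norm u)\<^sup>2"
proof -
  note aD = adaptedD[OF a]
  let ?K = "(cball 0 r \<inter> V) \<times> (sphere 0 1 \<inter> V)"
  let ?f = "\<lambda>p. hc c (chart_inv c (fst p)) (snd p) (snd p)"
  have sub: "fst ` ?K \<subseteq> ball 0 \<rho>" using r by auto
  have bil: "bilinear (hc c (chart_inv c (fst p)))" if "p \<in> ?K" for p
    using adapted_smooth(2)[OF a] sub that by blast
  have base: "continuous_on ?K (\<lambda>p. hc c (chart_inv c (fst p)) u v)" for u v
    by (rule continuous_on_compose2[OF smooth_on_continuous[OF adapted_smooth(1)[OF a]]])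
      (use sub in \<open>auto intro!: continuous_intros\<close>)
  have s1: "continuous_on ?K (\<lambda>p. hc c (chart_inv c (fst p)) u (snd p))" for u
    by (rule continuous_on_linear_family[where L = "\<lambda>p. hc c (chart_inv c (fst p)) u", OF _ base])
      (use bil in \<open>auto simp: bilinear_def intro!: continuous_intros\<close>)
  have cont: "continuous_on ?K ?f"
    by (rule continuous_on_linear_family[where L = "\<lambda>p u. hc c (chart_inv c (fst p)) u (snd p)", OF _ s1])
      (use bil in \<open>auto simp: bilinear_def intro!: continuous_intros\<close>)
  have cK: "compact ?K"
    by (intro compact_Times compact_Int_closed closed_subspace aD compact_cball compact_sphere)
  have ne: "?K \<noteq> {}"
  proof -
    have "(0, e) \<in> ?K" using r aD subspace_0 by auto
    then show ?thesis by blast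
  qed
  obtain x1 where x1: "x1 \<in> ?K" "\<And>y. y \<in> ?K \<Longrightarrow> ?f x1 \<le> ?f y"
    using continuous_attains_inf[OF cK ne cont] by blast
  obtain x2 where x2: "x2 \<in> ?K" "\<And>y. y \<in> ?K \<Longrightarrow> ?f y \<le> ?f x2"
    using continuous_attains_sup[OF cK ne cont] by blast
  have pos: "?f x > 0" if x: "x \<in> ?K" for x
  proof -
    have "fst x \<in> snd c ` fst c" "fst x \<in> V" using x r aD(6) by (cases x; auto)+
    then have "chart_inv c (fst x) \<in> U" by (rule slice_inv[OF aD(1)])
    then show ?thesis
      using null_slice[OF aD(1) _ aD(2), of "chart_inv c (fst x)"] x by (metis mem_Times_iff IntE mem_sphere_0 norm_zero zero_neq_one)
  qed
  have *: "?f x1 * (norm u)\<^sup>2 \<le> hc c q u u \<and> hc c q u u \<le> ?f x2 * (norm u)\<^sup>2"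
    if q: "q \<in> U" "norm (snd c q) \<le> r" and u: "u \<in> V" for q u
  proof (cases "u = 0")
    case True
    have "bilinear (hc c q)" using hc_bilinear[OF aD(10)] q aD(12) adapted_inW[OF a] by blast
    then show ?thesis using True by (simp add: bilinear_lzero)
  next
    case False
    have qc: "q \<in> fst c" using q aD(12) by blast
    have bq: "bilinear (hc c q)" using hc_bilinear[OF aD(10)] qc adapted_inW[OF a] by blast
    let ?u = "inverse (norm u) *\<^sub>R u"
    have "snd c q \<in> V" using aD(15) q by blast
    then have K: "(snd c q, ?u) \<in> ?K" using q u False aD(11) by (auto simp: subspace_scale)
    have "hc c q ?u ?u = inverse (norm u) * (inverse (norm u) * hc c q u u)"
      using bilinear_lmul[OF bq] bilinear_rmul[OF bq] by simp
    then have "hc c q u u = (norm u)\<^sup>2 * hc c q ?u ?u"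
      using False by (simp add: power2_eq_square field_simps)
    moreover have "?f (snd c q, ?u) = hc c q ?u ?u"
      using chartD(5)[OF aD(10) qc] by simp
    ultimately show ?thesis
      using x1(2)[OF K] x2(2)[OF K] False by (simp add: mult.commute)
  qed
  show ?thesis
    by (rule that[of "?f x1" "?f x2"]) (use pos x1(1) x2(1) * in auto)
qed

lemma adapted_lipschitz:
  assumes a: "adapted p c U V \<rho> e" and r: "r < \<rho>"
  obtains \<Lambda> where "\<Lambda> \<ge> 0" "\<And>x z u v. x \<in> cball 0 r \<Longrightarrow> z \<in> cball 0 r \<Longrightarrow>
    \<bar>hc c (chart_inv c x) u v - hc c (chart_inv c z) u v\<bar> \<le> \<Lambda> * norm (x - z) * norm u * norm v"
proof -
  let ?H = "\<lambda>x. hc c (chart_inv c x)"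
  have "\<exists>L. L \<ge> 0 \<and> (\<forall>x\<in>cball 0 r. \<forall>z\<in>cball 0 r. \<bar>?H x b b' - ?H z b b'\<bar> \<le> L * norm (x - z))" for b b'
    using smooth_on_ball_lipschitz[OF adapted_smooth(1)[OF a] r] by metis
  then obtain L where L: "\<And>b b'. L b b' \<ge> 0"
    "\<And>b b' x z. x \<in> cball 0 r \<Longrightarrow> z \<in> cball 0 r \<Longrightarrow> \<bar>?H x b b' - ?H z b b'\<bar> \<le> L b b' * norm (x - z)"
    by metis
  define \<Lambda> where "\<Lambda> = (\<Sum>b\<in>Basis. \<Sum>b'\<in>Basis. L b b')"
  have ex: "?H x u v = (\<Sum>b\<in>Basis. \<Sum>b'\<in>Basis. (u \<bullet> b) * (v \<bullet> b') * ?H x b b')" if "x \<in> cball 0 r" for x u v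
  proof -
    have bil: "bilinear (?H x)" using adapted_smooth(2)[OF a] that r by auto
    have "?H x u v = (\<Sum>b\<in>Basis. (u \<bullet> b) * ?H x b v)"
      using linear_expand_Basis[of "\<lambda>u. ?H x u v" u] bil by (simp add: bilinear_def)
    also have "\<dots> = (\<Sum>b\<in>Basis. (u \<bullet> b) * (\<Sum>b'\<in>Basis. (v \<bullet> b') * ?H x b b'))"
      using linear_expand_Basis[of "?H x b" v for b] bil by (simp add: bilinear_def)
    finally show ?thesis by (simp add: sum_distrib_left mult.assoc)
  qed
  show ?thesis
  proof
    show "\<Lambda> \<ge> 0" unfolding \<Lambda>_def by (intro sum_nonneg L)
    fix x z :: 'e and u v
    assume x: "x \<in> cball 0 r" and z: "z \<in> cball 0 r"
    have "\<bar>?H x u v - ?H z u v\<bar> = \<bar>\<Sum>b\<in>Basis. \<Sum>b'\<in>Basis. (u \<bullet> b) * (v \<bullet> b') * (?H x b b' - ?H z b b')\<bar>"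
      by (simp add: ex[OF x, of u v] ex[OF z, of u v] sum_subtractf[symmetric] right_diff_distrib)
    also have "\<dots> \<le> (\<Sum>b\<in>Basis. \<Sum>b'\<in>Basis. \<bar>(u \<bullet> b) * (v \<bullet> b') * (?H x b b' - ?H z b b')\<bar>)"
      by (rule order_trans[OF sum_abs]) (intro sum_mono sum_abs)
    also have "\<dots> \<le> (\<Sum>b\<in>Basis. \<Sum>b'\<in>Basis. norm u * norm v * (L b b' * norm (x - z)))"
      unfolding abs_mult by (intro sum_mono mult_mono L(2)[OF x z] Basis_le_norm) auto
    also have "\<dots> = \<Lambda> * norm (x - z) * norm u * norm v"
      by (simp add: \<Lambda>_def sum_distrib_left sum_distrib_right mult_ac)
    finally show "\<bar>?H x u v - ?H z u v\<bar> \<le> \<Lambda> * norm (x - z) * norm u * norm v" .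
  qed
qed

text \<open>The rigged vector field in an adapted chart; it is Lipschitz because it solves a linear system
  whose coefficients are Lipschitz and uniformly positive definite.\<close>

definition \<xi>c :: "('a, 'e) chart \<Rightarrow> 'a \<Rightarrow> 'e" where
  "\<xi>c c q = (THE n. \<xi> q = coord_vec A c q n)"

lemma adapted_xi:
  assumes a: "adapted p c U V \<rho> e" and q: "q \<in> U"
  shows "\<xi> q = coord_vec A c q (\<xi>c c q)" "\<xi>c c q \<in> V" "\<xi>c c q \<bullet> e = 1"
    "\<And>w. w \<in> V \<Longrightarrow> hc c q (\<xi>c c q) w = w \<bullet> e"
proof -
  note aD = adaptedD[OF a]
  have qc: "q \<in> fst c" using q aD(12) by blast
  obtain n where n: "n \<in> V" "\<xi> q = coord_vec A c q n" "\<omega>c c q n = 1" "\<And>w. w \<in> V \<Longrightarrow> hc c q n w = \<omega>c c q w"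
    using rigged_field_slice[OF aD(1) q aD(2)] by metis
  have "\<xi>c c q = n"
    unfolding \<xi>c_def n(2) using coord_vec_eq_iff[OF aD(10) qc] by (intro the_equality) auto
  then show "\<xi> q = coord_vec A c q (\<xi>c c q)" "\<xi>c c q \<in> V" "\<xi>c c q \<bullet> e = 1"
    "\<And>w. w \<in> V \<Longrightarrow> hc c q (\<xi>c c q) w = w \<bullet> e"
    using n adapted_form[OF a qc] by auto
qed

lemma xi_lipschitz:
  assumes a: "adapted p c U V \<rho> e" and r: "0 \<le> r" "r < \<rho>"
  obtains K where "K \<ge> 0" "\<And>q q'. q \<in> U \<Longrightarrow> norm (snd c q) \<le> r \<Longrightarrow> q' \<in> U \<Longrightarrow> norm (snd c q') \<le> r \<Longrightarrow>
    norm (\<xi>c c q - \<xi>c c q') \<le> K * norm (snd c q - snd c q')"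
proof -
  note aD = adaptedD[OF a]
  obtain m C where mC: "m > 0" "C > 0"
    "\<And>q u. q \<in> U \<Longrightarrow> norm (snd c q) \<le> r \<Longrightarrow> u \<in> V \<Longrightarrow> m * (norm u)\<^sup>2 \<le> hc c q u u \<and> hc c q u u \<le> C * (norm u)\<^sup>2"
    using adapted_bounds[OF a r] by metis
  obtain \<Lambda> where \<Lambda>: "\<Lambda> \<ge> 0" "\<And>x z u v. x \<in> cball 0 r \<Longrightarrow> z \<in> cball 0 r \<Longrightarrow>
    \<bar>hc c (chart_inv c x) u v - hc c (chart_inv c z) u v\<bar> \<le> \<Lambda> * norm (x - z) * norm u * norm v"
    using adapted_lipschitz[OF a r(2)] by metis
  have "norm (\<xi>c c q - \<xi>c c q') \<le> \<Lambda> / m\<^sup>2 * norm (snd c q - snd c q')"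
    if q: "q \<in> U" "norm (snd c q) \<le> r" and q': "q' \<in> U" "norm (snd c q') \<le> r" for q q'
  proof -
    let ?X = "\<xi>c c q" and ?Y = "\<xi>c c q'" and ?d = "norm (snd c q - snd c q')"
    note X = adapted_xi[OF a q(1)] and Y = adapted_xi[OF a q'(1)]
    have inv: "chart_inv c (snd c q) = q" "chart_inv c (snd c q') = q'" "q \<in> W" "q \<in> fst c"
      using chartD(5)[OF aD(10)] q q' aD(12) adapted_inW[OF a] by blast+
    define w where "w = ?X - ?Y"
    have wV: "w \<in> V" using X(2) Y(2) aD(11) by (simp add: w_def subspace_diff)
    have "m * (norm ?Y)\<^sup>2 \<le> ?Y \<bullet> e"
      using mC(3)[OF q' Y(2)] Y(4)[OF Y(2)] by simp
    also have "\<dots> \<le> norm ?Y" using norm_cauchy_schwarz[of ?Y e] aD(8) by simp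
    finally have "m * norm ?Y * norm ?Y \<le> 1 * norm ?Y" by (simp add: power2_eq_square mult.assoc)
    then have nY: "m * norm ?Y \<le> 1"
      by (cases "norm ?Y = 0") (auto simp: mult_le_cancel_right)
    \<comment> \<open>The difference \<open>w\<close> is estimated by testing the two linear systems against \<open>w\<close> itself.\<close>
    have "m * (norm w)\<^sup>2 \<le> hc c q w w" using mC(3)[OF q wV] by simp
    also have "\<dots> = hc c q ?X w - hc c q ?Y w"
      unfolding w_def by (rule bilinear_lsub[OF hc_bilinear[OF aD(10) inv(4,3)]])
    also have "\<dots> = hc c q' ?Y w - hc c q ?Y w"
      using X(4)[OF wV] Y(4)[OF wV] by simp
    also have "\<dots> \<le> \<Lambda> * norm (snd c q' - snd c q) * norm ?Y * norm w"
      using \<Lambda>(2)[of "snd c q'" "snd c q" ?Y w] q q' inv by simp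
    finally have *: "m * norm w * norm w \<le> (\<Lambda> * ?d * norm ?Y) * norm w"
      by (simp add: power2_eq_square norm_minus_commute mult.assoc)
    have "m * norm w \<le> \<Lambda> * ?d * norm ?Y"
    proof (cases "norm w = 0")
      case True
      then show ?thesis using \<Lambda>(1) by simp
    next
      case False
      then show ?thesis using * by (simp add: mult_le_cancel_right)
    qed
    then have "m * (m * norm w) \<le> m * (\<Lambda> * ?d * norm ?Y)"
      using mC(1) by (simp add: mult_left_mono)
    also have "\<dots> = \<Lambda> * ?d * (m * norm ?Y)" by simp
    also have "\<dots> \<le> \<Lambda> * ?d * 1" using nY \<Lambda>(1) by (intro mult_left_mono) auto
    finally show ?thesis
      using mC(1) by (simp add: w_def field_simps power2_eq_square)
  qed
  then show ?thesis using that[of "\<Lambda> / m\<^sup>2"] \<Lambda>(1) by simp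
qed

text \<open>The speed of a curve in the rigged metric.\<close>

abbreviation speed :: "(real \<Rightarrow> 'a) \<Rightarrow> real \<Rightarrow> real" where
  "speed \<gamma> t \<equiv> sqrt (h (\<gamma> t) (velocity A \<gamma> t) (velocity A \<gamma> t))"

text \<open>A bump function around the centre of an adapted chart, whose derivative along every curve is
  bounded by a multiple of the speed of the curve.\<close>

definition bump :: "('a, 'e) chart \<Rightarrow> 'a set \<Rightarrow> real \<Rightarrow> 'a \<Rightarrow> real" where
  "bump c U r q = (if q \<in> U then (max 0 (r\<^sup>2 - (norm (snd c q))\<^sup>2))\<^sup>2 / r ^ 4 else 0)"

lemma max_square_has_derivative:
  "((\<lambda>z::real. (max 0 z)\<^sup>2) has_real_derivative 2 * max 0 z) (at z)"
proof (cases "z = 0")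
  case True
  have "((\<lambda>z::real. (max 0 z)\<^sup>2) has_real_derivative 0) (at 0)"
    unfolding has_field_derivative_iff
  proof (rule tendsto_rabs_zero_cancel, rule tendsto_sandwich[of "\<lambda>_. 0" _ _ "\<lambda>z. \<bar>z\<bar>"])
    show "\<forall>\<^sub>F y in at 0. \<bar>((max 0 y)\<^sup>2 - (max 0 (0::real))\<^sup>2) / (y - 0)\<bar> \<le> \<bar>y\<bar>"
      by (intro always_eventually) (auto simp: max_def power2_eq_square divide_simps abs_mult)
    show "((\<lambda>z::real. \<bar>z\<bar>) \<longlongrightarrow> 0) (at 0)"
      by (auto intro!: tendsto_eq_intros)
  qed auto
  then show ?thesis using True by simp
next
  case False
  then consider "z > 0" | "z < 0" by linarith
  then show ?thesis
  proof cases
    case 1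
    have "((\<lambda>z::real. z\<^sup>2) has_real_derivative 2 * z) (at z)" by (auto intro!: derivative_eq_intros)
    then have "((\<lambda>z::real. (max 0 z)\<^sup>2) has_real_derivative 2 * z) (at z)"
      by (rule has_field_derivative_transform_within_open[of _ _ _ "{0<..}"]) (use 1 in auto)
    then show ?thesis using 1 by simp
  next
    case 2
    have "((\<lambda>z::real. 0) has_real_derivative 0) (at z)" by simp
    then have "((\<lambda>z::real. (max 0 z)\<^sup>2) has_real_derivative 0) (at z)"
      by (rule has_field_derivative_transform_within_open[of _ _ _ "{..<0}"]) (use 2 in auto)
    then show ?thesis using 2 by simp
  qed
qed

lemma bump_properties:
  assumes a: "adapted p c U V \<rho> e" and r: "0 < r" "r < \<rho>"
  shows "bump c U r p = 1" "bump c U r q > 0 \<longleftrightarrow> q \<in> U \<and> norm (snd c q) < r" "0 \<le> bump c U r q"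
    "0 \<le> s \<Longrightarrow> openin T {q \<in> topspace T. bump c U r q > s}"
proof -
  note aD = adaptedD[OF a]
  show "bump c U r p = 1" using aD(3,4) r by (simp add: bump_def)
  show "bump c U r q > 0 \<longleftrightarrow> q \<in> U \<and> norm (snd c q) < r"
    using r power2_less_imp_less[of "norm (snd c q)" r] power_strict_mono[of "norm (snd c q)" r 2]
    by (auto simp: bump_def max_def zero_less_divide_iff)
  show "0 \<le> bump c U r q" using r by (auto simp: bump_def)
  show "openin T {q \<in> topspace T. bump c U r q > s}" if "0 \<le> s"
  proof -
    let ?B = "{x::'e. (max 0 (r\<^sup>2 - (norm x)\<^sup>2))\<^sup>2 / r ^ 4 > s}"
    have "open ?B"
      by (intro open_Collect_less continuous_intros) (use r in auto)
    moreover have "{q \<in> topspace T. bump c U r q > s} = {q \<in> U. snd c q \<in> ?B}"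
      using that aD(16) by (auto simp: bump_def)
    ultimately show ?thesis using adapted_openin[OF a, of ?B] by simp
  qed
qed

lemma bump_derivative:
  assumes a: "adapted p c U V \<rho> e" and r: "0 < r" "r < \<rho>"
  obtains C where "C > 0" "\<And>J \<gamma> t. open J \<Longrightarrow> smooth_curve A T J \<gamma> \<Longrightarrow> t \<in> J \<Longrightarrow>
    \<exists>D. ((bump c U r \<circ> \<gamma>) has_real_derivative D) (at t) \<and> \<bar>D\<bar> \<le> C * speed \<gamma> t"
proof -
  note aD = adaptedD[OF a]
  obtain m C where mC: "m > 0" "C > 0"
    "\<And>q u. q \<in> U \<Longrightarrow> norm (snd c q) \<le> r \<Longrightarrow> u \<in> V \<Longrightarrow> m * (norm u)\<^sup>2 \<le> hc c q u u \<and> hc c q u u \<le> C * (norm u)\<^sup>2"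
    using adapted_bounds[OF a less_imp_le[OF r(1)] r(2)] by metis
  define C' where "C' = 4 / (r * sqrt m)"
  have "C' > 0" using mC r by (simp add: C'_def)
  moreover have "\<exists>D. ((bump c U r \<circ> \<gamma>) has_real_derivative D) (at t) \<and> \<bar>D\<bar> \<le> C' * speed \<gamma> t"
    if J: "open J" and \<gamma>: "smooth_curve A T J \<gamma>" and t: "t \<in> J" for J \<gamma> t
  proof (cases "\<gamma> t \<in> U")
    case True
    note amb = smooth_curve_ambient[OF submfd J \<gamma>]
    obtain w where w: "w \<in> V" "((snd c \<circ> \<gamma>) has_vector_derivative w) (at t)" "velocity A \<gamma> t = coord_vec A c (\<gamma> t) w"
      by (rule slice_curve_derivative[OF submfd aD(1) J \<gamma> t True])
    let ?x = "snd c (\<gamma> t)"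
    have "((\<lambda>s. r\<^sup>2 - y s \<bullet> y s) has_real_derivative - (2 * (y t \<bullet> w))) (at t)"
      if "(y has_derivative (\<lambda>s. s *\<^sub>R w)) (at t)" for y :: "real \<Rightarrow> 'e"
      unfolding has_field_derivative_def
      by (rule derivative_eq_intros that refl)+ (simp add: inner_commute algebra_simps fun_eq_iff)
    from this[OF w(2)[unfolded has_vector_derivative_def]]
    have "((\<lambda>s. r\<^sup>2 - (snd c \<circ> \<gamma>) s \<bullet> (snd c \<circ> \<gamma>) s) has_real_derivative - (2 * (?x \<bullet> w))) (at t)"
      by simp
    from DERIV_cdivide[OF DERIV_chain2[OF max_square_has_derivative this], of "r ^ 4"]
    have D: "((\<lambda>s. (max 0 (r\<^sup>2 - (snd c \<circ> \<gamma>) s \<bullet> (snd c \<circ> \<gamma>) s))\<^sup>2 / r ^ 4) has_real_derivative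
       2 * max 0 (r\<^sup>2 - ?x \<bullet> ?x) * - (2 * (?x \<bullet> w)) / r ^ 4) (at t)" (is "(_ has_real_derivative ?D) _")
      by simp
    have D': "((bump c U r \<circ> \<gamma>) has_real_derivative ?D) (at t)"
      by (rule has_field_derivative_transform_within_open[OF D curve_open_preimage[OF amb(2) J aD(13)]])
        (use t True in \<open>auto simp: bump_def dot_square_norm\<close>)
    have "\<bar>?D\<bar> \<le> C' * speed \<gamma> t"
    proof (cases "norm ?x \<le> r")
      case False
      then have "r\<^sup>2 \<le> ?x \<bullet> ?x" using r by (simp add: dot_square_norm)
      then have "max 0 (r\<^sup>2 - ?x \<bullet> ?x) = 0" by simp
      then have "?D = 0" by simp
      moreover have "0 \<le> h (\<gamma> t) (velocity A \<gamma> t) (velocity A \<gamma> t)"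
        using rigged_metric_nonneg[OF amb(3)[OF t] smooth_curve_velocity_tangent[OF submfd J \<gamma> t]]
        by (metis abs_ge_zero order_trans real_sqrt_ge_0_iff)
      ultimately show ?thesis using \<open>C' > 0\<close> by (simp only: abs_zero) simp
    next
      case nx: True
      have "m * (norm w)\<^sup>2 \<le> h (\<gamma> t) (velocity A \<gamma> t) (velocity A \<gamma> t)"
        using mC(3)[OF True nx w(1)] by (simp add: w(3) hc_def)
      then have "sqrt m * norm w \<le> speed \<gamma> t"
        using real_sqrt_le_mono by (fastforce simp: real_sqrt_mult)
      then have nw: "norm w \<le> speed \<gamma> t / sqrt m" using mC(1) by (simp add: field_simps)
      have "\<bar>?x \<bullet> w\<bar> \<le> norm ?x * norm w" by (rule Cauchy_Schwarz_ineq2)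
      also have "\<dots> \<le> r * (speed \<gamma> t / sqrt m)"
        using nx nw r by (intro mult_mono) auto
      finally have xw: "\<bar>?x \<bullet> w\<bar> \<le> r * (speed \<gamma> t / sqrt m)" .
      have "\<bar>?D\<bar> = 4 * max 0 (r\<^sup>2 - ?x \<bullet> ?x) * \<bar>?x \<bullet> w\<bar> / r ^ 4"
        using r by (simp add: abs_mult)
      also have "\<dots> \<le> 4 * r\<^sup>2 * (r * (speed \<gamma> t / sqrt m)) / r ^ 4"
        using r xw by (intro divide_right_mono mult_mono) auto
      also have "\<dots> = C' * speed \<gamma> t"
        using r mC(1) by (simp add: C'_def field_simps power2_eq_square power4_eq_xxxx)
      finally show ?thesis .
    qed
    then show ?thesis using D' by blast
  next
    case False
    note amb = smooth_curve_ambient[OF submfd J \<gamma>]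
    let ?K = "{q\<in>U. norm (snd c q) \<le> r}"
    have "closedin T ?K"
      by (rule compactin_imp_closedin[OF submanifold_Hausdorff[OF submfd] adapted_compact[OF a r(2)]])
    then have op: "openin T (topspace T - ?K)" by (simp add: openin_diff)
    have "((\<lambda>_. 0) has_real_derivative 0) (at t)" by simp
    then have "((bump c U r \<circ> \<gamma>) has_real_derivative 0) (at t)"
    proof (rule has_field_derivative_transform_within_open[OF _ curve_open_preimage[OF amb(2) J op]])
      show "t \<in> J \<inter> \<gamma> -` (topspace T - ?K)" using t False amb(3)[OF t] by simp
      fix s assume "s \<in> J \<inter> \<gamma> -` (topspace T - ?K)"
      then have "\<not> bump c U r (\<gamma> s) > 0" unfolding bump_properties(2)[OF a r] by auto
      then show "0 = (bump c U r \<circ> \<gamma>) s" using bump_properties(3)[OF a r, of "\<gamma> s"] by simp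
    qed
    moreover have "0 \<le> h (\<gamma> t) (velocity A \<gamma> t) (velocity A \<gamma> t)"
      using rigged_metric_nonneg[OF amb(3)[OF t] smooth_curve_velocity_tangent[OF submfd J \<gamma> t]]
      by (metis abs_ge_zero order_trans real_sqrt_ge_0_iff)
    ultimately show ?thesis using \<open>C' > 0\<close> by (intro exI[of _ 0]) simp
  qed
  ultimately show ?thesis using that by blast
qed

end


section \<open>The flow of the rigged vector field\<close>

lemma has_vector_derivative_shift:
  assumes "(f has_vector_derivative w) (at (t + s))"
  shows "((\<lambda>s::real. f (t + s)) has_vector_derivative w) (at s)"
proof -
  have "((\<lambda>s. t + s) has_derivative (\<lambda>h. h)) (at s)"
    by (auto intro!: derivative_eq_intros)
  from has_derivative_compose[OF this assms[unfolded has_vector_derivative_def]]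
  show ?thesis by (simp add: has_vector_derivative_def)
qed

context null_normalization
begin

text \<open>Integral curves of the rigged vector field, defined for all times.\<close>

definition integral_curve :: "(real \<Rightarrow> 'a) \<Rightarrow> bool" where
  "integral_curve \<gamma> \<longleftrightarrow> smooth_curve A T UNIV \<gamma> \<and> (\<forall>t. velocity A \<gamma> t = \<xi> (\<gamma> t))"

lemma integral_curveD:
  assumes "integral_curve \<gamma>"
  shows "smooth_curve A T UNIV \<gamma>" "ambient_curve UNIV \<gamma>" "continuous_map euclideanreal T \<gamma>"
    "\<gamma> t \<in> topspace T" "velocity A \<gamma> t = \<xi> (\<gamma> t)"
proof -
  show s: "smooth_curve A T UNIV \<gamma>" and "velocity A \<gamma> t = \<xi> (\<gamma> t)"
    using assms by (auto simp: integral_curve_def)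
  show "ambient_curve UNIV \<gamma>" "continuous_map euclideanreal T \<gamma>" "\<gamma> t \<in> topspace T"
    using smooth_curve_ambient[OF submfd open_UNIV s] by auto
qed

lemma integral_curve_coord:
  assumes a: "adapted p c U V \<rho> e" and \<gamma>: "integral_curve \<gamma>" and t: "\<gamma> t \<in> U"
  shows "((snd c \<circ> \<gamma>) has_vector_derivative \<xi>c c (\<gamma> t)) (at t)"
proof -
  note aD = adaptedD[OF a]
  obtain w where w: "w \<in> V" "((snd c \<circ> \<gamma>) has_vector_derivative w) (at t)" "velocity A \<gamma> t = coord_vec A c (\<gamma> t) w"
    by (rule slice_curve_derivative[OF submfd aD(1) open_UNIV integral_curveD(1)[OF \<gamma>] UNIV_I t])
  have "\<gamma> t \<in> fst c" using t aD(12) by blast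
  then have "w = \<xi>c c (\<gamma> t)"
    using w(3) integral_curveD(5)[OF \<gamma>] adapted_xi(1)[OF a t] coord_vec_eq_iff[OF aD(10)] by metis
  then show ?thesis using w(2) by simp
qed

lemma integral_curve_speed:
  assumes \<gamma>: "integral_curve \<gamma>"
  shows "speed \<gamma> t = 1"
proof -
  obtain c U V \<rho> e where a: "adapted (\<gamma> t) c U V \<rho> e"
    by (rule adapted_exists[OF integral_curveD(4)[OF \<gamma>]])
  note x = adapted_xi[OF a adaptedD(3)[OF a]]
  have "h (\<gamma> t) (\<xi> (\<gamma> t)) (\<xi> (\<gamma> t)) = 1"
    unfolding x(1) hc_def[symmetric] using x(4)[OF x(2)] x(3) by simp
  then show ?thesis using integral_curveD(5)[OF \<gamma>] by simp
qed

text \<open>Integral curves that start in \<open>B\<close> stay in the chart domain \<open>U\<close> for the time \<open>\<epsilon>\<close>, move the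
  coordinate along \<open>e\<close> at unit speed, and depend on their initial point with Lipschitz constant \<open>M\<close>.\<close>

definition flow_box :: "('a, 'e) chart \<Rightarrow> 'a set \<Rightarrow> 'e \<Rightarrow> real \<Rightarrow> real \<Rightarrow> 'a set \<Rightarrow> bool" where
  "flow_box c U e \<epsilon> M B \<longleftrightarrow>
     (\<forall>\<gamma> t s. integral_curve \<gamma> \<longrightarrow> \<gamma> t \<in> B \<longrightarrow> \<bar>s\<bar> \<le> \<epsilon> \<longrightarrow>
        \<gamma> (t + s) \<in> U \<and> snd c (\<gamma> (t + s)) \<bullet> e = snd c (\<gamma> t) \<bullet> e + s) \<and>
     (\<forall>\<gamma> \<eta> t t' s. integral_curve \<gamma> \<longrightarrow> integral_curve \<eta> \<longrightarrow> \<gamma> t \<in> B \<longrightarrow> \<eta> t' \<in> B \<longrightarrow> \<bar>s\<bar> \<le> \<epsilon> \<longrightarrow>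
        dist (snd c (\<gamma> (t + s))) (snd c (\<eta> (t' + s))) \<le> M * dist (snd c (\<gamma> t)) (snd c (\<eta> t')))"

lemma flow_boxD:
  assumes "flow_box c U e \<epsilon> M B"
  shows "\<forall>\<gamma> t s. integral_curve \<gamma> \<longrightarrow> \<gamma> t \<in> B \<longrightarrow> \<bar>s\<bar> \<le> \<epsilon> \<longrightarrow>
      \<gamma> (t + s) \<in> U \<and> snd c (\<gamma> (t + s)) \<bullet> e = snd c (\<gamma> t) \<bullet> e + s"
    and "\<forall>\<gamma> \<eta> t t' s. integral_curve \<gamma> \<longrightarrow> integral_curve \<eta> \<longrightarrow> \<gamma> t \<in> B \<longrightarrow> \<eta> t' \<in> B \<longrightarrow> \<bar>s\<bar> \<le> \<epsilon> \<longrightarrow>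
      dist (snd c (\<gamma> (t + s))) (snd c (\<eta> (t' + s))) \<le> M * dist (snd c (\<gamma> t)) (snd c (\<eta> t'))"
  using assms unfolding flow_box_def by (rule conjunct1, rule conjunct2)

lemma flow_box_exists:
  assumes "p \<in> topspace T"
  obtains c U V \<rho> e \<epsilon> M B where "adapted p c U V \<rho> e" "\<epsilon> > 0" "M > 0" "openin T B" "p \<in> B" "B \<subseteq> U"
    "flow_box c U e \<epsilon> M B"
proof -
  obtain c U V \<rho> e where a: "adapted p c U V \<rho> e" by (rule adapted_exists[OF assms])
  note aD = adaptedD[OF a]
  define r where "r = \<rho> / 2"
  have r: "0 < r" "r < \<rho>" using aD(5) by (auto simp: r_def)
  obtain C where C: "C > 0" "\<And>J \<gamma> t. open J \<Longrightarrow> smooth_curve A T J \<gamma> \<Longrightarrow> t \<in> J \<Longrightarrow>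
    \<exists>D. ((bump c U r \<circ> \<gamma>) has_real_derivative D) (at t) \<and> \<bar>D\<bar> \<le> C * speed \<gamma> t"
    using bump_derivative[OF a r] by metis
  obtain K where K: "K \<ge> 0" "\<And>q q'. q \<in> U \<Longrightarrow> norm (snd c q) \<le> r \<Longrightarrow> q' \<in> U \<Longrightarrow> norm (snd c q') \<le> r \<Longrightarrow>
    norm (\<xi>c c q - \<xi>c c q') \<le> K * norm (snd c q - snd c q')"
    using xi_lipschitz[OF a less_imp_le[OF r(1)] r(2)] by metis
  note bp = bump_properties[OF a r]
  define B where "B = {q \<in> topspace T. bump c U r q > 1/2}"
  \<comment> \<open>Along integral curves, whose speed is \<open>1\<close>, the bump drops from above \<open>1/2\<close> by at most \<open>1/4\<close> in this time.\<close>
  define \<epsilon> where "\<epsilon> = 1 / (4 * C)"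
  define M where "M = exp (K * \<epsilon>)"
  have BU: "B \<subseteq> U"
    using bp(2) by (fastforce simp: B_def)
  have stay: "\<gamma> (t + s) \<in> U \<and> norm (snd c (\<gamma> (t + s))) < r"
    if \<gamma>: "integral_curve \<gamma>" and t: "\<gamma> t \<in> B" and s: "\<bar>s\<bar> \<le> \<epsilon>" for \<gamma> t s
  proof -
    have "\<exists>D. ((bump c U r \<circ> \<gamma>) has_real_derivative D) (at t) \<and> \<bar>D\<bar> \<le> C" for t
      using C(2)[OF open_UNIV integral_curveD(1)[OF \<gamma>] UNIV_I, of t] integral_curve_speed[OF \<gamma>] by simp
    then obtain D where D: "\<And>t. ((bump c U r \<circ> \<gamma>) has_real_derivative D t) (at t)" "\<And>t. \<bar>D t\<bar> \<le> C"
      by metis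
    have "norm ((bump c U r \<circ> \<gamma>) (t + s) - (bump c U r \<circ> \<gamma>) t) \<le> C * norm (t + s - t)"
      by (rule field_differentiable_bound[of UNIV "bump c U r \<circ> \<gamma>" D]) (use D in simp_all)
    then have "bump c U r (\<gamma> t) - C * \<bar>s\<bar> \<le> bump c U r (\<gamma> (t + s))"
      by (simp add: abs_le_iff)
    moreover have "C * \<bar>s\<bar> \<le> C * \<epsilon>" using s C(1) by simp
    moreover have "C * \<epsilon> = 1/4" using C(1) by (simp add: \<epsilon>_def)
    moreover have "bump c U r (\<gamma> t) > 1/2" using t by (simp add: B_def)
    ultimately have "bump c U r (\<gamma> (t + s)) > 0" by linarith
    then show ?thesis using bp(2) by blast
  qed
  have deriv: "((\<lambda>s. snd c (\<gamma> (t + s))) has_vector_derivative \<xi>c c (\<gamma> (t + s))) (at s)"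
    if \<gamma>: "integral_curve \<gamma>" and t: "\<gamma> t \<in> B" and s: "\<bar>s\<bar> \<le> \<epsilon>" for \<gamma> t s
    using has_vector_derivative_shift[OF integral_curve_coord[OF a \<gamma>, of "t + s"]] stay[OF that] by simp
  have "snd c (\<gamma> (t + s)) \<bullet> e = snd c (\<gamma> t) \<bullet> e + s"
    if \<gamma>: "integral_curve \<gamma>" and t: "\<gamma> t \<in> B" and s: "\<bar>s\<bar> \<le> \<epsilon>" for \<gamma> t s
  proof -
    have d: "((\<lambda>s. snd c (\<gamma> (t + s)) \<bullet> e - s) has_real_derivative 0) (at s within {-\<epsilon>..\<epsilon>})" if s: "s \<in> {-\<epsilon>..\<epsilon>}" for s
    proof -
      have s': "\<bar>s\<bar> \<le> \<epsilon>" using s by auto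
      have "((\<lambda>s. snd c (\<gamma> (t + s)) \<bullet> e) has_vector_derivative \<xi>c c (\<gamma> (t + s)) \<bullet> e) (at s)"
        by (rule bounded_linear.has_vector_derivative[OF bounded_linear_inner_left deriv[OF \<gamma> t s']])
      then have "((\<lambda>s. snd c (\<gamma> (t + s)) \<bullet> e) has_real_derivative 1) (at s)"
        using adapted_xi(3)[OF a] stay[OF \<gamma> t s'] by (simp add: has_real_derivative_iff_has_vector_derivative)
      from DERIV_diff[OF this DERIV_ident] show ?thesis
        by (auto intro: has_field_derivative_at_within)
    qed
    obtain k where k: "\<And>s. s \<in> {-\<epsilon>..\<epsilon>} \<Longrightarrow> snd c (\<gamma> (t + s)) \<bullet> e - s = k"
      using has_field_derivative_zero_constant[OF convex_real_interval(5) d] by metis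
    have "0 \<in> {-\<epsilon>..\<epsilon>}" "s \<in> {-\<epsilon>..\<epsilon>}" using s by auto
    then show ?thesis using k[of 0] k[of s] by simp
  qed
  moreover have "dist (snd c (\<gamma> (t + s))) (snd c (\<eta> (t' + s))) \<le> M * dist (snd c (\<gamma> t)) (snd c (\<eta> t'))"
    if \<gamma>: "integral_curve \<gamma>" and \<eta>: "integral_curve \<eta>" and t: "\<gamma> t \<in> B" and t': "\<eta> t' \<in> B" and s: "\<bar>s\<bar> \<le> \<epsilon>" for \<gamma> \<eta> t t' s
  proof -
    define y where "y s = snd c (\<gamma> (t + s)) - snd c (\<eta> (t' + s))" for s
    define y' where "y' s = \<xi>c c (\<gamma> (t + s)) - \<xi>c c (\<eta> (t' + s))" for s
    have dy: "(y has_vector_derivative y' s) (at s)" if "\<bar>s\<bar> \<le> \<epsilon>" for s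
      unfolding y_def[abs_def] y'_def by (intro has_vector_derivative_diff deriv \<gamma> \<eta> t t' that)
    have "y s \<bullet> y s \<le> exp (2 * K * \<bar>s\<bar>) * (y 0 \<bullet> y 0)"
    proof (rule gronwall[where f' = "\<lambda>s. 2 * (y s \<bullet> y' s)" and b = \<epsilon>, OF _ _ s])
      fix s :: real assume s: "\<bar>s\<bar> \<le> \<epsilon>"
      show "((\<lambda>s. y s \<bullet> y s) has_real_derivative 2 * (y s \<bullet> y' s)) (at s)"
        unfolding has_field_derivative_def
        by (rule derivative_eq_intros dy[OF s, unfolded has_vector_derivative_def] refl)+
          (simp add: inner_commute fun_eq_iff)
      have "norm (y' s) \<le> K * norm (y s)"
        unfolding y_def y'_def using stay[OF \<gamma> t s] stay[OF \<eta> t' s] by (intro K(2)) auto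
      then have "norm (y s) * norm (y' s) \<le> norm (y s) * (K * norm (y s))"
        by (rule mult_left_mono) simp
      then have "\<bar>y s \<bullet> y' s\<bar> \<le> K * (y s \<bullet> y s)"
        using Cauchy_Schwarz_ineq2[of "y s" "y' s"] by (simp add: dot_square_norm power2_eq_square mult_ac)
      then show "\<bar>2 * (y s \<bullet> y' s)\<bar> \<le> 2 * K * (y s \<bullet> y s)" by (simp add: abs_mult)
    qed
    also have "\<dots> \<le> exp (2 * K * \<epsilon>) * (y 0 \<bullet> y 0)"
      using s K(1) by (intro mult_right_mono) (auto simp: mult_left_mono)
    also have "exp (2 * K * \<epsilon>) = M * M"
      unfolding M_def by (simp add: exp_add[symmetric])
    finally have "(norm (y s))\<^sup>2 \<le> (M * norm (y 0))\<^sup>2"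
      by (simp add: dot_square_norm power_mult_distrib power2_eq_square[of M])
    then have "norm (y s) \<le> M * norm (y 0)"
      by (rule power2_le_imp_le) (simp add: M_def)
    then show ?thesis by (simp add: y_def dist_norm)
  qed
  moreover have "openin T B" unfolding B_def by (rule bp(4)) simp
  moreover have "p \<in> B" using bp(1) assms by (simp add: B_def)
  moreover have "\<epsilon> > 0" "M > 0" using C(1) by (simp_all add: \<epsilon>_def M_def)
  moreover have "flow_box c U e \<epsilon> M B"
    unfolding flow_box_def using calculation(1,2) stay by blast
  ultimately show ?thesis using that[of c U V \<rho> e \<epsilon> M B] a BU by blast
qed

lemma integral_curve_shift:
  assumes \<gamma>: "integral_curve \<gamma>"
  shows "integral_curve (\<lambda>s. \<gamma> (t + s))"
proof -
  have eq: "(\<lambda>s. \<gamma> (t + s)) = (\<lambda>s. \<gamma> (1 * s + t))" by (simp add: add.commute)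
  have amb: "ambient_curve UNIV (\<lambda>s. \<gamma> (t + s))"
    unfolding eq using ambient_curve_affine[OF integral_curveD(2)[OF \<gamma>], of 1 t] by simp
  have "continuous_map euclideanreal euclideanreal (\<lambda>s. t + s)"
    by (auto intro!: continuous_intros)
  from continuous_map_compose[OF this integral_curveD(3)[OF \<gamma>]]
  have "smooth_curve A T UNIV (\<lambda>s. \<gamma> (t + s))"
    using amb by (intro smooth_curveI) (simp_all add: o_def)
  moreover have "velocity A (\<lambda>s. \<gamma> (t + s)) s = \<xi> (\<gamma> (t + s))" for s
    unfolding eq velocity_affine[OF integral_curveD(2)[OF \<gamma>] UNIV_I]
    using integral_curveD(5)[OF \<gamma>, of "t + s"] by (simp add: add.commute)
  ultimately show ?thesis by (simp add: integral_curve_def)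
qed

lemma integral_curve_unique:
  assumes \<gamma>: "integral_curve \<gamma>" and \<eta>: "integral_curve \<eta>" and "\<gamma> t0 = \<eta> t0"
  shows "\<gamma> t = \<eta> t"
proof -
  let ?S = "{t. \<gamma> t = \<eta> t}"
  have "closed ?S"
    using integral_curveD(2)[OF \<gamma>] integral_curveD(2)[OF \<eta>]
    by (intro closed_Collect_eq) (auto simp: ambient_curve_def)
  moreover have "open ?S"
    unfolding open_dist
  proof
    fix t assume t: "t \<in> ?S"
    obtain c U V \<rho> e \<epsilon> M B where fb: "adapted (\<gamma> t) c U V \<rho> e" "\<epsilon> > 0" "M > 0" "openin T B" "\<gamma> t \<in> B" "B \<subseteq> U"
      "flow_box c U e \<epsilon> M B"
      by (rule flow_box_exists[OF integral_curveD(4)[OF \<gamma>, of t]])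
    note aD = adaptedD[OF fb(1)]
    have "\<gamma> (t + s) = \<eta> (t + s)" if s: "\<bar>s\<bar> \<le> \<epsilon>" for s
    proof -
      have tB: "\<eta> t \<in> B" using t fb(5) by simp
      have "dist (snd c (\<gamma> (t + s))) (snd c (\<eta> (t + s))) \<le> M * dist (snd c (\<gamma> t)) (snd c (\<eta> t))"
        using flow_boxD(2)[OF fb(7)] \<gamma> \<eta> fb(5) tB s by blast
      then have "snd c (\<gamma> (t + s)) = snd c (\<eta> (t + s))" using t by simp
      moreover have "\<gamma> (t + s) \<in> fst c" "\<eta> (t + s) \<in> fst c"
        using flow_boxD(1)[OF fb(7)] \<gamma> \<eta> fb(5) tB s aD(12) by blast+
      ultimately show ?thesis using chartD(8)[OF aD(10)] by (auto dest: inj_onD)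
    qed
    from this[of "t' - t" for t'] have "t' \<in> ?S" if "dist t' t < \<epsilon>" for t'
      using that by (simp add: dist_real_def)
    then show "\<exists>e>0. \<forall>y. dist y t < e \<longrightarrow> y \<in> ?S" using fb(2) by blast
  qed
  ultimately have "closed ?S \<and> open ?S" by (rule conjI)
  then have "?S = {} \<or> ?S = UNIV" by (simp only: clopen)
  then show ?thesis using assms(3) by auto
qed

end

text \<open>The rigged vector field is complete and the leaves of the screen distribution are compact.
  Connectedness of the hypersurface is needed only for the distance.\<close>

locale complete_normalization = null_normalization A g T W \<zeta>
  for A :: "('a::{t2_space, second_countable_topology}, 'e::euclidean_space) chart set"
    and g T W \<zeta> +
  assumes complete: "complete_vector_field A T (rigged_vector_field A g T \<zeta>)"
    and compact_leaves: "\<And>L. leaf A T (screen_distribution A g T \<zeta>) L \<Longrightarrow> compact_space L"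
begin

text \<open>The integral curve of \<open>\<xi>\<close> that starts at \<open>x\<close>; the value is arbitrary for \<open>x\<close> outside the
  hypersurface.\<close>

definition flow :: "'a \<Rightarrow> real \<Rightarrow> 'a" where
  "flow x = (SOME \<gamma>. integral_curve \<gamma> \<and> \<gamma> 0 = x)"

lemma flow:
  assumes "x \<in> topspace T"
  shows "integral_curve (flow x)" "flow x 0 = x" "flow x t \<in> topspace T"
proof -
  obtain \<gamma> where "smooth_curve A T UNIV \<gamma>" "\<gamma> 0 = x" "\<And>t. velocity A \<gamma> t = \<xi> (\<gamma> t)"
    using complete assms unfolding complete_vector_field_def by metis
  then have "integral_curve \<gamma> \<and> \<gamma> 0 = x" by (simp add: integral_curve_def)
  then have "integral_curve (flow x) \<and> flow x 0 = x"
    unfolding flow_def by (rule someI[of "\<lambda>\<gamma>. integral_curve \<gamma> \<and> \<gamma> 0 = x"])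
  then show "integral_curve (flow x)" "flow x 0 = x" by auto
  from integral_curveD(4)[OF this(1)] show "flow x t \<in> topspace T" .
qed

lemma flow_add:
  assumes x: "x \<in> topspace T"
  shows "flow (flow x t) s = flow x (t + s)"
  using integral_curve_unique[OF flow(1)[OF flow(3)[OF x]] integral_curve_shift[OF flow(1)[OF x]], of t 0 t s]
    flow(2)[OF flow(3)[OF x]] by simp

text \<open>Continuity of the time \<open>t\<close> map at \<open>x\<close> for the leaf topology.\<close>

definition leaf_cont :: "real \<Rightarrow> 'a \<Rightarrow> bool" where
  "leaf_cont t x \<longleftrightarrow> (\<forall>S. openin leaf_top S \<and> flow x t \<in> S \<longrightarrow>
     (\<exists>U. openin leaf_top U \<and> x \<in> U \<and> (\<forall>y\<in>U. flow y t \<in> S)))"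

lemma leaf_cont_add:
  assumes x: "x \<in> topspace T" and "leaf_cont t x" "leaf_cont s (flow x t)"
  shows "leaf_cont (t + s) x"
  unfolding leaf_cont_def
proof (intro allI impI)
  fix S assume S: "openin leaf_top S \<and> flow x (t + s) \<in> S"
  then obtain U where U: "openin leaf_top U" "flow x t \<in> U" "\<And>y. y \<in> U \<Longrightarrow> flow y s \<in> S"
    using assms(3) flow_add[OF x] unfolding leaf_cont_def by metis
  then obtain U' where U': "openin leaf_top U'" "x \<in> U'" "\<And>y. y \<in> U' \<Longrightarrow> flow y t \<in> U"
    using assms(2) unfolding leaf_cont_def by metis
  have "flow y (t + s) \<in> S" if y: "y \<in> U'" for y
  proof -
    have "y \<in> topspace T" using openin_subset[OF U'(1)] y by auto
    then show ?thesis using flow_add U(3)[OF U'(3)[OF y]] by metis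
  qed
  then show "\<exists>U. openin leaf_top U \<and> x \<in> U \<and> (\<forall>y\<in>U. flow y (t + s) \<in> S)" using U' by blast
qed

text \<open>In a flow box, a point near \<open>z\<close> with the same coordinate along \<open>e\<close> flows to a point near the image
  of \<open>z\<close> with, again, the same coordinate along \<open>e\<close>.\<close>

lemma leaf_cont_local:
  assumes "p \<in> topspace T"
  obtains B \<epsilon> where "openin T B" "p \<in> B" "\<epsilon> > 0" "\<forall>z\<in>B. \<forall>s. \<bar>s\<bar> \<le> \<epsilon> \<longrightarrow> leaf_cont s z"
proof -
  obtain c U V \<rho> e \<epsilon> M B where fb: "adapted p c U V \<rho> e" "\<epsilon> > 0" "M > 0" "openin T B" "p \<in> B" "B \<subseteq> U"
    "flow_box c U e \<epsilon> M B"
    by (rule flow_box_exists[OF assms])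
  note aD = adaptedD[OF fb(1)]
  have BT: "B \<subseteq> topspace T" using openin_subset[OF fb(4)] .
  have stay: "flow y s \<in> U" "snd c (flow y s) \<bullet> e = snd c y \<bullet> e + s" if y: "y \<in> B" and s: "\<bar>s\<bar> \<le> \<epsilon>" for y s
    using flow_boxD(1)[OF fb(7), rule_format, of "flow y" 0 s] flow[of y] y s BT by auto
  have lip: "dist (snd c (flow y s)) (snd c (flow z s)) \<le> M * dist (snd c y) (snd c z)"
    if y: "y \<in> B" and z: "z \<in> B" and s: "\<bar>s\<bar> \<le> \<epsilon>" for y z s
  proof -
    have yz: "y \<in> topspace T" "z \<in> topspace T" using y z BT by auto
    show ?thesis
      using flow_boxD(2)[OF fb(7), rule_format, of "flow y" "flow z" 0 0 s] flow(1,2)[OF yz(1)] flow(1,2)[OF yz(2)] y z s by simp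
  qed
  have "leaf_cont s z" if z: "z \<in> B" and s: "\<bar>s\<bar> \<le> \<epsilon>" for z s
    unfolding leaf_cont_def
  proof (intro allI impI)
    let ?w = "flow z s"
    fix S assume S: "openin leaf_top S \<and> ?w \<in> S"
    have wc: "?w \<in> fst c" using stay(1)[OF z s] aD(12) by blast
    obtain U' where U': "openin T U'" "?w \<in> U'" "U' \<subseteq> fst c" "{y\<in>U'. snd c y \<bullet> e = snd c ?w \<bullet> e} \<subseteq> S"
      by (rule leaf_nhd[OF conjunct1[OF S] conjunct2[OF S] aD(9) wc])
    obtain r where r: "r > 0" "ball (snd c ?w) r \<subseteq> snd c ` fst c" "{q\<in>U. dist (snd c q) (snd c ?w) < r} \<subseteq> U'"
      by (rule slice_nhd[OF aD(1) U'(1,2) stay(1)[OF z s]])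
    let ?N = "{y\<in>U. snd c y \<in> ball (snd c z) (r / M)}"
    let ?P = "{y\<in>U. snd c y \<bullet> e = snd c z \<bullet> e}"
    have "openin leaf_top (B \<inter> ?N \<inter> ?P)"
      by (intro openin_Int openin_leaf_top_T[OF fb(4)] openin_leaf_top_T[OF adapted_openin[OF fb(1)]]
          plaque_openin[OF fb(1)] open_ball)
    moreover have "z \<in> B \<inter> ?N \<inter> ?P" using z fb(3,6) r(1) by auto
    moreover have "flow y s \<in> S" if y: "y \<in> B \<inter> ?N \<inter> ?P" for y
    proof -
      have yB: "y \<in> B" using y by blast
      have "dist (snd c (flow y s)) (snd c ?w) \<le> M * dist (snd c y) (snd c z)" by (rule lip[OF yB z s])
      also have "\<dots> < r" using y fb(3) by (simp add: dist_commute field_simps)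
      finally have "flow y s \<in> U'" using r(3) stay(1)[OF yB s] by blast
      then show ?thesis using U'(4) stay(2)[OF yB s] stay(2)[OF z s] y by auto
    qed
    ultimately show "\<exists>U. openin leaf_top U \<and> z \<in> U \<and> (\<forall>y\<in>U. flow y s \<in> S)" by blast
  qed
  then show ?thesis using that fb(2,4,5) by blast
qed

text \<open>The set of times \<open>t\<close> with this continuity is open and closed, by the local statement and the
  group property of the flow.\<close>

lemma leaf_cont_all:
  assumes x: "x \<in> topspace T"
  shows "leaf_cont t x"
proof -
  let ?S = "{t. leaf_cont t x}"
  have 0: "leaf_cont 0 x"
    unfolding leaf_cont_def using flow(2)[OF x]
  proof (intro allI impI)
    fix S assume S: "openin leaf_top S \<and> flow x 0 \<in> S"
    then have "\<forall>y\<in>S. flow y 0 \<in> S" using openin_subset[of leaf_top S] flow(2) by auto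
    then show "\<exists>U. openin leaf_top U \<and> x \<in> U \<and> (\<forall>y\<in>U. flow y 0 \<in> S)"
      using S flow(2)[OF x] by auto
  qed
  have key: "\<exists>\<delta>>0. \<forall>t'. dist t' t < \<delta> \<longrightarrow> (leaf_cont t' x \<longleftrightarrow> leaf_cont t x)" for t
  proof -
    obtain B \<epsilon> where B: "openin T B" "flow x t \<in> B" "\<epsilon> > 0" "\<forall>z\<in>B. \<forall>s. \<bar>s\<bar> \<le> \<epsilon> \<longrightarrow> leaf_cont s z"
      by (rule leaf_cont_local[OF flow(3)[OF x, of t]])
    have "open (UNIV \<inter> flow x -` B)"
      by (rule curve_open_preimage[OF _ open_UNIV B(1)]) (use integral_curveD(3)[OF flow(1)[OF x]] in simp)
    moreover have "t \<in> UNIV \<inter> flow x -` B" using B(2) by simp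
    ultimately obtain \<delta> where "\<delta> > 0" "ball t \<delta> \<subseteq> UNIV \<inter> flow x -` B"
      by (rule openE)
    then have d: "\<delta> > 0" "ball t \<delta> \<subseteq> flow x -` B" by auto
    have "leaf_cont t' x \<longleftrightarrow> leaf_cont t x" if t': "dist t' t < min \<delta> \<epsilon>" for t'
    proof -
      have "t' \<in> ball t \<delta>" using t' by (simp add: dist_commute)
      then have "flow x t' \<in> B" "\<bar>t' - t\<bar> \<le> \<epsilon>" "\<bar>t - t'\<bar> \<le> \<epsilon>"
        using t' d(2) by (auto simp: dist_real_def)
      then have "leaf_cont (t - t') (flow x t')" "leaf_cont (t' - t) (flow x t)" using B by blast+
      then show ?thesis
        using leaf_cont_add[OF x, of t' "t - t'"] leaf_cont_add[OF x, of t "t' - t"] by auto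
    qed
    moreover have "min \<delta> \<epsilon> > 0" using d(1) B(3) by simp
    ultimately show ?thesis by blast
  qed
  have "open ?S" "open (- ?S)"
    unfolding open_dist using key by (metis mem_Collect_eq, metis Compl_iff mem_Collect_eq)
  then have "closed ?S \<and> open ?S" by (simp only: closed_def)
  then have "?S = {} \<or> ?S = UNIV" by (simp only: clopen)
  then show ?thesis using 0 by auto
qed

text \<open>The flow is jointly continuous at time \<open>0\<close>, for the topology of the hypersurface.\<close>

lemma flow_near:
  assumes S: "openin T S" "z \<in> S"
  obtains N \<delta> where "openin T N" "z \<in> N" "\<delta> > 0" "\<forall>y\<in>N. \<forall>s. \<bar>s\<bar> < \<delta> \<longrightarrow> flow y s \<in> S"
proof -
  have zT: "z \<in> topspace T" using openin_subset[OF S(1)] S(2) by blast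
  obtain c U V \<rho> e \<epsilon> M B where fb: "adapted z c U V \<rho> e" "\<epsilon> > 0" "M > 0" "openin T B" "z \<in> B" "B \<subseteq> U"
    "flow_box c U e \<epsilon> M B"
    by (rule flow_box_exists[OF zT])
  note aD = adaptedD[OF fb(1)]
  obtain r where r: "r > 0" "ball (snd c z) r \<subseteq> snd c ` fst c" "{q\<in>U. dist (snd c q) (snd c z) < r} \<subseteq> S"
    by (rule slice_nhd[OF aD(1) S aD(3)])
  let ?N2 = "{q\<in>U. snd c q \<in> ball (snd c z) (r / 2)}"
  have "open (UNIV \<inter> flow z -` ?N2)"
    by (rule curve_open_preimage[OF _ open_UNIV adapted_openin[OF fb(1) open_ball]])
      (use integral_curveD(3)[OF flow(1)[OF zT]] in simp)
  moreover have "0 \<in> UNIV \<inter> flow z -` ?N2" using flow(2)[OF zT] aD(3) r(1) by simp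
  ultimately obtain \<delta> where "\<delta> > 0" "ball 0 \<delta> \<subseteq> UNIV \<inter> flow z -` ?N2"
    by (rule openE)
  then have d: "\<delta> > 0" "ball 0 \<delta> \<subseteq> flow z -` ?N2" by auto
  let ?N = "B \<inter> {q\<in>U. snd c q \<in> ball (snd c z) (r / (2 * M))}"
  have opN: "openin T ?N"
    by (intro openin_Int fb(4) adapted_openin[OF fb(1) open_ball])
  have zN: "z \<in> ?N" using fb(3,5) r(1) aD(3) by simp
  have "flow y s \<in> S" if yN: "y \<in> ?N" and s: "\<bar>s\<bar> < min \<delta> \<epsilon>" for y s
  proof -
    have yT: "y \<in> topspace T" using openin_subset[OF opN] yN by blast
    have i: "integral_curve (flow y)" "integral_curve (flow z)" "flow y 0 = y" "flow z 0 = z"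
      using flow[OF yT] flow[OF zT] by auto
    have "flow y s \<in> U" using flow_boxD(1)[OF fb(7), rule_format, of "flow y" 0 s] i yN s by auto
    moreover have "dist (snd c (flow y s)) (snd c (flow z s)) \<le> M * dist (snd c y) (snd c z)"
      using flow_boxD(2)[OF fb(7), rule_format, of "flow y" "flow z" 0 0 s] i yN zN s by simp
    moreover have "M * dist (snd c y) (snd c z) < r / 2"
      using yN fb(3) by (simp add: dist_commute field_simps)
    moreover have "dist (snd c (flow z s)) (snd c z) < r / 2"
    proof -
      have "s \<in> ball 0 \<delta>" using s by (simp add: dist_real_def)
      then show ?thesis using d(2) by (auto simp: dist_commute)
    qed
    ultimately have "dist (snd c (flow y s)) (snd c z) < r" "flow y s \<in> U"
      using dist_triangle[of "snd c (flow y s)" "snd c z" "snd c (flow z s)"] by auto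
    then show ?thesis using r(3) by auto
  qed
  then show ?thesis using that[OF opN zN, of "min \<delta> \<epsilon>"] d(1) fb(2) by auto
qed

lemma leaf_top_flow_continuous:
  "continuous_map (prod_topology euclideanreal leaf_top) T (\<lambda>(t, x). flow x t)"
  unfolding continuous_map_def
proof (intro conjI allI impI)
  show "(\<lambda>(t, x). flow x t) \<in> topspace (prod_topology euclideanreal leaf_top) \<rightarrow> topspace T"
    using flow(3) by auto
  fix S assume S: "openin T S"
  show "openin (prod_topology euclideanreal leaf_top) {p \<in> topspace (prod_topology euclideanreal leaf_top). (case p of (t, x) \<Rightarrow> flow x t) \<in> S}" (is "openin ?X ?R")
    unfolding openin_prod_topology_alt
  proof (intro allI impI)
    fix t0 x0 assume "(t0, x0) \<in> ?R"
    then have x0: "x0 \<in> topspace T" and zS: "flow x0 t0 \<in> S" by auto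
    obtain N \<delta> where N: "openin T N" "flow x0 t0 \<in> N" "\<delta> > 0" "\<forall>y\<in>N. \<forall>s. \<bar>s\<bar> < \<delta> \<longrightarrow> flow y s \<in> S"
      by (rule flow_near[OF S zS])
    obtain U0 where U0: "openin leaf_top U0" "x0 \<in> U0" "\<And>y. y \<in> U0 \<Longrightarrow> flow y t0 \<in> N"
      using leaf_cont_all[OF x0, of t0, unfolded leaf_cont_def, rule_format, OF conjI, OF openin_leaf_top_T[OF N(1)] N(2)] by blast
    have "flow y t \<in> S" if t: "t \<in> ball t0 \<delta>" and y: "y \<in> U0" for t y
    proof -
      have yT: "y \<in> topspace T" using openin_subset[OF U0(1)] y by auto
      have "\<bar>t - t0\<bar> < \<delta>" using t by (simp add: dist_real_def abs_minus_commute)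
      then have "flow (flow y t0) (t - t0) \<in> S" using N(4) U0(3)[OF y] by blast
      then show ?thesis using flow_add[OF yT, of t0 "t - t0"] by simp
    qed
    then show "\<exists>J U. openin euclideanreal J \<and> openin leaf_top U \<and> t0 \<in> J \<and> x0 \<in> U \<and> J \<times> U \<subseteq> ?R"
      using U0(1,2) N(3) openin_subset[OF U0(1)]
      by (intro exI[of _ "ball t0 \<delta>"] exI[of _ U0]) auto
  qed
qed

text \<open>The points reached from the leaf of \<open>p\<close> by the flow in time at most \<open>r\<close>, forwards or backwards.\<close>

definition tube :: "'a \<Rightarrow> real \<Rightarrow> 'a set" where
  "tube p r = (\<lambda>(t, x). flow x t) ` ({-r..r} \<times> leaf_set p)"

lemma compactin_tube:
  assumes p: "p \<in> topspace T"
  shows "compactin T (tube p r)"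
  unfolding tube_def
proof (rule image_compactin[OF _ leaf_top_flow_continuous])
  have "compact_space (subtopology leaf_top (leaf_set p))"
    by (rule compact_leaves[OF leaf_through[OF p]])
  then have "compactin leaf_top (leaf_set p)"
    using leaf_set_subset by (simp add: compactin_subspace)
  then show "compactin (prod_topology euclideanreal leaf_top) ({-r..r} \<times> leaf_set p)"
    by (simp add: compactin_Times)
qed

end


section \<open>Piecewise smooth paths and the rigged distance\<close>

text \<open>Induction from one point of a partition to the next.\<close>

lemma partition_induct:
  fixes K :: "real set"
  assumes K: "finite K" "a \<in> K" "\<And>k. k \<in> K \<Longrightarrow> a \<le> k" and base: "P a"
    and step: "\<And>s t. s \<in> K \<Longrightarrow> t \<in> K \<Longrightarrow> s < t \<Longrightarrow> {s<..<t} \<inter> K = {} \<Longrightarrow> P s \<Longrightarrow> P t"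
    and t: "t \<in> K"
  shows "P t"
  using t
proof (induction "card {k\<in>K. k < t}" arbitrary: t rule: less_induct)
  case less
  let ?L = "{k\<in>K. k < t}"
  have fin: "finite ?L" using K(1) by simp
  show ?case
  proof (cases "t = a")
    case False
    then have ne: "?L \<noteq> {}" using K(2,3) less.prems by force
    define s where "s = Max ?L"
    have s: "s \<in> K" "s < t" using Max_in[OF fin ne] by (auto simp: s_def)
    have emp: "{s<..<t} \<inter> K = {}"
      using Max_ge[OF fin] by (force simp: s_def)
    have "{k\<in>K. k < s} \<subset> ?L" using s by auto
    then have "card {k\<in>K. k < s} < card ?L" using fin by (rule psubset_card_mono[rotated])
    from step[OF s(1) less.prems s(2) emp less.hyps[OF this s(1)]] show ?thesis .
  qed (use base in simp)
qed

context atlas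
begin

lemma smooth_curve_subset:
  "smooth_curve A T J \<gamma> \<Longrightarrow> J' \<subseteq> J \<Longrightarrow> smooth_curve A T J' \<gamma>"
  unfolding smooth_curve_def
  by (auto intro: smooth_on_subset continuous_map_from_subtopology_mono)

lemma smooth_curve_affine:
  assumes "submanifold A k T" "open J" "smooth_curve A T J \<gamma>"
  shows "smooth_curve A T ((\<lambda>t. a * t + b) -` J) (\<lambda>t. \<gamma> (a * t + b))"
proof (rule smooth_curveI[OF ambient_curve_affine[OF smooth_curve_ambient(1)[OF assms]]])
  have "continuous_map (top_of_set ((\<lambda>t. a * t + b) -` J)) (top_of_set J) (\<lambda>t. a * t + b)"
    by (auto intro!: continuous_intros)
  from continuous_map_compose[OF this smooth_curve_ambient(2)[OF assms]]
  show "continuous_map (top_of_set ((\<lambda>t. a * t + b) -` J)) T (\<lambda>t. \<gamma> (a * t + b))"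
    by (simp add: o_def)
qed

lemma smooth_segment_affine:
  assumes T: "submanifold A k T" and g: "smooth_segment A T s t \<gamma>"
    and "\<And>x. x \<in> {s'..t'} \<Longrightarrow> a * x + b \<in> {s..t}" "\<And>x. x \<in> {s'..t'} \<Longrightarrow> \<gamma>' x = \<gamma> (a * x + b)"
  shows "smooth_segment A T s' t' \<gamma>'"
proof -
  obtain J \<eta> where J: "open J" "{s..t} \<subseteq> J" "smooth_curve A T J \<eta>" "\<And>r. r \<in> {s..t} \<Longrightarrow> \<gamma> r = \<eta> r"
    using g unfolding smooth_segment_def by blast
  have "open ((\<lambda>x. a * x + b) -` J)"
    by (rule open_vimage[OF J(1)]) (intro continuous_intros)
  then show ?thesis
    unfolding smooth_segment_def using assms(3,4) subsetD[OF J(2)] J(4) smooth_curve_affine[OF T J(1,3), of a b]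
    by (intro exI[of _ "(\<lambda>x. a * x + b) -` J"] exI[of _ "\<lambda>x. \<eta> (a * x + b)"]) auto
qed

text \<open>\<open>pw T K \<gamma>\<close>: the path \<open>\<gamma>\<close> is piecewise smooth with respect to the partition \<open>K\<close> of the unit interval.\<close>

definition pw :: "'a topology \<Rightarrow> real set \<Rightarrow> (real \<Rightarrow> 'a) \<Rightarrow> bool" where
  "pw T K \<gamma> \<longleftrightarrow> finite K \<and> {0, 1} \<subseteq> K \<and> K \<subseteq> {0..1} \<and>
     (\<forall>s\<in>K. \<forall>t\<in>K. s < t \<and> {s<..<t} \<inter> K = {} \<longrightarrow> smooth_segment A T s t \<gamma>)"

lemma piecewise_smooth_path_iff: "piecewise_smooth_path A T \<gamma> \<longleftrightarrow> (\<exists>K. pw T K \<gamma>)"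
  by (simp add: piecewise_smooth_path_def pw_def)

lemma pw_induct:
  assumes "pw T K \<gamma>" "P 0"
    and "\<And>s t. s \<in> {0..1} \<Longrightarrow> t \<in> {0..1} \<Longrightarrow> s < t \<Longrightarrow> smooth_segment A T s t \<gamma> \<Longrightarrow> P s \<Longrightarrow> P t"
  shows "P (1::real)"
proof (rule partition_induct[of K 0])
  show "P t" if "s \<in> K" "t \<in> K" "s < t" "{s<..<t} \<inter> K = {}" "P s" for s t
    by (rule assms(3)[of s t]) (use assms(1) that in \<open>auto simp: pw_def\<close>)
qed (use assms in \<open>auto simp: pw_def\<close>)

lemma pw_locally_smooth:
  assumes g: "pw T K \<gamma>" and t: "t \<in> {0..1} - K"
  obtains J \<eta> where "open J" "t \<in> J" "J \<subseteq> {0..1}" "smooth_curve A T J \<eta>" "\<And>s. s \<in> J \<Longrightarrow> \<gamma> s = \<eta> s"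
proof -
  have K: "finite K" "0 \<in> K" "1 \<in> K" "K \<subseteq> {0..1}"
    and seg: "\<And>s t. s \<in> K \<Longrightarrow> t \<in> K \<Longrightarrow> s < t \<Longrightarrow> {s<..<t} \<inter> K = {} \<Longrightarrow> smooth_segment A T s t \<gamma>"
    using g by (auto simp: pw_def)
  let ?L = "{k\<in>K. k < t}" and ?R = "{k\<in>K. t < k}"
  have t01: "0 < t" "t < 1" using t K by (auto simp: less_le)
  have fin: "finite ?L" "finite ?R" using K(1) by auto
  have ne: "?L \<noteq> {}" "?R \<noteq> {}" using K t01 by auto
  define a where "a = Max ?L"
  define b where "b = Min ?R"
  have a: "a \<in> K" "a < t" using Max_in[OF fin(1) ne(1)] by (auto simp: a_def)
  have b: "b \<in> K" "t < b" using Min_in[OF fin(2) ne(2)] by (auto simp: b_def)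
  have "k \<notin> K" if "k \<in> {a<..<b}" for k
  proof
    assume "k \<in> K"
    moreover have "k \<noteq> t" using t \<open>k \<in> K\<close> by auto
    ultimately have "k \<in> ?L \<or> k \<in> ?R" by auto
    then show False
      using Max_ge[OF fin(1), of k] Min_le[OF fin(2), of k] that by (auto simp: a_def b_def)
  qed
  then have "smooth_segment A T a b \<gamma>" using a b by (intro seg) auto
  then obtain J \<eta> where J: "open J" "{a..b} \<subseteq> J" "smooth_curve A T J \<eta>" "\<forall>r\<in>{a..b}. \<gamma> r = \<eta> r"
    unfolding smooth_segment_def by blast
  have "smooth_curve A T {a<..<b} \<eta>"
    by (rule smooth_curve_subset[OF J(3)]) (use J(2) in auto)
  then show ?thesis
    by (rule that[of "{a<..<b}" \<eta>, rotated 3]) (use a b J(4) subsetD[OF K(4) a(1)] subsetD[OF K(4) b(1)] in auto)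
qed

lemma pw_continuous:
  fixes f :: "'a \<Rightarrow> real"
  assumes g: "pw T K \<gamma>"
    and f: "\<And>J \<eta>. open J \<Longrightarrow> smooth_curve A T J \<eta> \<Longrightarrow> continuous_on J (f \<circ> \<eta>)"
  shows "continuous_on {0..1} (f \<circ> \<gamma>)"
proof (rule pw_induct[OF g, of "\<lambda>t. continuous_on {0..t} (f \<circ> \<gamma>)"])
  fix s t :: real
  assume st: "s \<in> {0..1}" "s < t" and seg: "smooth_segment A T s t \<gamma>" and c: "continuous_on {0..s} (f \<circ> \<gamma>)"
  obtain J \<eta> where J: "open J" "{s..t} \<subseteq> J" "smooth_curve A T J \<eta>" "\<forall>r\<in>{s..t}. \<gamma> r = \<eta> r"
    using seg unfolding smooth_segment_def by blast
  have "continuous_on {s..t} (f \<circ> \<eta>)" by (rule continuous_on_subset[OF f[OF J(1,3)] J(2)])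
  then have "continuous_on {s..t} (f \<circ> \<gamma>)"
    by (rule continuous_on_eq) (use J(4) in auto)
  then have "continuous_on ({0..s} \<union> {s..t}) (f \<circ> \<gamma>)"
    using c by (intro continuous_on_closed_Un) auto
  moreover have "{0..s} \<union> {s..t} = {0..t}" using st by auto
  ultimately show "continuous_on {0..t} (f \<circ> \<gamma>)" by simp
qed auto

lemma pw_join:
  assumes T: "submanifold A k T" and g1: "pw T K1 \<gamma>1" and g2: "pw T K2 \<gamma>2" and eq: "\<gamma>1 1 = \<gamma>2 0"
  shows "pw T ((\<lambda>k. k / 2) ` K1 \<union> (\<lambda>k. (k + 1) / 2) ` K2) (\<gamma>1 +++ \<gamma>2)" (is "pw T ?K _")
proof -
  have K1: "finite K1" "0 \<in> K1" "1 \<in> K1" "K1 \<subseteq> {0..1}" and K2: "finite K2" "0 \<in> K2" "1 \<in> K2" "K2 \<subseteq> {0..1}"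
    using g1 g2 by (auto simp: pw_def)
  have half: "1/2 \<in> ?K" using K1(3) by (auto simp: image_iff)
  have K1': "2 * x \<in> K1" if "x \<in> ?K" "x \<le> 1/2" for x
    using that K1 K2 by (auto simp: field_simps)
  have K2': "2 * x - 1 \<in> K2" if "x \<in> ?K" "x \<ge> 1/2" for x
    using that K1 K2 by (auto simp: field_simps)
  have "smooth_segment A T s t (\<gamma>1 +++ \<gamma>2)"
    if s: "s \<in> ?K" and t: "t \<in> ?K" and st: "s < t" and emp: "{s<..<t} \<inter> ?K = {}" for s t
  proof -
    have "1/2 \<notin> {s<..<t}" using half emp by blast
    then consider "t \<le> 1/2" | "s \<ge> 1/2" by fastforce
    then show ?thesis
    proof cases
      case 1
      have "k \<notin> K1" if "2 * s < k" "k < 2 * t" for k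
      proof
        assume "k \<in> K1"
        then have "k / 2 \<in> ?K" by blast
        moreover have "k / 2 \<in> {s<..<t}" using that by auto
        ultimately show False using emp by blast
      qed
      then have "{2 * s<..<2 * t} \<inter> K1 = {}" by auto
      moreover have "2 * s \<in> K1" "2 * t \<in> K1" using K1'[OF s] K1'[OF t] 1 st by auto
      ultimately have "smooth_segment A T (2 * s) (2 * t) \<gamma>1"
        using g1 st unfolding pw_def by auto
      then show ?thesis
        by (rule smooth_segment_affine[OF T, where a = 2 and b = 0]) (use 1 in \<open>auto simp: joinpaths_def\<close>)
    next
      case 2
      have "k \<notin> K2" if "2 * s - 1 < k" "k < 2 * t - 1" for k
      proof
        assume "k \<in> K2"
        then have "(k + 1) / 2 \<in> ?K" by blast
        moreover have "(k + 1) / 2 \<in> {s<..<t}" using that by auto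
        ultimately show False using emp by blast
      qed
      then have "{2 * s - 1<..<2 * t - 1} \<inter> K2 = {}" by auto
      moreover have "2 * s - 1 \<in> K2" "2 * t - 1 \<in> K2" using K2'[OF s] K2'[OF t] 2 st by auto
      ultimately have "smooth_segment A T (2 * s - 1) (2 * t - 1) \<gamma>2"
        using g2 st unfolding pw_def by auto
      then show ?thesis
      proof (rule smooth_segment_affine[OF T, where a = 2 and b = "-1"])
        fix x assume x: "x \<in> {s..t}"
        show "(\<gamma>1 +++ \<gamma>2) x = \<gamma>2 (2 * x + - 1)"
        proof (cases "x = 1/2")
          case True
          show ?thesis unfolding True using eq by (simp add: joinpaths_def)
        next
          case False
          then show ?thesis using x 2 by (auto simp: joinpaths_def)
        qed
      qed auto
    qed
  qed
  moreover have "0 \<in> ?K" "1 \<in> ?K" using K1(2) K2(3) by (auto simp: image_iff intro: bexI[of _ 1])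
  moreover have "?K \<subseteq> {0..1}" using K1(4) K2(4) by (auto simp: field_simps)
  ultimately show ?thesis using K1(1) K2(1) unfolding pw_def by auto
qed

lemma pw_reverse:
  assumes T: "submanifold A k T" and g: "pw T K \<gamma>"
  shows "pw T ((\<lambda>k. 1 - k) ` K) (reversepath \<gamma>)" (is "pw T ?K _")
proof -
  have K: "finite K" "0 \<in> K" "1 \<in> K" "K \<subseteq> {0..1}" using g by (auto simp: pw_def)
  have "smooth_segment A T s t (reversepath \<gamma>)"
    if s: "s \<in> ?K" and t: "t \<in> ?K" and st: "s < t" and emp: "{s<..<t} \<inter> ?K = {}" for s t
  proof -
    have "k \<notin> K" if "1 - t < k" "k < 1 - s" for k
    proof
      assume "k \<in> K"
      then have "1 - k \<in> ?K" by (rule imageI)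
      moreover have "1 - k \<in> {s<..<t}" using that by auto
      ultimately show False using emp by blast
    qed
    then have "{1 - t<..<1 - s} \<inter> K = {}" by auto
    moreover have "1 - t \<in> K" "1 - s \<in> K" using s t by auto
    ultimately have "smooth_segment A T (1 - t) (1 - s) \<gamma>"
      using g st unfolding pw_def by auto
    then show ?thesis
      by (rule smooth_segment_affine[OF T, where a = "-1" and b = 1]) (auto simp: reversepath_def)
  qed
  moreover have "0 \<in> ?K" "1 \<in> ?K" "?K \<subseteq> {0..1}" using K by (auto simp: image_iff)
  ultimately show ?thesis using K(1) unfolding pw_def by auto
qed

lemma pw_smooth:
  assumes "open J" "{0..1} \<subseteq> J" "smooth_curve A T J \<gamma>"
  shows "pw T {0, 1} \<gamma>"
proof -
  have "smooth_segment A T 0 1 \<gamma>" unfolding smooth_segment_def using assms by blast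
  then show ?thesis by (auto simp: pw_def)
qed

end

context null_normalization
begin

lemma h_scale:
  assumes p: "p \<in> W" and v: "v \<in> tangent_space A p"
  shows "h p (\<lambda>c. a *\<^sub>R v c) (\<lambda>c. a *\<^sub>R v c) = a\<^sup>2 * h p v v"
proof -
  obtain c where c: "c \<in> A" "p \<in> fst c" by (rule chart_around)
  have cm: "c \<in> max_atlas A" using c atlas_subset_max by auto
  obtain u where u: "v = coord_vec A c p u" by (rule tangent_space_coord_vec[OF cm c(2) v])
  note b = hc_bilinear[OF cm c(2) p]
  show ?thesis
    unfolding u coord_vec_scale[OF cm c(2)] hc_def[symmetric]
    using bilinear_lmul[OF b] bilinear_rmul[OF b] by (simp add: power2_eq_square)
qed

lemma curve_density_continuous:
  assumes J: "open J" and \<gamma>: "smooth_curve A T J \<gamma>"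
  shows "continuous_on J (\<lambda>t. \<omega> (\<gamma> t) (velocity A \<gamma> t))" "continuous_on J (speed \<gamma>)"
proof -
  note amb = smooth_curve_ambient[OF submfd J \<gamma>]
  have *: "isCont (\<lambda>t. \<omega> (\<gamma> t) (velocity A \<gamma> t)) t0 \<and> isCont (speed \<gamma>) t0" if t0: "t0 \<in> J" for t0
  proof -
    obtain c U V \<rho> e where a: "adapted (\<gamma> t0) c U V \<rho> e" by (rule adapted_exists[OF amb(3)[OF t0]])
    note aD = adaptedD[OF a]
    let ?J = "J \<inter> \<gamma> -` fst c"
    let ?y = "snd c \<circ> \<gamma>" and ?d = "\<lambda>t. frechet_derivative (snd c \<circ> \<gamma>) (at t) 1"
    have opJ: "open ?J" by (rule ambient_curve_open[OF amb(1) chartD(1)[OF aD(10)]])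
    have t0J: "t0 \<in> ?J" using t0 aD(3,12) by auto
    have sm: "smooth_on ?J ?y" by (rule ambient_curve_smooth[OF amb(1) aD(10)])
    have cd: "continuous_on ?J ?d" by (rule smooth_on_continuous[OF smooth_on_frechet[OF sm]])
    have cy: "continuous_on ?J ?y" by (rule smooth_on_continuous[OF sm])
    have vel: "velocity A \<gamma> t = coord_vec A c (\<gamma> t) (?d t)" if t: "t \<in> ?J" for t
    proof -
      note D = smooth_on_has_derivative[OF sm t]
      have "frechet_derivative ?y (at t) s = s *\<^sub>R ?d t" for s
        using linear_cmul[OF has_derivative_linear[OF D], of s 1] by simp
      then have "frechet_derivative ?y (at t) = (\<lambda>s. s *\<^sub>R ?d t)" by (rule ext)
      then have "(?y has_vector_derivative ?d t) (at t)"
        using D unfolding has_vector_derivative_def by metis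
      then show ?thesis
        using velocity_coord[OF ambient_curve_isCont[OF amb(1)] aD(10)] t by blast
    qed
    have bil: "bilinear (hc c (chart_inv c (?y t)))" if "t \<in> ?J" for t
      by (rule adapted_smooth(2)[OF a]) (use that aD(6) in auto)
    have base: "continuous_on ?J (\<lambda>t. hc c (chart_inv c (?y t)) u v)" for u v
      by (rule continuous_on_compose2[OF smooth_on_continuous[OF adapted_smooth(1)[OF a]] cy]) (use aD(6) in auto)
    have s1: "continuous_on ?J (\<lambda>t. hc c (chart_inv c (?y t)) u (?d t))" for u
      by (rule continuous_on_linear_family[where L = "\<lambda>t. hc c (chart_inv c (?y t)) u", OF _ base cd])
        (use bil in \<open>auto simp: bilinear_def\<close>)
    have "continuous_on ?J (\<lambda>t. hc c (chart_inv c (?y t)) (?d t) (?d t))"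
      by (rule continuous_on_linear_family[where L = "\<lambda>t u. hc c (chart_inv c (?y t)) u (?d t)", OF _ s1 cd])
        (use bil in \<open>auto simp: bilinear_def\<close>)
    then have "continuous_on ?J (\<lambda>t. sqrt (hc c (chart_inv c (?y t)) (?d t) (?d t)))"
      by (intro continuous_intros)
    then have c1: "continuous_on ?J (speed \<gamma>)"
      by (rule continuous_on_eq) (use vel chartD(5)[OF aD(10)] in \<open>auto simp: hc_def\<close>)
    have "continuous_on ?J (\<lambda>t. ?d t \<bullet> e)" by (intro continuous_intros cd)
    then have c2: "continuous_on ?J (\<lambda>t. \<omega> (\<gamma> t) (velocity A \<gamma> t))"
      by (rule continuous_on_eq) (use vel adapted_form[OF a] in \<open>auto simp: \<omega>c_def\<close>)
    show ?thesis using c1 c2 opJ t0J by (simp add: continuous_on_eq_continuous_at)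
  qed
  then show "continuous_on J (\<lambda>t. \<omega> (\<gamma> t) (velocity A \<gamma> t))" "continuous_on J (speed \<gamma>)"
    using J by (simp_all add: continuous_on_eq_continuous_at)
qed

lemma speed_cong:
  assumes "\<And>s. s \<in> S \<Longrightarrow> \<gamma> s = \<eta> s" "open S" "t \<in> S"
  shows "speed \<gamma> t = speed \<eta> t"
proof -
  have "velocity A \<gamma> t = velocity A \<eta> t" by (rule velocity_cong[OF assms])
  then show ?thesis using assms(1)[OF assms(3)] by simp
qed

lemma segment_speed_integrable:
  assumes "smooth_segment A T s t \<gamma>"
  shows "speed \<gamma> integrable_on {s..t}"
proof -
  obtain J \<eta> where J: "open J" "{s..t} \<subseteq> J" "smooth_curve A T J \<eta>" "\<forall>r\<in>{s..t}. \<gamma> r = \<eta> r"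
    using assms unfolding smooth_segment_def by blast
  have "speed \<eta> integrable_on cbox s t"
    using continuous_on_subset[OF curve_density_continuous(2)[OF J(1,3)] J(2)]
    by (simp add: integrable_continuous_interval)
  then have "speed \<gamma> integrable_on cbox s t"
    by (rule integrable_spike_interior[rotated]) (use speed_cong[of "{s<..<t}" \<gamma> \<eta>] J(4) in auto)
  then show ?thesis by simp
qed

lemma pw_speed_integrable:
  assumes g: "pw T K \<gamma>"
  shows "speed \<gamma> integrable_on {0..1}"
proof (rule pw_induct[OF g, of "\<lambda>t. speed \<gamma> integrable_on {0..t}"])
  fix s t :: real
  assume "s \<in> {0..1}" "s < t" "smooth_segment A T s t \<gamma>" "speed \<gamma> integrable_on {0..s}"
  then show "speed \<gamma> integrable_on {0..t}"
    by (intro Henstock_Kurzweil_Integration.integrable_combine[OF _ _ _ segment_speed_integrable, of 0 s t]) auto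
qed (use integrable_on_refl[of _ 0] in auto)

text \<open>A function whose derivative along curves is bounded by a multiple of the speed is Lipschitz
  with respect to the length of paths.\<close>

lemma pw_length_bound:
  fixes f :: "'a \<Rightarrow> real"
  assumes g: "pw T K \<gamma>"
    and f: "\<And>J \<eta> t. open J \<Longrightarrow> smooth_curve A T J \<eta> \<Longrightarrow> t \<in> J \<Longrightarrow>
      \<exists>D. ((f \<circ> \<eta>) has_real_derivative D) (at t) \<and> \<bar>D\<bar> \<le> C * speed \<eta> t"
  shows "\<bar>f (\<gamma> 1) - f (\<gamma> 0)\<bar> \<le> C * curve_length A h \<gamma>"
proof -
  have K: "finite K" using g by (simp add: pw_def)
  have cont: "continuous_on {0..1} (f \<circ> \<gamma>)"
  proof (rule pw_continuous[OF g])
    fix J \<eta> assume J: "open J" "smooth_curve A T J \<eta>"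
    have "isCont (f \<circ> \<eta>) t" if "t \<in> J" for t
      using f[OF J that] DERIV_isCont by blast
    then show "continuous_on J (f \<circ> \<eta>)" using continuous_at_imp_continuous_on by blast
  qed
  have "\<exists>D. ((f \<circ> \<gamma>) has_real_derivative D) (at t) \<and> \<bar>D\<bar> \<le> C * speed \<gamma> t" if t: "t \<in> {0..1} - K" for t
  proof -
    obtain J \<eta> where J: "open J" "t \<in> J" "J \<subseteq> {0..1}" "smooth_curve A T J \<eta>" "\<And>s. s \<in> J \<Longrightarrow> \<gamma> s = \<eta> s"
      using pw_locally_smooth[OF g t] by metis
    obtain D where D: "((f \<circ> \<eta>) has_real_derivative D) (at t)" "\<bar>D\<bar> \<le> C * speed \<eta> t"
      using f[OF J(1,4,2)] by blast
    have "((f \<circ> \<gamma>) has_real_derivative D) (at t)"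
      by (rule has_field_derivative_transform_within_open[OF D(1) J(1,2)]) (use J(5) in simp)
    moreover have "speed \<gamma> t = speed \<eta> t" by (rule speed_cong[of J]) (use J in auto)
    ultimately show ?thesis using D(2) by auto
  qed
  then obtain D where D: "\<And>t. t \<in> {0..1} - K \<Longrightarrow> ((f \<circ> \<gamma>) has_real_derivative D t) (at t)"
    "\<And>t. t \<in> {0..1} - K \<Longrightarrow> \<bar>D t\<bar> \<le> C * speed \<gamma> t"
    by metis
  have int: "(D has_integral ((f \<circ> \<gamma>) 1 - (f \<circ> \<gamma>) 0)) {0..1}"
    by (rule fundamental_theorem_of_calculus_strong[OF K _ _ cont])
      (use D(1) in \<open>auto simp: has_real_derivative_iff_has_vector_derivative\<close>)
  let ?D = "\<lambda>t. if t \<in> K then 0 else D t" and ?s = "\<lambda>t. if t \<in> K then 0 else C * speed \<gamma> t"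
  have i1: "(?D has_integral ((f \<circ> \<gamma>) 1 - (f \<circ> \<gamma>) 0)) {0..1}"
    by (rule has_integral_spike_finite[OF K _ int]) auto
  have "((\<lambda>t. C * speed \<gamma> t) has_integral C * curve_length A h \<gamma>) {0..1}"
    unfolding curve_length_def using pw_speed_integrable[OF g]
    by (intro has_integral_mult_right integrable_integral)
  then have i2: "(?s has_integral C * curve_length A h \<gamma>) {0..1}"
    by (rule has_integral_spike_finite[OF K, rotated]) auto
  have "(f \<circ> \<gamma>) 1 - (f \<circ> \<gamma>) 0 \<le> C * curve_length A h \<gamma>"
    by (rule has_integral_le[OF i1 i2]) (use D(2) in \<open>auto simp: abs_le_iff\<close>)
  moreover have "- ((f \<circ> \<gamma>) 1 - (f \<circ> \<gamma>) 0) \<le> C * curve_length A h \<gamma>"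
    by (rule has_integral_le[OF has_integral_neg[OF i1] i2]) (use D(2) in \<open>auto simp: abs_le_iff\<close>)
  ultimately show ?thesis by (simp add: abs_le_iff)
qed

lemma speed_nonneg:
  assumes "open J" "smooth_curve A T J \<gamma>" "t \<in> J"
  shows "0 \<le> speed \<gamma> t"
  using rigged_metric_nonneg[OF smooth_curve_ambient(3)[OF submfd assms] smooth_curve_velocity_tangent[OF submfd assms]]
  by (meson abs_ge_zero order_trans)

lemma pw_length_nonneg:
  assumes "pw T K \<gamma>"
  shows "0 \<le> curve_length A h \<gamma>"
proof -
  have "\<bar>(\<lambda>_. 0) (\<gamma> 1) - (\<lambda>_. 0) (\<gamma> 0)\<bar> \<le> 1 * curve_length A h \<gamma>"
  proof (rule pw_length_bound[OF assms])
    fix J \<eta> and t :: real assume "open J" "smooth_curve A T J \<eta>" "t \<in> J"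
    then show "\<exists>D. ((\<lambda>_. 0) \<circ> \<eta> has_real_derivative D) (at t) \<and> \<bar>D\<bar> \<le> 1 * speed \<eta> t"
      using speed_nonneg by (intro exI[of _ 0]) (simp add: o_def)
  qed
  then show ?thesis by simp
qed

text \<open>The length of a path reparametrized affinely from \<open>{u..v}\<close> onto the unit interval. It is used for
  concatenation and for reversal.\<close>

lemma pw_length_affine:
  assumes g: "pw T K \<gamma>" and a: "a \<noteq> 0" and eq: "\<And>x. x \<in> {u..v} \<Longrightarrow> \<gamma>' x = \<gamma> (a * x + b)"
    and img: "(\<lambda>x. (1 / a) *\<^sub>R x + - ((1 / a) *\<^sub>R b)) ` cbox 0 1 = {u..v}"
  shows "(speed \<gamma>' has_integral curve_length A h \<gamma>) {u..v}"
proof -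
  have "(speed \<gamma> has_integral curve_length A h \<gamma>) (cbox 0 1)"
    unfolding curve_length_def using pw_speed_integrable[OF g] by (simp add: integrable_integral)
  from has_integral_mult_right[OF has_integral_affinity[OF this a, of b], of "\<bar>a\<bar>"]
  have i: "((\<lambda>x. \<bar>a\<bar> * speed \<gamma> (a * x + b)) has_integral curve_length A h \<gamma>) {u..v}"
    unfolding img using a by simp
  let ?S = "{u, v} \<union> (\<lambda>k. (k - b) / a) ` K"
  have "finite ?S" using g by (simp add: pw_def)
  then show ?thesis
  proof (rule has_integral_spike_finite[OF _ _ i])
    fix x assume x: "x \<in> {u..v} - ?S"
    let ?t = "a * x + b"
    have "x \<in> (\<lambda>x. (1 / a) *\<^sub>R x + - ((1 / a) *\<^sub>R b)) ` cbox 0 1" using img x by blast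
    then have "?t \<in> {0..1}" using a by (auto simp: field_simps)
    moreover have "?t \<notin> K"
    proof
      assume "?t \<in> K"
      then have "(?t - b) / a \<in> ?S" by blast
      then show False using x a by simp
    qed
    ultimately have t: "?t \<in> {0..1} - K" by blast
    obtain J \<eta> where J: "open J" "?t \<in> J" "J \<subseteq> {0..1}" "smooth_curve A T J \<eta>" "\<And>s. s \<in> J \<Longrightarrow> \<gamma> s = \<eta> s"
      using pw_locally_smooth[OF g t] by metis
    note amb = smooth_curve_ambient[OF submfd J(1,4)]
    let ?J = "{u<..<v} \<inter> (\<lambda>x. a * x + b) -` J"
    have "open ((\<lambda>x. a * x + b) -` J)"
      by (rule open_vimage[OF J(1)]) (intro continuous_intros)
    then have "open ?J" by (rule open_Int[OF open_greaterThanLessThan])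
    then have "speed \<gamma>' x = speed (\<lambda>x. \<eta> (a * x + b)) x"
      by (rule speed_cong[rotated]) (use x J eq in auto)
    also have "\<dots> = sqrt (a\<^sup>2 * h (\<eta> ?t) (velocity A \<eta> ?t) (velocity A \<eta> ?t))"
    proof -
      have T: "\<eta> ?t \<in> topspace T" by (rule amb(3)[OF J(2)])
      have "velocity A \<eta> ?t \<in> tangent_space A (\<eta> ?t)"
        by (rule sub_tangent_space_tangent[OF submfd T smooth_curve_velocity_tangent[OF submfd J(1,4,2)]])
      then show ?thesis
        unfolding velocity_affine[OF amb(1) J(2)] using h_scale TW T by auto
    qed
    also have "\<dots> = \<bar>a\<bar> * speed \<eta> ?t" by (simp add: real_sqrt_mult)
    also have "speed \<eta> ?t = speed \<gamma> ?t" by (rule speed_cong[of J]) (use J in auto)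
    finally show "speed \<gamma>' x = \<bar>a\<bar> * speed \<gamma> (a * x + b)" .
  qed
qed

lemma length_join:
  assumes g1: "pw T K1 \<gamma>1" and g2: "pw T K2 \<gamma>2" and eq: "\<gamma>1 1 = \<gamma>2 0"
  shows "curve_length A h (\<gamma>1 +++ \<gamma>2) = curve_length A h \<gamma>1 + curve_length A h \<gamma>2"
proof -
  have "(speed (\<gamma>1 +++ \<gamma>2) has_integral curve_length A h \<gamma>1) {0..1/2}"
    by (rule pw_length_affine[OF g1, of 2 _ _ _ 0])
      (auto simp: joinpaths_def image_iff intro!: bexI[of _ "2 * x" for x])
  moreover have "(speed (\<gamma>1 +++ \<gamma>2) has_integral curve_length A h \<gamma>2) {1/2..1}"
  proof (rule pw_length_affine[OF g2, of 2 _ _ _ "-1"])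
    show "(\<gamma>1 +++ \<gamma>2) x = \<gamma>2 (2 * x + - 1)" if "x \<in> {1/2..1}" for x
    proof (cases "x = 1/2")
      case True
      show ?thesis unfolding True using eq by (simp add: joinpaths_def)
    next
      case False
      then show ?thesis using that by (auto simp: joinpaths_def)
    qed
    show "(\<lambda>x::real. (1 / 2) *\<^sub>R x + - ((1 / 2) *\<^sub>R - 1)) ` cbox 0 1 = {1/2..1}"
      by (auto simp: image_iff field_simps intro!: bexI[of _ "2 * x - 1" for x])
  qed simp
  ultimately have "(speed (\<gamma>1 +++ \<gamma>2) has_integral (curve_length A h \<gamma>1 + curve_length A h \<gamma>2)) {0..1}"
    by (rule has_integral_combine[rotated 2]) auto
  then show ?thesis unfolding curve_length_def[of A h "\<gamma>1 +++ \<gamma>2"] by (rule integral_unique)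
qed

lemma length_reverse:
  assumes g: "pw T K \<gamma>"
  shows "curve_length A h (reversepath \<gamma>) = curve_length A h \<gamma>"
proof -
  have "(speed (reversepath \<gamma>) has_integral curve_length A h \<gamma>) {0..1}"
    by (rule pw_length_affine[OF g, of "-1" _ _ _ 1])
      (auto simp: reversepath_def image_iff intro!: bexI[of _ "1 - x" for x])
  then show ?thesis unfolding curve_length_def[of A h "reversepath \<gamma>"] by (rule integral_unique)
qed

text \<open>Straight segments in adapted charts.\<close>

lemma adapted_segment:
  assumes a: "adapted p c U V \<rho> e"
  obtains C where "C > 0" "\<And>q q'. q \<in> U \<Longrightarrow> norm (snd c q) < \<rho> / 2 \<Longrightarrow> q' \<in> U \<Longrightarrow> norm (snd c q') < \<rho> / 2 \<Longrightarrow>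
    \<exists>\<gamma>. pw T {0, 1} \<gamma> \<and> \<gamma> 0 = q \<and> \<gamma> 1 = q' \<and> curve_length A h \<gamma> \<le> C * dist (snd c q) (snd c q')"
proof -
  note aD = adaptedD[OF a]
  have r: "0 \<le> \<rho> / 2" "\<rho> / 2 < \<rho>" using aD(5) by auto
  obtain m C where mC: "m > 0" "C > 0"
    "\<And>q u. q \<in> U \<Longrightarrow> norm (snd c q) \<le> \<rho> / 2 \<Longrightarrow> u \<in> V \<Longrightarrow> m * (norm u)\<^sup>2 \<le> hc c q u u \<and> hc c q u u \<le> C * (norm u)\<^sup>2"
    using adapted_bounds[OF a r] by metis
  have "\<exists>\<gamma>. pw T {0, 1} \<gamma> \<and> \<gamma> 0 = q \<and> \<gamma> 1 = q' \<and> curve_length A h \<gamma> \<le> sqrt C * dist (snd c q) (snd c q')"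
    if q: "q \<in> U" "norm (snd c q) < \<rho> / 2" and q': "q' \<in> U" "norm (snd c q') < \<rho> / 2" for q q'
  proof -
    let ?u = "snd c q' - snd c q"
    let ?B = "ball (0::'e) (\<rho> / 2)"
    have V: "snd c q \<in> V" "?u \<in> V"
      using q q' aD(11,15) by (auto intro: subspace_diff)
    have B: "?B \<subseteq> snd c ` fst c" using aD(5,6) by auto
    define y where "y = (\<lambda>t::real. snd c q + t *\<^sub>R ?u)"
    note l = slice_affine[OF aD(1) V open_ball B, folded y_def]
    let ?J = "y -` ?B" and ?\<gamma> = "chart_inv c \<circ> y"
    have J: "{0..1} \<subseteq> ?J"
    proof
      fix t :: real assume t: "t \<in> {0..1}"
      have "(1 - t) *\<^sub>R snd c q + t *\<^sub>R snd c q' \<in> ?B"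
        using t q q' by (intro convexD[OF convex_ball]) auto
      then show "t \<in> ?J" by (simp add: y_def algebra_simps)
    qed
    have pw: "pw T {0, 1} ?\<gamma>" by (rule pw_smooth[OF l(1) J l(2)])
    have ends: "?\<gamma> 0 = q" "?\<gamma> 1 = q'"
      using chartD(5)[OF aD(10)] q q' aD(12) by (auto simp: y_def)
    have sp: "speed ?\<gamma> t \<le> sqrt C * norm ?u" if t: "t \<in> {0..1}" for t
    proof -
      have tJ: "t \<in> ?J" using t J by blast
      have "norm (snd c (chart_inv c (y t))) \<le> \<rho> / 2" using l(4)[OF tJ] tJ by (simp add: y_def)
      then have "hc c (chart_inv c (y t)) ?u ?u \<le> C * (norm ?u)\<^sup>2"
        using mC(3)[OF l(3)[OF tJ] _ V(2)] by (simp add: y_def)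
      then have "speed ?\<gamma> t \<le> sqrt (C * (norm ?u)\<^sup>2)"
        using l(5)[OF tJ] by (simp add: hc_def y_def)
      then show ?thesis by (simp add: real_sqrt_mult)
    qed
    have "curve_length A h ?\<gamma> \<le> integral {0..1} (\<lambda>t::real. sqrt C * norm ?u)"
      unfolding curve_length_def by (rule integral_le[OF pw_speed_integrable[OF pw]]) (use sp in auto)
    then have "curve_length A h ?\<gamma> \<le> sqrt C * dist (snd c q) (snd c q')"
      by (simp add: dist_norm norm_minus_commute)
    then show ?thesis using pw ends by blast
  qed
  then show ?thesis using that[of "sqrt C"] mC(2) by simp
qed

text \<open>The piecewise smooth paths from \<open>p\<close> to \<open>q\<close>, over which the rigged distance is the infimum of
  the lengths.\<close>

definition paths :: "'a \<Rightarrow> 'a \<Rightarrow> (real \<Rightarrow> 'a) set" where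
  "paths p q = {\<gamma>. piecewise_smooth_path A T \<gamma> \<and> \<gamma> 0 = p \<and> \<gamma> 1 = q}"

abbreviation dst :: "'a \<Rightarrow> 'a \<Rightarrow> real" where "dst \<equiv> riemannian_distance A T h"

lemma pathsE:
  assumes "\<gamma> \<in> paths p q"
  obtains K where "pw T K \<gamma>" "\<gamma> 0 = p" "\<gamma> 1 = q"
  using assms by (auto simp: paths_def piecewise_smooth_path_iff)

lemma pathsI: "pw T K \<gamma> \<Longrightarrow> \<gamma> 0 = p \<Longrightarrow> \<gamma> 1 = q \<Longrightarrow> \<gamma> \<in> paths p q"
  by (auto simp: paths_def piecewise_smooth_path_iff)

lemma paths_length_nonneg: "\<gamma> \<in> paths p q \<Longrightarrow> 0 \<le> curve_length A h \<gamma>"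
  by (metis pathsE pw_length_nonneg)

lemma paths_join:
  assumes "\<gamma>1 \<in> paths p q" "\<gamma>2 \<in> paths q r"
  shows "\<gamma>1 +++ \<gamma>2 \<in> paths p r" "curve_length A h (\<gamma>1 +++ \<gamma>2) = curve_length A h \<gamma>1 + curve_length A h \<gamma>2"
proof -
  obtain K1 where 1: "pw T K1 \<gamma>1" "\<gamma>1 0 = p" "\<gamma>1 1 = q" by (rule pathsE[OF assms(1)])
  obtain K2 where 2: "pw T K2 \<gamma>2" "\<gamma>2 0 = q" "\<gamma>2 1 = r" by (rule pathsE[OF assms(2)])
  show "\<gamma>1 +++ \<gamma>2 \<in> paths p r"
    by (rule pathsI[OF pw_join[OF submfd 1(1) 2(1)]]) (use 1 2 in \<open>auto simp: joinpaths_def\<close>)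
  show "curve_length A h (\<gamma>1 +++ \<gamma>2) = curve_length A h \<gamma>1 + curve_length A h \<gamma>2"
    by (rule length_join[OF 1(1) 2(1)]) (use 1 2 in simp)
qed

lemma paths_reverse:
  assumes "\<gamma> \<in> paths p q"
  shows "reversepath \<gamma> \<in> paths q p" "curve_length A h (reversepath \<gamma>) = curve_length A h \<gamma>"
proof -
  obtain K where 1: "pw T K \<gamma>" "\<gamma> 0 = p" "\<gamma> 1 = q" by (rule pathsE[OF assms(1)])
  show "reversepath \<gamma> \<in> paths q p"
    by (rule pathsI[OF pw_reverse[OF submfd 1(1)]]) (use 1 in \<open>auto simp: reversepath_def\<close>)
  show "curve_length A h (reversepath \<gamma>) = curve_length A h \<gamma>" by (rule length_reverse[OF 1(1)])
qed

lemma distance_eq: "dst p q = (if paths p q = {} then 0 else Inf (curve_length A h ` paths p q))"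
  unfolding riemannian_distance_def paths_def Let_def by (rule refl)

lemma distance_le:
  assumes "\<gamma> \<in> paths p q"
  shows "dst p q \<le> curve_length A h \<gamma>"
proof -
  have "bdd_below (curve_length A h ` paths p q)"
    using paths_length_nonneg by (intro bdd_belowI[of _ 0]) auto
  then show ?thesis
    unfolding distance_eq using assms by (auto intro: cINF_lower)
qed

lemma distance_approx:
  assumes "paths p q \<noteq> {}" "dst p q < r"
  obtains \<gamma> where "\<gamma> \<in> paths p q" "curve_length A h \<gamma> < r"
proof -
  have "Inf (curve_length A h ` paths p q) < r"
    using assms by (simp add: distance_eq)
  then show ?thesis
    using that cInf_lessD[of "curve_length A h ` paths p q" r] assms(1) by auto
qed

lemma distance_nonneg: "0 \<le> dst p q"
  unfolding distance_eq using paths_length_nonneg by (auto intro!: cINF_greatest)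

lemma distance_commute: "dst p q = dst q p"
proof -
  have *: "curve_length A h ` paths p q \<subseteq> curve_length A h ` paths q p" for p q
    using paths_reverse by (metis (no_types, lifting) image_eqI image_subsetI)
  then have "curve_length A h ` paths p q = curve_length A h ` paths q p" by blast
  moreover from this have "paths p q = {} \<longleftrightarrow> paths q p = {}" by blast
  ultimately show ?thesis by (simp add: distance_eq)
qed

text \<open>The distance balls around \<open>x\<close> contain neighbourhoods of \<open>x\<close> in the hypersurface.\<close>

lemma distance_nhd:
  assumes x: "x \<in> topspace T" and "0 < r"
  obtains N where "openin T N" "x \<in> N" "\<forall>y\<in>N. paths x y \<noteq> {} \<and> dst x y < r"
proof -
  obtain c U V \<rho> e where a: "adapted x c U V \<rho> e" by (rule adapted_exists[OF x])
  note aD = adaptedD[OF a]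
  obtain C where C: "C > 0" "\<And>q q'. q \<in> U \<Longrightarrow> norm (snd c q) < \<rho> / 2 \<Longrightarrow> q' \<in> U \<Longrightarrow> norm (snd c q') < \<rho> / 2 \<Longrightarrow>
    \<exists>\<gamma>. pw T {0, 1} \<gamma> \<and> \<gamma> 0 = q \<and> \<gamma> 1 = q' \<and> curve_length A h \<gamma> \<le> C * dist (snd c q) (snd c q')"
    using adapted_segment[OF a] by metis
  let ?N = "{q\<in>U. snd c q \<in> ball 0 (min (\<rho> / 2) (r / C))}"
  have "paths x y \<noteq> {} \<and> dst x y < r" if y: "y \<in> ?N" for y
  proof -
    have "\<exists>\<gamma>. pw T {0, 1} \<gamma> \<and> \<gamma> 0 = x \<and> \<gamma> 1 = y \<and> curve_length A h \<gamma> \<le> C * dist (snd c x) (snd c y)"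
      by (rule C(2)) (use aD y in auto)
    then obtain \<gamma> where \<gamma>: "\<gamma> \<in> paths x y" "curve_length A h \<gamma> \<le> C * dist (snd c x) (snd c y)"
      using pathsI by blast
    have "C * dist (snd c x) (snd c y) < r" using y aD(4) C(1) by (simp add: field_simps)
    then show ?thesis using \<gamma> distance_le[OF \<gamma>(1)] by auto
  qed
  then show ?thesis
    by (intro that[of ?N] adapted_openin[OF a open_ball] ballI) (use aD(3,4,5) C(1) assms(2) in auto)
qed

lemma paths_self: "x \<in> topspace T \<Longrightarrow> paths x x \<noteq> {}"
  using distance_nhd[of x 1] by (metis zero_less_one)

lemma paths_connected:
  assumes conn: "connected_space T" and p: "p \<in> topspace T" and q: "q \<in> topspace T"
  shows "paths p q \<noteq> {}"
proof -
  let ?R = "{q \<in> topspace T. paths p q \<noteq> {}}"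
  have nh: "\<exists>N. openin T N \<and> x \<in> N \<and> (\<forall>y\<in>N. paths p y \<noteq> {} \<longleftrightarrow> paths p x \<noteq> {})" if x: "x \<in> topspace T" for x
  proof -
    obtain N where N: "openin T N" "x \<in> N" "\<forall>y\<in>N. paths x y \<noteq> {} \<and> dst x y < 1"
      by (rule distance_nhd[OF x zero_less_one])
    have "paths p y \<noteq> {} \<longleftrightarrow> paths p x \<noteq> {}" if "y \<in> N" for y
    proof -
      have "paths x y \<noteq> {}" using bspec[OF N(3) that] by (rule conjunct1)
      then obtain \<gamma> where \<gamma>: "\<gamma> \<in> paths x y" by (meson ex_in_conv)
      show ?thesis using paths_join(1)[OF _ \<gamma>] paths_join(1)[OF _ paths_reverse(1)[OF \<gamma>]] by blast
    qed
    then show ?thesis using N by blast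
  qed
  have "openin T ?R"
  proof (subst openin_subopen, intro ballI)
    fix x assume x: "x \<in> ?R"
    then obtain N where N: "openin T N" "x \<in> N" "\<forall>y\<in>N. paths p y \<noteq> {} \<longleftrightarrow> paths p x \<noteq> {}" using nh[of x] by blast
    have "N \<subseteq> ?R" using N(3) x openin_subset[OF N(1)] by blast
    then show "\<exists>N. openin T N \<and> x \<in> N \<and> N \<subseteq> ?R" using N by blast
  qed
  moreover have "openin T (topspace T - ?R)"
  proof (subst openin_subopen, intro ballI)
    fix x assume x: "x \<in> topspace T - ?R"
    then obtain N where N: "openin T N" "x \<in> N" "\<forall>y\<in>N. paths p y \<noteq> {} \<longleftrightarrow> paths p x \<noteq> {}" using nh[of x] by blast
    have "N \<subseteq> topspace T - ?R" using N(3) x openin_subset[OF N(1)] by blast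
    then show "\<exists>N. openin T N \<and> x \<in> N \<and> N \<subseteq> topspace T - ?R" using N by blast
  qed
  then have "closedin T ?R" unfolding closedin_def by blast
  ultimately have "?R = {} \<or> ?R = topspace T"
    using conn unfolding connected_space_clopen_in by blast
  moreover have "p \<in> ?R" using p paths_self by blast
  ultimately show ?thesis using q by blast
qed

text \<open>Distinct points are separated by a bump function, whose Lipschitz property bounds the lengths
  of the paths between them from below.\<close>

lemma distance_zero:
  assumes conn: "connected_space T" and p: "p \<in> topspace T" and q: "q \<in> topspace T"
  shows "dst p q = 0 \<longleftrightarrow> p = q"
proof
  assume "p = q"
  have "dst p p < r" if "0 < r" for r
    using distance_nhd[OF p that] by metis
  then have "\<not> 0 < dst p p" by blast
  then show "dst p q = 0" using distance_nonneg[of p p] \<open>p = q\<close> by simp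
next
  assume d: "dst p q = 0"
  show "p = q"
  proof (rule ccontr)
    assume ne: "p \<noteq> q"
    obtain c U V \<rho> e where a: "adapted p c U V \<rho> e" by (rule adapted_exists[OF p])
    note aD = adaptedD[OF a]
    \<comment> \<open>The radius is chosen so that the bump around \<open>p\<close> vanishes at \<open>q\<close>.\<close>
    define r where "r = (if q \<in> U then min (norm (snd c q)) (\<rho> / 2) else \<rho> / 2)"
    have "snd c q \<noteq> 0" if "q \<in> U"
      using inj_onD[OF chartD(8)[OF aD(10)], of q p] that ne aD(3,4,12) by auto
    then have r: "0 < r" "r < \<rho>" using aD(5) by (auto simp: r_def)
    note bp = bump_properties[OF a r]
    have "\<not> bump c U r q > 0" unfolding bp(2) by (auto simp: r_def)
    then have q0: "bump c U r q = 0" using bp(3)[of q] by simp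
    obtain C where C: "C > 0" "\<And>J \<gamma> t. open J \<Longrightarrow> smooth_curve A T J \<gamma> \<Longrightarrow> t \<in> J \<Longrightarrow>
      \<exists>D. ((bump c U r \<circ> \<gamma>) has_real_derivative D) (at t) \<and> \<bar>D\<bar> \<le> C * speed \<gamma> t"
      using bump_derivative[OF a r] by metis
    have "dst p q < 1 / C" using d C(1) by simp
    then obtain \<gamma> where \<gamma>: "\<gamma> \<in> paths p q" "curve_length A h \<gamma> < 1 / C"
      by (rule distance_approx[OF paths_connected[OF conn p q]])
    obtain K where K: "pw T K \<gamma>" "\<gamma> 0 = p" "\<gamma> 1 = q" by (rule pathsE[OF \<gamma>(1)])
    have "\<bar>bump c U r (\<gamma> 1) - bump c U r (\<gamma> 0)\<bar> \<le> C * curve_length A h \<gamma>"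
      by (rule pw_length_bound[OF K(1) C(2)])
    then have "1 \<le> C * curve_length A h \<gamma>" using K(2,3) q0 bp(1) by simp
    then show False using \<gamma>(2) C(1) by (simp add: field_simps)
  qed
qed

lemma distance_metric_space:
  assumes conn: "connected_space T"
  shows "Metric_space (topspace T) dst"
proof
  show "0 \<le> dst x y" for x y by (rule distance_nonneg)
  show "dst x y = dst y x" for x y by (rule distance_commute)
  show "dst x y = 0 \<longleftrightarrow> x = y" if "x \<in> topspace T" "y \<in> topspace T" for x y
    by (rule distance_zero[OF conn that])
  fix x y z assume x: "x \<in> topspace T" and y: "y \<in> topspace T" and z: "z \<in> topspace T"
  show "dst x z \<le> dst x y + dst y z"
  proof (rule field_le_epsilon)
    fix r :: real assume "0 < r"
    then have "dst x y < dst x y + r / 2" "dst y z < dst y z + r / 2" by auto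
    obtain \<gamma>1 where 1: "\<gamma>1 \<in> paths x y" "curve_length A h \<gamma>1 < dst x y + r / 2"
      by (rule distance_approx[OF paths_connected[OF conn x y] \<open>dst x y < dst x y + r / 2\<close>])
    obtain \<gamma>2 where 2: "\<gamma>2 \<in> paths y z" "curve_length A h \<gamma>2 < dst y z + r / 2"
      by (rule distance_approx[OF paths_connected[OF conn y z] \<open>dst y z < dst y z + r / 2\<close>])
    have "dst x z \<le> curve_length A h (\<gamma>1 +++ \<gamma>2)"
      by (rule distance_le[OF paths_join(1)[OF 1(1) 2(1)]])
    then show "dst x z \<le> dst x y + dst y z + r"
      using paths_join(2)[OF 1(1) 2(1)] 1(2) 2(2) by linarith
  qed
qed

end


section \<open>Balls lie in compact tubes around leaves\<close>

lemma compactin_cluster_point: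
  assumes K: "compactin X K" and \<sigma>: "\<And>n. n \<ge> n0 \<Longrightarrow> \<sigma> n \<in> K"
  obtains x where "x \<in> K" "\<forall>S. openin X S \<longrightarrow> x \<in> S \<longrightarrow> infinite {n::nat. \<sigma> n \<in> S}"
proof (rule ccontr)
  assume no: "\<not> thesis"
  let ?U = "{S. openin X S \<and> finite {n. \<sigma> n \<in> S}}"
  have "K \<subseteq> \<Union>?U" using no that by blast
  then obtain \<F> where F: "finite \<F>" "\<F> \<subseteq> ?U" "K \<subseteq> \<Union>\<F>"
    using K unfolding compactin_def by (metis (no_types, lifting) mem_Collect_eq)
  have "{n0..} \<subseteq> (\<Union>S\<in>\<F>. {n. \<sigma> n \<in> S})" using \<sigma> F(3) by fastforce
  moreover have "finite (\<Union>S\<in>\<F>. {n. \<sigma> n \<in> S})" using F(1,2) by blast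
  ultimately show False using finite_subset infinite_Ici by blast
qed

context complete_normalization
begin

text \<open>Moving the points of a curve back along the flow, by the integral of \<open>\<omega>\<close> along the curve, yields a
  curve in a single leaf.\<close>

lemma transport_along_curve:
  assumes J: "open J" "{a..b} \<subseteq> J" and \<eta>: "smooth_curve A T J \<eta>" and ab: "a \<le> b"
  obtains \<sigma> where "\<bar>\<sigma>\<bar> \<le> integral {a..b} (speed \<eta>)"
    "\<forall>\<tau>. flow (\<eta> a) \<tau> \<in> leaf_set p \<longrightarrow> flow (\<eta> b) (\<tau> - \<sigma>) \<in> leaf_set p"
proof -
  note amb = smooth_curve_ambient[OF submfd J(1) \<eta>]
  define w where "w s = \<omega> (\<eta> s) (velocity A \<eta> s)" for s
  define \<sigma> where "\<sigma> s = integral {a..s} w" for s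
  have contw: "continuous_on {a..b} w"
    unfolding w_def by (rule continuous_on_subset[OF curve_density_continuous(1)[OF J(1) \<eta>] J(2)])
  have d\<sigma>: "(\<sigma> has_real_derivative w s) (at s within {a..b})" if "s \<in> {a..b}" for s
    unfolding \<sigma>_def[abs_def] by (rule integral_has_real_derivative[OF contw that])
  have cont\<sigma>: "continuous_on {a..b} \<sigma>"
    using d\<sigma> DERIV_continuous_on by blast
  have inT: "\<eta> s \<in> topspace T" if "s \<in> {a..b}" for s
    using amb(3) J(2) that by blast
  \<comment> \<open>The flow for the time \<open>\<sigma> s0 - \<sigma> s\<close> cancels the change of the primitive along the curve, so the
    moved points stay in the plaque of \<open>\<eta> s0\<close>.\<close>
  have near: "\<exists>\<delta>>0. \<forall>s\<in>{a..b}. dist s s0 < \<delta> \<longrightarrow> flow (\<eta> s) (\<sigma> s0 - \<sigma> s) \<in> S"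
    if s0: "s0 \<in> {a..b}" and S: "openin leaf_top S" "\<eta> s0 \<in> S" for s0 S
  proof -
    let ?z = "\<eta> s0"
    obtain c U V \<rho> e \<epsilon> M B where fb: "adapted ?z c U V \<rho> e" "\<epsilon> > 0" "M > 0" "openin T B" "?z \<in> B" "B \<subseteq> U"
      "flow_box c U e \<epsilon> M B"
      by (rule flow_box_exists[OF inT[OF s0]])
    note aD = adaptedD[OF fb(1)]
    have zc: "?z \<in> fst c" using aD(3,12) by blast
    obtain U' where U': "openin T U'" "?z \<in> U'" "U' \<subseteq> fst c" "{y\<in>U'. snd c y \<bullet> e = snd c ?z \<bullet> e} \<subseteq> S"
      by (rule leaf_nhd[OF S aD(9) zc])
    obtain N \<delta>1 where N: "openin T N" "?z \<in> N" "\<delta>1 > 0" "\<forall>y\<in>N. \<forall>s. \<bar>s\<bar> < \<delta>1 \<longrightarrow> flow y s \<in> U'"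
      by (rule flow_near[OF U'(1,2)])
    have "open (J \<inter> \<eta> -` (B \<inter> N))"
      by (rule curve_open_preimage[OF amb(2) J(1) openin_Int[OF fb(4) N(1)]])
    moreover have "s0 \<in> J \<inter> \<eta> -` (B \<inter> N)" using s0 J(2) fb(5) N(2) by auto
    ultimately obtain \<delta>2 where \<delta>2: "\<delta>2 > 0" "ball s0 \<delta>2 \<subseteq> J \<inter> \<eta> -` (B \<inter> N)"
      by (rule openE)
    obtain \<delta>3 where \<delta>3: "\<delta>3 > 0" "\<And>s. s \<in> {a..b} \<Longrightarrow> dist s s0 < \<delta>3 \<Longrightarrow> dist (\<sigma> s) (\<sigma> s0) < min \<delta>1 \<epsilon>"
      using cont\<sigma> s0 N(3) fb(2) unfolding continuous_on_iff by (metis min_less_iff_conj)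
    let ?I = "{a..b} \<inter> ball s0 \<delta>2"
    have inB: "\<eta> s \<in> B" "\<eta> s \<in> N" "s \<in> J" if "s \<in> ?I" for s using \<delta>2(2) that by auto
    have "((\<lambda>s. snd c (\<eta> s) \<bullet> e - \<sigma> s) has_real_derivative 0) (at s within ?I)" if s: "s \<in> ?I" for s
    proof -
      have "\<eta> s \<in> fst c" using inB(1)[OF s] fb(6) aD(12) by blast
      from prim_curve[OF aD(9) amb(1) inB(3)[OF s] this]
      have "((\<lambda>s. snd c (\<eta> s) \<bullet> e) has_real_derivative w s) (at s within ?I)"
        by (simp add: w_def o_def has_field_derivative_at_within)
      moreover have "(\<sigma> has_real_derivative w s) (at s within ?I)"
        by (rule DERIV_subset[OF d\<sigma>]) (use s in auto)
      ultimately show ?thesis using DERIV_diff by fastforce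
    qed
    from has_field_derivative_zero_constant[OF convex_Int[OF convex_real_interval(5) convex_ball] this]
    obtain k where k: "\<And>s. s \<in> ?I \<Longrightarrow> snd c (\<eta> s) \<bullet> e - \<sigma> s = k" by metis
    have "flow (\<eta> s) (\<sigma> s0 - \<sigma> s) \<in> S" if s: "s \<in> {a..b}" "dist s s0 < min \<delta>2 \<delta>3" for s
    proof -
      have sI: "s \<in> ?I" "s0 \<in> ?I" using s s0 \<delta>2(1) by (auto simp: dist_commute)
      have sm: "\<bar>\<sigma> s0 - \<sigma> s\<bar> < \<delta>1" "\<bar>\<sigma> s0 - \<sigma> s\<bar> \<le> \<epsilon>"
        using \<delta>3(2)[of s] s by (auto simp: dist_real_def abs_minus_commute)
      have "flow (\<eta> s) (\<sigma> s0 - \<sigma> s) \<in> U'" using N(4) inB(2)[OF sI(1)] sm(1) by blast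
      moreover have "snd c (flow (\<eta> s) (\<sigma> s0 - \<sigma> s)) \<bullet> e = snd c (\<eta> s) \<bullet> e + (\<sigma> s0 - \<sigma> s)"
        using flow_boxD(1)[OF fb(7), rule_format, of "flow (\<eta> s)" 0 "\<sigma> s0 - \<sigma> s"] flow(1,2)[OF inT[OF s(1)]] inB(1)[OF sI(1)] sm(2) by simp
      moreover have "snd c (\<eta> s) \<bullet> e - \<sigma> s = snd c ?z \<bullet> e - \<sigma> s0"
        using k[OF sI(1)] k[OF sI(2)] by simp
      ultimately show ?thesis using U'(4) by auto
    qed
    moreover have "min \<delta>2 \<delta>3 > 0" using \<delta>2(1) \<delta>3(1) by simp
    ultimately show ?thesis by blast
  qed
  \<comment> \<open>The remaining time \<open>\<tau> - \<sigma> s0\<close> is fixed, and the flow for a fixed time is continuous for the leaf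
    topology.\<close>
  have cont: "continuous_map (top_of_set {a..b}) leaf_top (\<lambda>s. flow (\<eta> s) (\<tau> - \<sigma> s))" for \<tau>
    unfolding continuous_map_def
  proof (intro conjI allI impI)
    show "(\<lambda>s. flow (\<eta> s) (\<tau> - \<sigma> s)) \<in> topspace (top_of_set {a..b}) \<rightarrow> topspace leaf_top"
      using flow(3) inT by auto
    fix S assume S: "openin leaf_top S"
    have "\<exists>\<delta>>0. \<forall>s\<in>{a..b}. dist s s0 < \<delta> \<longrightarrow> flow (\<eta> s) (\<tau> - \<sigma> s) \<in> S"
      if s0: "s0 \<in> {a..b}" "flow (\<eta> s0) (\<tau> - \<sigma> s0) \<in> S" for s0
    proof -
      obtain U where U: "openin leaf_top U" "\<eta> s0 \<in> U" "\<And>y. y \<in> U \<Longrightarrow> flow y (\<tau> - \<sigma> s0) \<in> S"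
        using leaf_cont_all[OF inT[OF s0(1)], of "\<tau> - \<sigma> s0", unfolded leaf_cont_def, rule_format, OF conjI, OF S s0(2)] by blast
      obtain \<delta> where \<delta>: "\<delta> > 0" "\<forall>s\<in>{a..b}. dist s s0 < \<delta> \<longrightarrow> flow (\<eta> s) (\<sigma> s0 - \<sigma> s) \<in> U"
        using near[OF s0(1) U(1,2)] by blast
      have "flow (\<eta> s) (\<tau> - \<sigma> s) \<in> S" if s: "s \<in> {a..b}" "dist s s0 < \<delta>" for s
      proof -
        have "flow (flow (\<eta> s) (\<sigma> s0 - \<sigma> s)) (\<tau> - \<sigma> s0) \<in> S" using \<delta>(2) s U(3) by blast
        then show ?thesis using flow_add[OF inT[OF s(1)]] by simp
      qed
      then show ?thesis using \<delta>(1) by blast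
    qed
    then show "openin (top_of_set {a..b}) {s \<in> topspace (top_of_set {a..b}). flow (\<eta> s) (\<tau> - \<sigma> s) \<in> S}"
      unfolding openin_euclidean_subtopology_iff by auto
  qed
  have "flow (\<eta> b) (\<tau> - \<sigma> b) \<in> leaf_set p" if \<tau>: "flow (\<eta> a) \<tau> \<in> leaf_set p" for \<tau>
  proof -
    let ?x = "\<lambda>s. flow (\<eta> s) (\<tau> - \<sigma> s)"
    have "connectedin (top_of_set {a..b}) {a..b}" by (simp add: connectedin_subtopology)
    then have "connectedin leaf_top (?x ` {a..b})" by (rule connectedin_continuous_map_image[OF cont])
    moreover have "?x a \<in> ?x ` {a..b}" using ab by auto
    ultimately have "?x ` {a..b} \<subseteq> leaf_set (?x a)" by (rule connected_component_of_maximal)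
    moreover have "?x a = flow (\<eta> a) \<tau>" by (simp add: \<sigma>_def)
    moreover have "?x b \<in> ?x ` {a..b}" using ab by auto
    ultimately show ?thesis using leaf_set_eq[OF \<tau>] by (metis subsetD)
  qed
  moreover have "\<bar>\<sigma> b\<bar> \<le> integral {a..b} (speed \<eta>)"
    unfolding \<sigma>_def real_norm_def[symmetric]
  proof (rule integral_norm_bound_integral)
    show "w integrable_on {a..b}" by (rule integrable_continuous_interval[OF contw])
    show "speed \<eta> integrable_on {a..b}"
      by (rule integrable_continuous_interval[OF continuous_on_subset[OF curve_density_continuous(2)[OF J(1) \<eta>] J(2)]])
    show "norm (w s) \<le> speed \<eta> s" if "s \<in> {a..b}" for s
      unfolding w_def real_norm_def
      by (rule rigged_metric_nonneg[OF inT[OF that] smooth_curve_velocity_tangent[OF submfd J(1) \<eta>]])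
        (use that J(2) in auto)
  qed
  ultimately show ?thesis using that by blast
qed

text \<open>The rigged metric bounds \<open>\<omega>\<close>, so the total time of the transport along a path is at most the
  length of the path.\<close>

lemma path_in_tube:
  assumes \<gamma>: "\<gamma> \<in> paths p q" and p: "p \<in> topspace T"
  shows "q \<in> tube p (curve_length A h \<gamma>)"
proof -
  obtain K where K: "pw T K \<gamma>" "\<gamma> 0 = p" "\<gamma> 1 = q" by (rule pathsE[OF \<gamma>])
  have "\<gamma> 1 \<in> topspace T \<and> speed \<gamma> integrable_on {0..1} \<and>
    (\<exists>\<sigma>. \<bar>\<sigma>\<bar> \<le> integral {0..1} (speed \<gamma>) \<and> flow (\<gamma> 1) (- \<sigma>) \<in> leaf_set p)"
  proof (rule pw_induct[OF K(1), of "\<lambda>t. \<gamma> t \<in> topspace T \<and> speed \<gamma> integrable_on {0..t} \<and>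
      (\<exists>\<sigma>. \<bar>\<sigma>\<bar> \<le> integral {0..t} (speed \<gamma>) \<and> flow (\<gamma> t) (- \<sigma>) \<in> leaf_set p)"])
    have "p \<in> leaf_set p" using p by (simp add: connected_component_of_refl)
    then show "\<gamma> 0 \<in> topspace T \<and> speed \<gamma> integrable_on {0..0} \<and>
      (\<exists>\<sigma>. \<bar>\<sigma>\<bar> \<le> integral {0..0} (speed \<gamma>) \<and> flow (\<gamma> 0) (- \<sigma>) \<in> leaf_set p)"
      using K(2) p flow(2)[OF p] integrable_on_refl[of "speed \<gamma>" 0] by (auto intro!: exI[of _ 0])
  next
    fix s t :: real
    assume s: "s \<in> {0..1}" and st: "s < t" and seg: "smooth_segment A T s t \<gamma>"
      and IH: "\<gamma> s \<in> topspace T \<and> speed \<gamma> integrable_on {0..s} \<and>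
        (\<exists>\<sigma>. \<bar>\<sigma>\<bar> \<le> integral {0..s} (speed \<gamma>) \<and> flow (\<gamma> s) (- \<sigma>) \<in> leaf_set p)"
    obtain \<sigma> where \<sigma>: "\<bar>\<sigma>\<bar> \<le> integral {0..s} (speed \<gamma>)" "flow (\<gamma> s) (- \<sigma>) \<in> leaf_set p" using IH by blast
    obtain J \<eta> where J: "open J" "{s..t} \<subseteq> J" "smooth_curve A T J \<eta>" "\<forall>r\<in>{s..t}. \<gamma> r = \<eta> r"
      using seg unfolding smooth_segment_def by blast
    obtain \<sigma>' where \<sigma>': "\<bar>\<sigma>'\<bar> \<le> integral {s..t} (speed \<eta>)"
      "\<forall>\<tau>. flow (\<eta> s) \<tau> \<in> leaf_set p \<longrightarrow> flow (\<eta> t) (\<tau> - \<sigma>') \<in> leaf_set p"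
      by (rule transport_along_curve[OF J(1-3) less_imp_le[OF st]])
    have ends: "\<eta> s = \<gamma> s" "\<eta> t = \<gamma> t" using J(4) st by auto
    have "t \<in> J" using J(2) st by auto
    from smooth_curve_ambient(3)[OF submfd J(1,3) this]
    have t: "\<gamma> t \<in> topspace T" by (simp only: ends)
    have int: "speed \<gamma> integrable_on {0..t}"
      using IH st s by (intro Henstock_Kurzweil_Integration.integrable_combine[OF _ _ _ segment_speed_integrable[OF seg], of 0]) auto
    have "integral {s..t} (speed \<eta>) = integral {s..t} (speed \<gamma>)"
    proof (rule integral_spike[of "{s, t}"])
      show "speed \<gamma> x = speed \<eta> x" if "x \<in> {s..t} - {s, t}" for x
        by (rule speed_cong[of "{s<..<t}"]) (use that J(4) in auto)
    qed auto
    then have "\<bar>\<sigma> + \<sigma>'\<bar> \<le> integral {0..s} (speed \<gamma>) + integral {s..t} (speed \<gamma>)"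
      using \<sigma>(1) \<sigma>'(1) by linarith
    also have "\<dots> = integral {0..t} (speed \<gamma>)"
      by (rule Henstock_Kurzweil_Integration.integral_combine[OF _ _ int]) (use s st in auto)
    finally have "\<bar>\<sigma> + \<sigma>'\<bar> \<le> integral {0..t} (speed \<gamma>)" .
    moreover have "flow (\<gamma> t) (- (\<sigma> + \<sigma>')) \<in> leaf_set p"
      using \<sigma>'(2)[rule_format, of "- \<sigma>"] \<sigma>(2) ends by simp
    ultimately show "\<gamma> t \<in> topspace T \<and> speed \<gamma> integrable_on {0..t} \<and>
        (\<exists>\<sigma>. \<bar>\<sigma>\<bar> \<le> integral {0..t} (speed \<gamma>) \<and> flow (\<gamma> t) (- \<sigma>) \<in> leaf_set p)"
      using t int by blast
  qed
  then obtain \<sigma> where \<sigma>: "q \<in> topspace T" "\<bar>\<sigma>\<bar> \<le> curve_length A h \<gamma>" "flow q (- \<sigma>) \<in> leaf_set p"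
    unfolding K(3) curve_length_def by blast
  have "flow (flow q (- \<sigma>)) \<sigma> = q"
    using flow_add[OF \<sigma>(1), of "- \<sigma>" \<sigma>] flow(2)[OF \<sigma>(1)] by simp
  moreover have "\<sigma> \<in> {- curve_length A h \<gamma>..curve_length A h \<gamma>}" using \<sigma>(2) by auto
  ultimately show ?thesis
    unfolding tube_def using \<sigma>(3) by (intro image_eqI[of _ _ "(\<sigma>, flow q (- \<sigma>))"]) auto
qed

lemma tube_mono: "r \<le> r' \<Longrightarrow> tube p r \<subseteq> tube p r'"
  unfolding tube_def by (intro image_mono) auto

text \<open>A Cauchy sequence stays in a bounded set, hence in a compact tube, and a cluster point for the
  topology of the hypersurface is a limit for the distance.\<close>

lemma rigged_metric_complete:
  assumes conn: "connected_space T"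
  shows "riemannian_complete A T h"
proof -
  interpret M: Metric_space "topspace T" dst by (rule distance_metric_space[OF conn])
  have "M.mcomplete"
    unfolding M.mcomplete_def
  proof (intro allI impI)
    fix \<sigma> assume \<sigma>: "M.MCauchy \<sigma>"
    have inT: "\<sigma> n \<in> topspace T" for n using \<sigma> by (auto simp: M.MCauchy_def)
    have cauchy: "\<exists>N. \<forall>n n'. N \<le> n \<longrightarrow> N \<le> n' \<longrightarrow> dst (\<sigma> n) (\<sigma> n') < r" if "r > 0" for r
      using \<sigma> that by (simp add: M.MCauchy_def)
    obtain n0 where n0: "\<And>n n'. n0 \<le> n \<Longrightarrow> n0 \<le> n' \<Longrightarrow> dst (\<sigma> n) (\<sigma> n') < 1"
      using cauchy[of 1] by auto
    let ?K = "tube (\<sigma> n0) 1"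
    have inK: "\<sigma> n \<in> ?K" if n: "n \<ge> n0" for n
    proof -
      obtain \<gamma> where \<gamma>: "\<gamma> \<in> paths (\<sigma> n0) (\<sigma> n)" "curve_length A h \<gamma> < 1"
        by (rule distance_approx[OF paths_connected[OF conn inT inT] n0[OF order_refl n]])
      show ?thesis
        using path_in_tube[OF \<gamma>(1) inT] tube_mono[OF less_imp_le[OF \<gamma>(2)]] by blast
    qed
    obtain x where x: "x \<in> ?K" "\<forall>S. openin T S \<longrightarrow> x \<in> S \<longrightarrow> infinite {n. \<sigma> n \<in> S}"
      by (rule compactin_cluster_point[OF compactin_tube[OF inT] inK])
    have xT: "x \<in> topspace T"
      using x(1) compactin_subset_topspace[OF compactin_tube[OF inT]] by blast
    have "limitin M.mtopology \<sigma> x sequentially"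
      unfolding M.limitin_metric
    proof (intro conjI allI impI xT)
      fix r :: real assume r: "r > 0"
      obtain n1 where n1: "\<And>n n'. n1 \<le> n \<Longrightarrow> n1 \<le> n' \<Longrightarrow> dst (\<sigma> n) (\<sigma> n') < r / 2"
        using cauchy[of "r / 2"] r by auto
      have "r / 2 > 0" using r by simp
      then obtain N where N: "openin T N" "x \<in> N" "\<forall>y\<in>N. paths x y \<noteq> {} \<and> dst x y < r / 2"
        by (rule distance_nhd[OF xT])
      obtain m where m: "m \<ge> n1" "\<sigma> m \<in> N"
        using x(2) N(1,2) unfolding infinite_nat_iff_unbounded_le by blast
      have "dst (\<sigma> n) x < r" if n: "n \<ge> n1" for n
      proof -
        have "dst (\<sigma> n) x \<le> dst (\<sigma> n) (\<sigma> m) + dst (\<sigma> m) x" by (rule M.triangle[OF inT inT xT])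
        moreover have "dst (\<sigma> m) x < r / 2" using N(3) m(2) distance_commute[of x "\<sigma> m"] by auto
        ultimately show ?thesis using n1[OF n m(1)] by linarith
      qed
      then show "\<forall>\<^sub>F n in sequentially. \<sigma> n \<in> topspace T \<and> dst (\<sigma> n) x < r"
        using inT unfolding eventually_sequentially by blast
    qed
    then show "\<exists>x. limitin M.mtopology \<sigma> x sequentially" by blast
  qed
  then show ?thesis
    unfolding riemannian_complete_def using M.Metric_space_axioms by blast
qed

end

theorem theorem4p9:
  fixes A :: "('a::{t2_space, second_countable_topology}, 'e::euclidean_space) chart set"
    and g :: "'a \<Rightarrow> ('a, 'e) tvec \<Rightarrow> ('a, 'e) tvec \<Rightarrow> real"
    and T :: "'a topology"
    and W :: "'a set"
    and \<zeta> :: "'a \<Rightarrow> ('a, 'e) tvec"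
    and n :: nat
  assumes "smooth_atlas A"
    and "DIM('e) = n + 2"
    and "lorentzian_metric A g"
    and "closed_normalization A g T W \<zeta>"
    and "connected_space T"
    and "\<not> compact_space T"
    and "complete_vector_field A T (rigged_vector_field A g T \<zeta>)"
    and "\<And>L. leaf A T (screen_distribution A g T \<zeta>) L \<Longrightarrow> compact_space L"
  shows "riemannian_complete A T (rigged_metric g \<zeta>)"
proof -
  interpret complete_normalization A g T W \<zeta>
    using assms by unfold_locales auto
  show ?thesis by (rule rigged_metric_complete[OF assms(5)])
qed

end
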